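(* Let $k\ge 1$ be an integer and let $M$ be a formally symmetric differential expression of even order $m=2k$ on $[0,\infty)$, $$M[y]=\sum_{r=0}^{k}(-1)^r\bigl(s_r y^{(r)}\bigr)^{(r)}+\frac12\sum_{r=0}^{k-1} i^{2r+1}\Bigl\{\bigl(q_r y^{(r)}\bigr)^{(r+1)}+\bigl(q_r y^{(r+1)}\bigr)^{(r)}\Bigr\},$$ where the coefficients are real-valued on $[0,\infty)$, $s_r\in C^{(r)}([0,\infty))$ for $0\le r\le k$, $q_r\in C^{(r+1)}([0,\infty))$ for $0\le r\le k-1$, and $s_k(x)>0$ for all $x\in[0,\infty)$. Let $\Delta$ be the maximal domain of $M$ in $L^2(0,\infty)$, and for $f,g\in\Delta$ let $[fg](\infty)=\lim_{x\to\infty}[fg](x)$, where $[fg](x)$ is the sesquilinear form of Green's formula for $M$. (Necessity) Let $p,q$ be integers with $0\le p,q\le k$ and put $n=p+q$. If $M$ is in the limit $(k+p,k+q)$ case at $\infty$, then $$\det_{1\le r,s\le n+1}\bigl[[f_r g_s](\infty)\bigr]=0\quad\text{for all } f_1,\dots,f_{n+1},g_1,\dots,g_{n+1}\in\Delta .$$ (Converse) Let $n$ be an integer with $0\le n\le 2k$. If $$\det_{1\le r,s\le n+1}\bigl[[f_r g_s](\infty)\bigr]=0\quad\text{for all } f_1,\dots,f_{n+1},g_1,\dots,g_{n+1}\in\Delta ,$$ then $M$ is in the limit $(k+p,k+q)$ case at $\infty$ for some integers $0\le p,q\le k$ with $p+q\le n$. More precisely, $p+q=n$ if $$\det_{1\le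 r,s\le n+1}\bigl[[f_r g_s](\infty)\bigr]=0\quad\text{for all } f_1,\dots,f_{n+1},g_1,\dots,g_{n+1}\in\Delta$$ but $$\det_{1\le r,s\le n}\bigl[[f_r g_s](\infty)\bigr]\ne 0\quad\text{for some } f_1,\dots,f_n,g_1,\dots,g_n\in\Delta .$$
   Context: Let $m$ denote the order of $M$. The maximal domain is $$\Delta=\{f\in L^2(0,\infty): f^{(m-1)}\in AC_{\rm loc}(0,\infty)\ \text{and}\ M[f]\in L^2(0,\infty)\},$$ where functions are complex-valued and $AC_{\rm loc}$ means absolutely continuous on all compact subintervals. Sesquilinear form: $[fg](x)$ is the integrated term in Green's formula $$\int_0^x\bigl\{\overline{g}\,M[f]-f\,\overline{M[g]}\bigr\}\,dt=[fg](x)-[fg](0),$$ valid for $f,g$ with $f^{(m-1)},g^{(m-1)}$ locally absolutely continuous. It is obtained by integration by parts and has the form $[fg](x)=\sum_{j,l=0}^{m-1}B_{jl}(x)f^{(j)}(x)\overline{g^{(l)}(x)}$ with continuous functions $B_{jl}$ on $[0,\infty)$ determined by the coefficients of $M$; it is the unique form of this type for which Green's formula holds for all such $f,g$. It is linear in $f$, conjugate-linear in $g$, non-singular at each $x$, and satisfies $[gf](x)=-\overline{[fg](x)}$. For $f,g\in\Delta$ the limit $[fg](\infty)=\lim_{x\to\infty}[fg](x)$ exists and is finite. Limit classification: $T_{\max}$ is the operator in $L^2(0,\infty)$ with domain $\Delta$ and $T_{\max}f=M[f]$; $T_{\min}$ is its restriction to $\{f\in\Delta:[fg](0)=[fg](\infty)=0\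 \text{for all } g\in\Delta\}$. $T_{\min}$ is closed and symmetric with $T_{\min}^*=T_{\max}$. The deficiency indices are $N_\pm=\dim\{f\in\Delta: M[f]=\pm i f\}$; equivalently, $N_+$ (respectively $N_-$) is the number of linearly independent solutions of $M[y]=\lambda y$ on $[0,\infty)$ lying in $L^2(0,\infty)$, for any $\lambda$ with $\operatorname{Im}\lambda>0$ (respectively $\operatorname{Im}\lambda<0$). $M$ is said to be in the limit $(N_+,N_-)$ case at $\infty$ if the deficiency indices of $T_{\min}$ are $(N_+,N_-)$. Convention: a determinant of size $0$ equals $1$. *)

theory Defs
  imports
    "HOL-Analysis.Analysis"
    "HOL-Library.Function_Algebras"
    "Jordan_Normal_Form.Determinant"
begin

section \<open>Calculus on the half-line\<close>

text \<open>The derivative is taken within \<open>{0..}\<close>, so it is one-sided at \<open>0\<close> and for \<open>x \<ge> 0\<close> it depends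
  only on the values of the function on \<open>[0,\<infinity>)\<close>.\<close>

definition hderiv :: "(real \<Rightarrow> 'a::real_normed_vector) \<Rightarrow> real \<Rightarrow> 'a" where
  "hderiv f = (\<lambda>x. vector_derivative f (at x within {0..}))"

definition D :: "nat \<Rightarrow> (real \<Rightarrow> 'a::real_normed_vector) \<Rightarrow> real \<Rightarrow> 'a" where
  "D n f = (hderiv ^^ n) f"

definition C_half :: "nat \<Rightarrow> (real \<Rightarrow> 'a::real_normed_vector) \<Rightarrow> bool" where
  "C_half n f \<longleftrightarrow> (\<forall>j<n. D j f differentiable_on {0..}) \<and> continuous_on {0..} (D n f)"

definition abs_cont_on :: "real \<Rightarrow> real \<Rightarrow> (real \<Rightarrow> complex) \<Rightarrow> bool" where
  "abs_cont_on a b f \<longleftrightarrow>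
     (\<forall>\<epsilon>>0. \<exists>\<delta>>0. \<forall>(N::nat) u v.
        (\<forall>i<N. a \<le> u i \<and> u i \<le> v i \<and> v i \<le> b) \<and>
        (\<forall>i<N. \<forall>j<N. i \<noteq> j \<longrightarrow> {u i<..<v i} \<inter> {u j<..<v j} = {}) \<and>
        (\<Sum>i<N. v i - u i) < \<delta> \<longrightarrow>
        (\<Sum>i<N. norm (f (v i) - f (u i))) < \<epsilon>)"

definition AC_loc :: "(real \<Rightarrow> complex) \<Rightarrow> bool" where
  "AC_loc f \<longleftrightarrow> (\<forall>a b. 0 \<le> a \<longrightarrow> a \<le> b \<longrightarrow> abs_cont_on a b f)"

definition L2 :: "(real \<Rightarrow> complex) \<Rightarrow> bool" where
  "L2 f \<longleftrightarrow> f \<in> borel_measurable (lebesgue_on {0<..}) \<and>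
     integrable (lebesgue_on {0<..}) (\<lambda>x. (norm (f x))\<^sup>2)"


section \<open>The differential expression and its maximal domain\<close>

definition M_expr ::
  "nat \<Rightarrow> (nat \<Rightarrow> real \<Rightarrow> real) \<Rightarrow> (nat \<Rightarrow> real \<Rightarrow> real) \<Rightarrow> (real \<Rightarrow> complex) \<Rightarrow> real \<Rightarrow> complex" where
  "M_expr k s q y x =
     (\<Sum>r\<le>k. (-1)^r * D r (\<lambda>t. of_real (s r t) * D r y t) x)
     + 1/2 * (\<Sum>r<k. \<i>^(2*r+1) *
         (D (r+1) (\<lambda>t. of_real (q r t) * D r y t) x
          + D r (\<lambda>t. of_real (q r t) * D (r+1) y t) x))"

text \<open>Elements of \<open>L\<^sup>2(0,\<infinity>)\<close> whose class contains a function with the required smoothness are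
  represented by that (unique) continuous function on \<open>[0,\<infinity>)\<close>, extended by \<open>0\<close> to the negative
  half-line; the extension keeps dimensions of spaces of such functions correct.
  Differentiability of the derivatives of order below \<open>2k - 1\<close> is part of the statement that the
  derivative of order \<open>2k - 1\<close> exists.\<close>

definition Delta ::
  "nat \<Rightarrow> (nat \<Rightarrow> real \<Rightarrow> real) \<Rightarrow> (nat \<Rightarrow> real \<Rightarrow> real) \<Rightarrow> (real \<Rightarrow> complex) set" where
  "Delta k s q =
     {f. (\<forall>x<0. f x = 0) \<and> L2 f \<and>
         (\<forall>j<2*k-1. D j f differentiable_on {0..}) \<and> AC_loc (D (2*k-1) f) \<and>
         L2 (M_expr k s q f)}"


section \<open>The form of Green's formula\<close>

text \<open>\<open>ibp r U g\<close> is the integrated term of an \<open>r\<close>-fold integration by parts: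
  \<open>\<integral> U\<^sup>(\<^sup>r\<^sup>) cnj g = ibp r U g + (-1)^r \<integral> U cnj (g\<^sup>(\<^sup>r\<^sup>))\<close>.\<close>

definition ibp :: "nat \<Rightarrow> (real \<Rightarrow> complex) \<Rightarrow> (real \<Rightarrow> complex) \<Rightarrow> real \<Rightarrow> complex" where
  "ibp r U g x = (\<Sum>j<r. (-1)^j * D (r-1-j) U x * cnj (D j g x))"

text \<open>Applying \<open>ibp\<close> to every term of \<open>\<integral> (cnj g * M[f] - f * cnj M[g])\<close>; the remaining integrals
  cancel. The sign in front of the conjugated \<open>q\<close>-terms comes from \<open>cnj (\<i>^(2r+1)) = - \<i>^(2r+1)\<close>.
  Lemma \<open>lagrange_identity\<close> below is Green's formula in differentiated form.\<close>

definition green_form ::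
  "nat \<Rightarrow> (nat \<Rightarrow> real \<Rightarrow> real) \<Rightarrow> (nat \<Rightarrow> real \<Rightarrow> real) \<Rightarrow>
   (real \<Rightarrow> complex) \<Rightarrow> (real \<Rightarrow> complex) \<Rightarrow> real \<Rightarrow> complex" where
  "green_form k s q f g x =
     (\<Sum>r\<le>k. (-1)^r *
        (ibp r (\<lambda>t. of_real (s r t) * D r f t) g x
         - cnj (ibp r (\<lambda>t. of_real (s r t) * D r g t) f x)))
     + 1/2 * (\<Sum>r<k. \<i>^(2*r+1) *
        (ibp (r+1) (\<lambda>t. of_real (q r t) * D r f t) g x
         + ibp r (\<lambda>t. of_real (q r t) * D (r+1) f t) g x
         + cnj (ibp (r+1) (\<lambda>t. of_real (q r t) * D r g t) f x
                + ibp r (\<lambda>t. of_real (q r t) * D (r+1) g t) f x)))"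

text \<open>Differentiable \<open>n\<close> times on \<open>[0,\<infinity>)\<close> and once more at the point \<open>x\<close>; only used to prove
  \<open>lagrange_identity\<close>.\<close>

definition dd :: "nat \<Rightarrow> real \<Rightarrow> (real \<Rightarrow> 'a::real_normed_vector) \<Rightarrow> bool" where
  "dd n x u \<longleftrightarrow> (\<forall>j<n. D j u differentiable_on {0..}) \<and> D n u differentiable (at x within {0..})"

lemma D_0 [simp]: "D 0 f = f"
  by (simp add: D_def)

lemma D_Suc: "D (Suc n) f = hderiv (D n f)"
  by (simp add: D_def)

lemma D_Suc': "D (Suc n) f = D n (hderiv f)"
  by (simp only: D_def funpow_Suc_right o_def)

lemma D_add: "D m (D n f) = D (m + n) f"
  by (simp add: D_def funpow_add)

lemma hderiv_eqI:
  "(f has_vector_derivative f') (at x within {0..}) \<Longrightarrow> 0 \<le> x \<Longrightarrow> hderiv f x = f'"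
proof -
  assume a: "(f has_vector_derivative f') (at x within {0..})" "0 \<le> x"
  have "at x within {0..} \<noteq> bot"
  proof -
    have "at x within {x..x+1} \<noteq> bot" by (simp add: at_within_Icc_at_right trivial_limit_at_right_real)
    moreover have "{x..x+1} \<subseteq> {0..}" using a(2) by auto
    ultimately show ?thesis using at_le bot.extremum_uniqueI by metis
  qed
  then show "hderiv f x = f'"
    unfolding hderiv_def by (rule vector_derivative_within[OF _ a(1)])
qed

lemma hderiv_has:
  "f differentiable (at x within {0..}) \<Longrightarrow> (f has_vector_derivative hderiv f x) (at x within {0..})"
  unfolding hderiv_def by (simp add: vector_derivative_works)

lemma hderiv_cong:
  assumes "\<And>t. 0 \<le> t \<Longrightarrow> f t = g t" "0 \<le> x"
  shows "hderiv f x = hderiv g x"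
proof -
  have "(f has_vector_derivative d) (at x within {0..}) = (g has_vector_derivative d) (at x within {0..})" for d
    using assms has_vector_derivative_transform[of x "{0..}" f g d]
      has_vector_derivative_transform[of x "{0..}" g f d] by auto
  then show ?thesis unfolding hderiv_def vector_derivative_def by simp
qed

lemma D_cong:
  assumes "\<And>t. 0 \<le> t \<Longrightarrow> f t = g t" "0 \<le> x"
  shows "D n f x = D n g x"
  using assms(2)
proof (induction n arbitrary: x)
  case 0 then show ?case using assms by simp
next
  case (Suc n)
  then show ?case unfolding D_Suc by (intro hderiv_cong) auto
qed

lemma diff_cong:
  assumes "\<And>t. 0 \<le> t \<Longrightarrow> f t = g t" "0 \<le> x"
  shows "f differentiable (at x within {0..}) \<longleftrightarrow> g differentiable (at x within {0..})"
  using assms differentiable_transform_within[of f x "{0..}" 1 g]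
    differentiable_transform_within[of g x "{0..}" 1 f] by auto

lemma dd_cong:
  assumes "\<And>t. 0 \<le> t \<Longrightarrow> f t = g t" "0 \<le> x"
  shows "dd n x f \<longleftrightarrow> dd n x g"
proof -
  have *: "D j f differentiable (at y within {0..}) \<longleftrightarrow> D j g differentiable (at y within {0..})"
    if "0 \<le> y" for j y
    using that by (intro diff_cong D_cong assms) auto
  then show ?thesis using assms(2) by (auto simp: dd_def differentiable_on_def)
qed

lemma dd_Suc: "dd (Suc n) x u \<longleftrightarrow> u differentiable_on {0..} \<and> dd n x (hderiv u)"
  unfolding dd_def All_less_Suc2 D_Suc' D_0 by blast

lemma dd_mono: "dd n x u \<Longrightarrow> m \<le> n \<Longrightarrow> 0 \<le> x \<Longrightarrow> dd m x u"
  unfolding dd_def differentiable_on_def by (cases "m = n") auto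

lemma dd_D: "dd n x u \<Longrightarrow> m + j \<le> n \<Longrightarrow> 0 \<le> x \<Longrightarrow> dd m x (D j u)"
  by (drule dd_mono[of n x u "m + j"]) (auto simp: dd_def D_add)

lemma dd_add:
  fixes u v :: "real \<Rightarrow> 'a::real_normed_vector"
  assumes "dd n x u" "dd n x v" "0 \<le> x"
  shows "dd n x (\<lambda>t. u t + v t)"
  using assms
proof (induction n arbitrary: u v)
  case 0 then show ?case by (auto simp: dd_def)
next
  case (Suc n)
  have *: "hderiv (\<lambda>t. u t + v t) t = hderiv u t + hderiv v t" if "0 \<le> t" for t
    using Suc.prems that
    by (intro hderiv_eqI has_vector_derivative_add hderiv_has) (auto simp: dd_Suc differentiable_on_def)
  have "dd n x (\<lambda>t. hderiv u t + hderiv v t)"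
    using Suc by (auto simp: dd_Suc)
  then have "dd n x (hderiv (\<lambda>t. u t + v t))"
    using dd_cong[OF * \<open>0 \<le> x\<close>] by simp
  then show ?case using Suc.prems by (auto simp: dd_Suc)
qed

lemma dd_mult:
  fixes u v :: "real \<Rightarrow> complex"
  assumes "dd n x u" "dd n x v" "0 \<le> x"
  shows "dd n x (\<lambda>t. u t * v t)"
  using assms
proof (induction n arbitrary: u v)
  case 0 then show ?case by (auto simp: dd_def)
next
  case (Suc n)
  have *: "hderiv (\<lambda>t. u t * v t) t = u t * hderiv v t + hderiv u t * v t" if "0 \<le> t" for t
    using Suc.prems that
    by (intro hderiv_eqI has_vector_derivative_mult hderiv_has) (auto simp: dd_Suc differentiable_on_def)
  have "dd n x u" "dd n x v" using Suc.prems by (auto intro: dd_mono)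
  then have "dd n x (\<lambda>t. u t * hderiv v t + hderiv u t * v t)"
    using Suc by (intro dd_add Suc.IH) (auto simp: dd_Suc)
  then have "dd n x (hderiv (\<lambda>t. u t * v t))"
    using dd_cong[OF * \<open>0 \<le> x\<close>] by simp
  then show ?case using Suc.prems by (auto simp: dd_Suc differentiable_on_def)
qed

lemma has_of_real:
  "u differentiable (at x within {0..}) \<Longrightarrow>
   ((\<lambda>t. complex_of_real (u t)) has_vector_derivative of_real (hderiv u x)) (at x within {0..})"
  by (intro has_vector_derivative_of_real)
     (simp add: has_real_derivative_iff_has_vector_derivative hderiv_has)

lemma dd_of_real:
  assumes "dd n x u" "0 \<le> x"
  shows "dd n x (\<lambda>t. complex_of_real (u t))"
  using assms
proof (induction n arbitrary: u)
  case 0 then show ?case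
    by (auto simp: dd_def intro!: differentiableI_vector[OF has_of_real])
next
  case (Suc n)
  have *: "hderiv (\<lambda>t. complex_of_real (u t)) t = of_real (hderiv u t)" if "0 \<le> t" for t
    using Suc.prems that
    by (intro hderiv_eqI has_of_real) (auto simp: dd_Suc differentiable_on_def)
  have "dd n x (\<lambda>t. complex_of_real (hderiv u t))"
    using Suc by (auto simp: dd_Suc)
  then have "dd n x (hderiv (\<lambda>t. complex_of_real (u t)))"
    using dd_cong[OF * \<open>0 \<le> x\<close>] by simp
  then show ?case using Suc.prems
    by (auto simp: dd_Suc differentiable_on_def
        intro!: differentiableI_vector[OF has_of_real])
qed

lemma C_half_dd: "C_half n u \<Longrightarrow> m < n \<Longrightarrow> 0 \<le> x \<Longrightarrow> dd m x u"
  by (auto simp: C_half_def dd_def differentiable_on_def)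

lemma dd_coeff:
  assumes "C_half n c" "dd l x u" "0 \<le> x" "m < n" "m + j \<le> l"
  shows "dd m x (\<lambda>t. complex_of_real (c t) * D j u t)"
  using assms by (intro dd_mult dd_of_real C_half_dd[of n c m x] dd_D[of l x u]) auto

lemma dd_has:
  assumes "dd n x u" "j \<le> n" "0 \<le> x"
  shows "(D j u has_vector_derivative D (Suc j) u x) (at x within {0..})"
  using dd_mono[OF assms] unfolding D_Suc by (intro hderiv_has) (auto simp: dd_def)

lemma ibp_deriv:
  assumes U: "r > 0 \<Longrightarrow> dd (r - 1) x U" and g: "r > 0 \<Longrightarrow> dd (r - 1) x g" and x: "0 \<le> x"
  shows "(ibp r U g has_vector_derivative
            (D r U x * cnj (g x) - (-1)^r * U x * cnj (D r g x))) (at x within {0..})"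
proof -
  define c where "c j = (-1)^j * D (r - j) U x * cnj (D j g x)" for j
  have "((\<lambda>t. (-1)^j * D (r-1-j) U t * cnj (D j g t)) has_vector_derivative (c j - c (Suc j)))
          (at x within {0..})" if j: "j < r" for j
  proof -
    have "((\<lambda>t. (-1)^j * (D (r-1-j) U t * cnj (D j g t))) has_vector_derivative
            (-1)^j * (D (r-1-j) U x * cnj (D (Suc j) g x) + D (Suc (r-1-j)) U x * cnj (D j g x)))
          (at x within {0..})"
      using U g x j
      by (intro has_vector_derivative_mult_right has_vector_derivative_mult
          has_vector_derivative_cnj dd_has[where n = "r-1"]) auto
    moreover have e: "Suc (r-1-j) = r - j" using j by auto
    have "c j - c (Suc j) =
        (-1)^j * (D (r-1-j) U x * cnj (D (Suc j) g x) + D (Suc (r-1-j)) U x * cnj (D j g x))"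
      unfolding c_def e by (simp add: distrib_left mult.assoc)
    ultimately show ?thesis by (simp only: mult.assoc)
  qed
  then have "(ibp r U g has_vector_derivative (\<Sum>j<r. c j - c (Suc j))) (at x within {0..})"
    unfolding ibp_def[abs_def] by (intro has_vector_derivative_sum) auto
  moreover have "(\<Sum>j<r. c j - c (Suc j)) = c 0 - c r"
    by (rule sum_lessThan_telescope')
  ultimately show ?thesis by (simp add: c_def)
qed

theorem lagrange_identity:
  assumes s: "\<And>r. r \<le> k \<Longrightarrow> C_half r (s r)" and q: "\<And>r. r < k \<Longrightarrow> C_half (r + 1) (q r)"
    and f: "\<forall>j<2*k-1. D j f differentiable_on {0..}" "D (2*k-1) f differentiable (at x within {0..})"
    and g: "\<forall>j<2*k-1. D j g differentiable_on {0..}" "D (2*k-1) g differentiable (at x within {0..})"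
    and x: "0 \<le> x"
  shows "(green_form k s q f g has_vector_derivative
            (cnj (g x) * M_expr k s q f x - f x * cnj (M_expr k s q g x))) (at x within {0..})"
proof -
  have df: "dd (2*k-1) x f" and dg: "dd (2*k-1) x g" using f g by (auto simp: dd_def)
  define L where "L u r = (\<lambda>t. complex_of_real (s r t) * D r u t)" for u r
  define P where "P u r = (\<lambda>t. complex_of_real (q r t) * D r u t)" for u r
  define Q where "Q u r = (\<lambda>t. complex_of_real (q r t) * D (r+1) u t)" for u r
  have 1: "(ibp r (L u r) v has_vector_derivative
            (D r (L u r) x * cnj (v x) - (-1)^r * L u r x * cnj (D r v x))) (at x within {0..})"
    if "dd (2*k-1) x u" "dd (2*k-1) x v" "r \<le> k" for u v r
  proof (rule ibp_deriv)
    show "dd (r - 1) x (L u r)" if "r > 0"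
      unfolding L_def by (rule dd_coeff[OF s \<open>dd (2*k-1) x u\<close> x]) (use that \<open>r \<le> k\<close> in auto)
    show "dd (r - 1) x v"
      by (rule dd_mono[OF \<open>dd (2*k-1) x v\<close> _ x]) (use \<open>r \<le> k\<close> in auto)
  qed (rule x)
  have 2: "(ibp (r+1) (P u r) v has_vector_derivative
            (D (r+1) (P u r) x * cnj (v x) - (-1)^(r+1) * P u r x * cnj (D (r+1) v x))) (at x within {0..})"
    if "dd (2*k-1) x u" "dd (2*k-1) x v" "r < k" for u v r
  proof (rule ibp_deriv)
    show "dd (r + 1 - 1) x (P u r)" if "r + 1 > 0"
      unfolding P_def by (rule dd_coeff[OF q \<open>dd (2*k-1) x u\<close> x]) (use that \<open>r < k\<close> in auto)
    show "dd (r + 1 - 1) x v"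
      by (rule dd_mono[OF \<open>dd (2*k-1) x v\<close> _ x]) (use \<open>r < k\<close> in auto)
  qed (rule x)
  have 3: "(ibp r (Q u r) v has_vector_derivative
            (D r (Q u r) x * cnj (v x) - (-1)^r * Q u r x * cnj (D r v x))) (at x within {0..})"
    if "dd (2*k-1) x u" "dd (2*k-1) x v" "r < k" for u v r
  proof (rule ibp_deriv)
    show "dd (r - 1) x (Q u r)" if "r > 0"
      unfolding Q_def by (rule dd_coeff[OF q \<open>dd (2*k-1) x u\<close> x]) (use that \<open>r < k\<close> in auto)
    show "dd (r - 1) x v"
      by (rule dd_mono[OF \<open>dd (2*k-1) x v\<close> _ x]) (use \<open>r < k\<close> in auto)
  qed (rule x)
  let ?A = "\<lambda>r. (-1)^r *
        ((D r (L f r) x * cnj (g x) - (-1)^r * L f r x * cnj (D r g x))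
         - cnj (D r (L g r) x * cnj (f x) - (-1)^r * L g r x * cnj (D r f x)))"
  let ?B = "\<lambda>r. \<i>^(2*r+1) *
        ((D (r+1) (P f r) x * cnj (g x) - (-1)^(r+1) * P f r x * cnj (D (r+1) g x))
         + (D r (Q f r) x * cnj (g x) - (-1)^r * Q f r x * cnj (D r g x))
         + cnj ((D (r+1) (P g r) x * cnj (f x) - (-1)^(r+1) * P g r x * cnj (D (r+1) f x))
                + (D r (Q g r) x * cnj (f x) - (-1)^r * Q g r x * cnj (D r f x))))"
  have "(green_form k s q f g has_vector_derivative ((\<Sum>r\<le>k. ?A r) + 1/2 * (\<Sum>r<k. ?B r))) (at x within {0..})"
    unfolding green_form_def[abs_def] L_def[symmetric] P_def[symmetric] Q_def[symmetric]
    by (intro has_vector_derivative_add has_vector_derivative_sum has_vector_derivative_mult_right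
        has_vector_derivative_diff has_vector_derivative_cnj 1 2 3 df dg) auto
  moreover have "?A r = cnj (g x) * ((-1)^r * D r (L f r) x) - f x * cnj ((-1)^r * D r (L g r) x)" for r
    by (simp add: L_def algebra_simps)
  moreover have "?B r = cnj (g x) * (\<i>^(2*r+1) * (D (r+1) (P f r) x + D r (Q f r) x))
      - f x * cnj (\<i>^(2*r+1) * (D (r+1) (P g r) x + D r (Q g r) x))" for r
  proof -
    have i: "cnj (\<i>^(2*r+1)) = - (\<i>^(2*r+1))" by (simp add: power_mult)
    show ?thesis unfolding complex_cnj_mult i
      by (simp add: P_def Q_def algebra_simps)
  qed
  moreover have "cnj (g x) * M_expr k s q f x - f x * cnj (M_expr k s q g x) =
      (\<Sum>r\<le>k. cnj (g x) * ((-1)^r * D r (L f r) x) - f x * cnj ((-1)^r * D r (L g r) x))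
      + 1/2 * (\<Sum>r<k. cnj (g x) * (\<i>^(2*r+1) * (D (r+1) (P f r) x + D r (Q f r) x))
      - f x * cnj (\<i>^(2*r+1) * (D (r+1) (P g r) x + D r (Q g r) x)))"
    unfolding M_expr_def L_def[symmetric] P_def[symmetric] Q_def[symmetric]
      complex_cnj_add complex_cnj_mult cnj_sum sum_subtractf
    by (simp add: sum_distrib_left sum_distrib_right algebra_simps)
  ultimately show ?thesis by simp
qed

definition green_form_inf ::
  "nat \<Rightarrow> (nat \<Rightarrow> real \<Rightarrow> real) \<Rightarrow> (nat \<Rightarrow> real \<Rightarrow> real) \<Rightarrow>
   (real \<Rightarrow> complex) \<Rightarrow> (real \<Rightarrow> complex) \<Rightarrow> complex" where
  "green_form_inf k s q f g = Lim at_top (green_form k s q f g)"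

text \<open>The determinant of \<open>[f\<^sub>i g\<^sub>j](\<infinity>)\<close> with indices running over \<open>0, \<dots>, n - 1\<close>; it is \<open>1\<close> for \<open>n = 0\<close>.\<close>

definition green_det ::
  "nat \<Rightarrow> (nat \<Rightarrow> real \<Rightarrow> real) \<Rightarrow> (nat \<Rightarrow> real \<Rightarrow> real) \<Rightarrow>
   nat \<Rightarrow> (nat \<Rightarrow> real \<Rightarrow> complex) \<Rightarrow> (nat \<Rightarrow> real \<Rightarrow> complex) \<Rightarrow> complex" where
  "green_det k s q n f g = Determinant.det (mat n n (\<lambda>(i, j). green_form_inf k s q (f i) (g j)))"


section \<open>Deficiency indices\<close>

global_interpretation cfun: vector_space "\<lambda>(c::complex) (f::real \<Rightarrow> complex) x. c * f x"
  by unfold_locales (auto simp: fun_eq_iff algebra_simps)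

definition defect_space ::
  "nat \<Rightarrow> (nat \<Rightarrow> real \<Rightarrow> real) \<Rightarrow> (nat \<Rightarrow> real \<Rightarrow> real) \<Rightarrow> complex \<Rightarrow> (real \<Rightarrow> complex) set" where
  "defect_space k s q c =
     {f \<in> Delta k s q. AE x in lebesgue_on {0<..}. M_expr k s q f x = c * f x}"

text \<open>These spaces consist of solutions of a linear equation of order \<open>2k\<close>, so they have finite
  dimension and the library's convention for infinite dimension plays no role.\<close>

definition limit_case ::
  "nat \<Rightarrow> (nat \<Rightarrow> real \<Rightarrow> real) \<Rightarrow> (nat \<Rightarrow> real \<Rightarrow> real) \<Rightarrow> nat \<Rightarrow> nat \<Rightarrow> bool" where
  "limit_case k s q N_plus N_minus \<longleftrightarrow>
     cfun.dim (defect_space k s q \<i>) = N_plus \<and> cfun.dim (defect_space k s q (-\<i>)) = N_minus"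

end

theory Submission
  imports Defs
begin

text \<open>Throughout, \<open>c\<close> is one of \<open>\<plusminus> \<i>\<close>, \<open>E c\<close> is the space of all \<open>f\<close> in the maximal domain with
  \<open>M f = c f\<close> almost everywhere, and \<open>[f g]\<close> is Green's form. Multiplied by \<open>- c\<close>, Green's form is Hermitian at \<open>0\<close> and at
  infinity (\<open>zero_form\<close>, \<open>inf_form\<close>). The theorem is a statement about the inertia of the form at infinity:
  \<open>- \<i> [f g](\<infinity>)\<close> has \<open>N\<^sub>+ - k\<close> positive and \<open>N\<^sub>- - k\<close> negative directions on the maximal domain, hence
  rank \<open>N\<^sub>+ + N\<^sub>- - 2 k\<close>. Determinants of a size greater than the rank vanish, since the form factors
  through a space whose dimension is the rank; those of at most this size are nonzero for members of
  an orthogonal family that realises the rank.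

  The inertia comes from the difference \<open>\<beta>\<close> of the two forms, \<open>\<beta>(f, f) = - c ([f f](\<infinity>) - [f f](0))\<close>.
  By Green's formula \<open>\<beta>(f, f) = 2 \<parallel>f\<parallel>\<^sup>2\<close> on \<open>E c\<close> (\<open>defect_energy\<close>). Conversely \<open>\<beta>(f, f) \<le> 0\<close> whenever
  \<open>M f + c f\<close> is orthogonal to \<open>E c\<close> in \<open>L\<^sup>2\<close> (\<open>boundary_form_nonpos\<close>), so a space on which \<open>\<beta>\<close> is positive
  has at most the dimension of \<open>E c\<close> (\<open>positive_family_bound\<close>). Thus \<open>\<beta>\<close> has exactly \<open>dim (E c)\<close> positive
  directions. Functions with prescribed derivatives at \<open>0\<close> that vanish on \<open>(1, \<infinity>)\<close> decouple the two
  endpoints (\<open>cutoff_exists\<close>), and the form at \<open>0\<close> has \<open>k\<close> positive and \<open>k\<close> negative directions: it is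
  nondegenerate in the \<open>2 k\<close> derivatives of order below \<open>2 k\<close>, and it vanishes on the functions whose
  first \<open>k\<close> of these derivatives are \<open>0\<close> (\<open>zero_form_inertia\<close>). Subtraction leaves \<open>dim (E c) - k\<close> positive
  directions at infinity (\<open>defect_lower_bound\<close>, \<open>defect_upper_bound\<close>), and \<open>c = \<i>\<close> and \<open>c = - \<i>\<close> give the two
  counts (\<open>boundary_form_rank\<close>).

  No operator theory enters. Instead of von Neumann's decomposition of the maximal domain, \<open>f\<close> is
  compared on \<open>[0, b]\<close> with the sum of a solution of \<open>M u = c u\<close> and one of \<open>M y = - c y\<close> that has the same
  boundary values as \<open>f\<close> (\<open>boundary_values\<close>); the limit \<open>b \<rightarrow> \<infinity>\<close> is taken along a sequence for which the
  finitely many coefficients of \<open>u\<close> converge. Elements of the maximal domain only have an absolutely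
  continuous derivative of order \<open>2 k - 1\<close>, so Green's formula rests on Lebesgue's fundamental theorem
  of calculus (\<open>abs_cont_on_FTC\<close>).\<close>

section \<open>Absolutely continuous functions\<close>

text \<open>Any finite index set is admitted, so that subdivisions of all members of a family together form
  a family again, indexed by pairs.\<close>

definition subint_family :: "real \<Rightarrow> real \<Rightarrow> 'i set \<Rightarrow> ('i \<Rightarrow> real) \<Rightarrow> ('i \<Rightarrow> real) \<Rightarrow> bool" where
  "subint_family a b I u v \<longleftrightarrow> finite I \<and> (\<forall>i\<in>I. a \<le> u i \<and> u i \<le> v i \<and> v i \<le> b) \<and>
     (\<forall>i\<in>I. \<forall>j\<in>I. i \<noteq> j \<longrightarrow> {u i<..<v i} \<inter> {u j<..<v j} = {})"

lemma abs_cont_on_iff: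
  "abs_cont_on a b f \<longleftrightarrow> (\<forall>e>0. \<exists>d>0. \<forall>(N::nat) u v. subint_family a b {..<N} u v \<and> (\<Sum>i<N. v i - u i) < d \<longrightarrow>
      (\<Sum>i<N. norm (f (v i) - f (u i))) < e)"
  proof -
  have "subint_family a b {..<N} u v \<longleftrightarrow> (\<forall>i<N. a \<le> u i \<and> u i \<le> v i \<and> v i \<le> b) \<and>
        (\<forall>i<N. \<forall>j<N. i \<noteq> j \<longrightarrow> {u i<..<v i} \<inter> {u j<..<v j} = {})" for N :: nat and u v
    unfolding subint_family_def Ball_def lessThan_iff by blast
  then show ?thesis unfolding abs_cont_on_def by (simp only: conj_assoc)
qed

text \<open>A bijection with an initial segment of the naturals carries the definition of absolute continuity
  over to families with an arbitrary finite index set.\<close>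

lemma abs_cont_on_finite_index:
  assumes "abs_cont_on a b f" "e > 0"
  obtains d where "d > 0"
    and "\<forall>(I::'i set) u v. subint_family a b I u v \<longrightarrow> (\<Sum>i\<in>I. v i - u i) < d
           \<longrightarrow> (\<Sum>i\<in>I. norm (f (v i) - f (u i))) < e"
proof -
  have "\<exists>d>0. \<forall>(N::nat) u v. subint_family a b {..<N} u v \<and> (\<Sum>i<N. v i - u i) < d \<longrightarrow>
      (\<Sum>i<N. norm (f (v i) - f (u i))) < e"
    using assms(1)[unfolded abs_cont_on_iff] assms(2) by (elim allE impE)
  then obtain d where d: "d > 0" and *: "\<And>(N::nat) u v. subint_family a b {..<N} u v \<Longrightarrow>
        (\<Sum>i<N. v i - u i) < d \<Longrightarrow> (\<Sum>i<N. norm (f (v i) - f (u i))) < e"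
    by (elim exE conjE) (simp only: all_conj_distrib imp_conjL)
  show ?thesis
  proof (rule that[OF d], intro allI impI)
    fix I :: "'i set" and u v
    assume fam: "subint_family a b I u v" and len: "(\<Sum>i\<in>I. v i - u i) < d"
    then obtain h where h: "bij_betw h {..<card I} I"
      using ex_bij_betw_nat_finite[of I] by (auto simp: atLeast0LessThan subint_family_def)
    have hI: "h i \<in> I" if "i < card I" for i using h that by (auto simp: bij_betw_def)
    have hne: "h i \<noteq> h j" if "i < card I" "j < card I" "i \<noteq> j" for i j
      using h that by (auto simp: bij_betw_def inj_on_def)
    have "(\<Sum>i<card I. norm (f ((v \<circ> h) i) - f ((u \<circ> h) i))) < e"
    proof (rule *)
      show "subint_family a b {..<card I} (u \<circ> h) (v \<circ> h)"
        using fam hI hne unfolding subint_family_def by simp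
      show "(\<Sum>i<card I. (v \<circ> h) i - (u \<circ> h) i) < d"
        using len sum.reindex_bij_betw[OF h, of "\<lambda>i. v i - u i"] by simp
    qed
    then show "(\<Sum>i\<in>I. norm (f (v i) - f (u i))) < e"
      using sum.reindex_bij_betw[OF h, of "\<lambda>i. norm (f (v i) - f (u i))"] by simp
  qed
qed

lemma subint_familyD: "subint_family a b I u v \<Longrightarrow> i \<in> I \<Longrightarrow> a \<le> u i \<and> u i \<le> v i \<and> v i \<le> b"
  unfolding subint_family_def by blast

text \<open>Operations preserve absolute continuity because the increments of the result are bounded by those
  of the arguments.\<close>

lemma abs_cont_on_dominated:
  assumes f: "abs_cont_on a b f" and g: "abs_cont_on a b g" and C: "C > 0"
    and le: "\<And>x y. \<lbrakk>a \<le> x; x \<le> y; y \<le> b\<rbrakk> \<Longrightarrow>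
              norm (h y - h x) \<le> C * norm (f y - f x) + C * norm (g y - g x)"
  shows "abs_cont_on a b h"
unfolding abs_cont_on_iff
proof (intro allI impI)
  fix e :: real assume "e > 0"
  then have e': "e / (2*C) > 0" using C by simp
  obtain d1 where d1: "d1 > 0" "\<forall>(I::nat set) u v. subint_family a b I u v \<longrightarrow> (\<Sum>i\<in>I. v i - u i) < d1
        \<longrightarrow> (\<Sum>i\<in>I. norm (f (v i) - f (u i))) < e / (2*C)"
    by (rule abs_cont_on_finite_index[OF f e'])
  obtain d2 where d2: "d2 > 0" "\<forall>(I::nat set) u v. subint_family a b I u v \<longrightarrow> (\<Sum>i\<in>I. v i - u i) < d2
        \<longrightarrow> (\<Sum>i\<in>I. norm (g (v i) - g (u i))) < e / (2*C)"
    by (rule abs_cont_on_finite_index[OF g e'])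
  have "(\<Sum>i<N. norm (h (v i) - h (u i))) < e"
    if A: "subint_family a b {..<N} u v" "(\<Sum>i<N. v i - u i) < min d1 d2" for N :: nat and u v
  proof -
    have "(\<Sum>i<N. norm (h (v i) - h (u i)))
        \<le> (\<Sum>i<N. C * norm (f (v i) - f (u i)) + C * norm (g (v i) - g (u i)))"
      using subint_familyD[OF A(1)] by (intro sum_mono le) auto
    also have "\<dots> = C * (\<Sum>i<N. norm (f (v i) - f (u i))) + C * (\<Sum>i<N. norm (g (v i) - g (u i)))"
      by (simp add: sum.distrib sum_distrib_left)
    also have "\<dots> < C * (e / (2*C)) + C * (e / (2*C))"
      using d1(2)[rule_format, OF A(1)] d2(2)[rule_format, OF A(1)] A(2) C by (intro add_strict_mono mult_strict_left_mono) auto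
    also have "\<dots> = e" using C by (simp add: field_simps)
    finally show ?thesis .
  qed
  then show "\<exists>d>0. \<forall>(N::nat) u v. subint_family a b {..<N} u v \<and>
        (\<Sum>i<N. v i - u i) < d \<longrightarrow> (\<Sum>i<N. norm (h (v i) - h (u i))) < e"
    using d1(1) d2(1) by (intro exI[of _ "min d1 d2"]) auto
qed

lemma abs_cont_on_lipschitz:
  assumes "C \<ge> 0" "\<And>x y. \<lbrakk>a \<le> x; x \<le> y; y \<le> b\<rbrakk> \<Longrightarrow> norm (h y - h x) \<le> C * (y - x)"
  shows "abs_cont_on a b h"
unfolding abs_cont_on_iff
proof (intro allI impI)
  fix e :: real assume e: "e > 0"
  have "(\<Sum>i<N. norm (h (v i) - h (u i))) < e"
    if A: "subint_family a b {..<N} u v" "(\<Sum>i<N. v i - u i) < e / (C+1)" for N :: nat and u v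
  proof -
    have "(\<Sum>i<N. norm (h (v i) - h (u i))) \<le> (\<Sum>i<N. (C+1) * (v i - u i))"
      using subint_familyD[OF A(1)] by (intro sum_mono order.trans[OF assms(2)] mult_right_mono) auto
    also have "\<dots> = (C+1) * (\<Sum>i<N. v i - u i)" by (simp add: sum_distrib_left)
    also have "\<dots> < (C+1) * (e / (C+1))" using A(2) assms(1) by (intro mult_strict_left_mono) auto
    also have "\<dots> = e" using assms(1) by simp
    finally show ?thesis .
  qed
  then show "\<exists>d>0. \<forall>(N::nat) u v. subint_family a b {..<N} u v \<and>
        (\<Sum>i<N. v i - u i) < d \<longrightarrow> (\<Sum>i<N. norm (h (v i) - h (u i))) < e"
    using e assms(1) by (intro exI[of _ "e / (C+1)"]) auto
qed

lemma abs_cont_on_continuous: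
  assumes "abs_cont_on a b f"
  shows "continuous_on {a..b} f"
  unfolding continuous_on_iff
proof (intro ballI allI impI)
  fix x and e :: real assume x: "x \<in> {a..b}" and e: "e > 0"
  obtain d where d: "d > 0" "\<forall>(I::nat set) u v. subint_family a b I u v \<longrightarrow> (\<Sum>i\<in>I. v i - u i) < d
        \<longrightarrow> (\<Sum>i\<in>I. norm (f (v i) - f (u i))) < e"
    by (rule abs_cont_on_finite_index[OF assms e])
  have "dist (f y) (f x) < e" if "y \<in> {a..b}" "dist y x < d" for y
  proof -
    have "subint_family a b {0::nat} (\<lambda>_. min x y) (\<lambda>_. max x y)"
      using that x by (auto simp: subint_family_def)
    moreover have "(\<Sum>i\<in>{0::nat}. max x y - min x y) < d" using that(2) by (auto simp: dist_real_def)
    ultimately have "(\<Sum>i\<in>{0::nat}. norm (f (max x y) - f (min x y))) < e" by (rule d(2)[rule_format])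
    then have "norm (f (max x y) - f (min x y)) < e" by simp
    then show ?thesis by (cases "x \<le> y") (auto simp: dist_norm max_def min_def norm_minus_commute)
  qed
  then show "\<exists>d>0. \<forall>x'\<in>{a..b}. dist x' x < d \<longrightarrow> dist (f x') (f x) < e" using d(1) by blast
qed

lemma abs_cont_on_mult:
  assumes f: "abs_cont_on a b f" and g: "abs_cont_on a b g"
  shows "abs_cont_on a b (\<lambda>x. f x * g x)"
proof -
  have "bounded (f ` {a..b})" "bounded (g ` {a..b})"
    using f g by (auto intro!: compact_imp_bounded compact_continuous_image abs_cont_on_continuous)
  then obtain A B where AB: "A > 0" "B > 0" "\<And>x. x \<in> {a..b} \<Longrightarrow> norm (f x) \<le> A" "\<And>x. x \<in> {a..b} \<Longrightarrow> norm (g x) \<le> B"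
    unfolding bounded_pos by blast
  show ?thesis
  proof (rule abs_cont_on_dominated[OF f g, where C = "A + B"])
    fix x y assume xy: "a \<le> x" "x \<le> y" "y \<le> b"
    have "f y * g y - f x * g x = (f y - f x) * g y + f x * (g y - g x)" by (simp add: algebra_simps)
    then have "norm (f y * g y - f x * g x) \<le> norm (f y - f x) * norm (g y) + norm (f x) * norm (g y - g x)"
      by (metis norm_mult norm_triangle_ineq)
    also have "\<dots> \<le> norm (f y - f x) * (A+B) + (A+B) * norm (g y - g x)"
      using AB(1,2) AB(3)[of x] AB(4)[of y] xy by (intro add_mono mult_mono) auto
    finally show "norm (f y * g y - f x * g x) \<le> (A + B) * norm (f y - f x) + (A + B) * norm (g y - g x)"
      by (simp add: mult.commute)
  qed (use AB in auto)
qed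

lemma abs_cont_on_add:
  assumes f: "abs_cont_on a b f" and g: "abs_cont_on a b g"
  shows "abs_cont_on a b (\<lambda>x. f x + g x)"
  by (rule abs_cont_on_dominated[OF f g, where C = 1])
     (auto simp: add_diff_add norm_triangle_ineq)

lemma abs_cont_on_const: "abs_cont_on a b (\<lambda>x. c)"
  by (rule abs_cont_on_lipschitz[of 0]) auto

lemma abs_cont_on_cnj: "abs_cont_on a b f \<Longrightarrow> abs_cont_on a b (\<lambda>x. cnj (f x))"
  by (rule abs_cont_on_dominated[of a b f f 1])
     (simp_all only: complex_cnj_diff[symmetric] complex_mod_cnj, auto)

lemma AC_loc_add: "AC_loc f \<Longrightarrow> AC_loc g \<Longrightarrow> AC_loc (\<lambda>x. f x + g x)"
  and AC_loc_mult: "AC_loc f \<Longrightarrow> AC_loc g \<Longrightarrow> AC_loc (\<lambda>x. f x * g x)"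
  and AC_loc_const: "AC_loc (\<lambda>x. c)"
  and AC_loc_cnj: "AC_loc f \<Longrightarrow> AC_loc (\<lambda>x. cnj (f x))"
  by (auto simp: AC_loc_def intro: abs_cont_on_add abs_cont_on_mult abs_cont_on_const abs_cont_on_cnj)

lemma AC_loc_sum: "(\<And>i. i \<in> I \<Longrightarrow> AC_loc (f i)) \<Longrightarrow> AC_loc (\<lambda>x. \<Sum>i\<in>I. f i x)"
  by (induction I rule: infinite_finite_induct) (auto intro: AC_loc_add AC_loc_const)

lemma continuous_on_half_line_iff:
  fixes f :: "real \<Rightarrow> 'a::topological_space"
  shows "continuous_on {0..} f \<longleftrightarrow> (\<forall>X\<ge>0. continuous_on {0..X} f)"
proof
  assume *: "\<forall>X\<ge>0. continuous_on {0..X} f"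
  show "continuous_on {0..} f"
    unfolding continuous_on_eq_continuous_within
  proof
    fix x :: real assume "x \<in> {0..}"
    then have "continuous_on {0..x+1} f" "x \<ge> 0" using * by auto
    then have "continuous (at x within {0..x+1}) f" by (simp add: continuous_on_eq_continuous_within)
    moreover have "at x within {0..x+1} = at x within {0..}"
      by (rule at_within_nhd[of _ "{..<x+1}"]) auto
    ultimately show "continuous (at x within {0..}) f" by simp
  qed
qed (auto intro: continuous_on_subset)

lemma AC_loc_continuous: "AC_loc f \<Longrightarrow> continuous_on {0..} f"
  unfolding continuous_on_half_line_iff by (auto simp: AC_loc_def intro: abs_cont_on_continuous)

lemma AC_loc_cong: "AC_loc f \<Longrightarrow> (\<And>x. x \<ge> 0 \<Longrightarrow> f x = g x) \<Longrightarrow> AC_loc g"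
  unfolding AC_loc_def
  by (auto intro!: abs_cont_on_dominated[of _ _ f f 1 g])

lemma C1_lipschitz:
  fixes f :: "real \<Rightarrow> complex"
  assumes der: "\<And>x. 0 \<le> x \<Longrightarrow> (f has_vector_derivative f' x) (at x within {0..})"
    and cont: "continuous_on {0..} f'" and a: "0 \<le> a"
  obtains C where "C > 0" "\<And>x y. x \<in> {a..b} \<Longrightarrow> y \<in> {a..b} \<Longrightarrow> norm (f y - f x) \<le> C * norm (y - x)"
proof -
  have "bounded (f' ` {a..b})"
    using a by (intro compact_imp_bounded compact_continuous_image continuous_on_subset[OF cont]) auto
  then obtain C where C: "C > 0" "\<And>x. x \<in> {a..b} \<Longrightarrow> norm (f' x) \<le> C" unfolding bounded_pos by blast
  have "norm (f y - f x) \<le> C * norm (y - x)" if "x \<in> {a..b}" "y \<in> {a..b}" for x y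
  proof (rule differentiable_bound[where S = "{a..b}" and f' = "\<lambda>x h. h *\<^sub>R f' x"])
    fix t assume t: "t \<in> {a..b}"
    have "(f has_vector_derivative f' t) (at t within {a..b})"
      by (rule has_vector_derivative_within_subset[OF der]) (use t a in auto)
    then show "(f has_derivative (\<lambda>h. h *\<^sub>R f' t)) (at t within {a..b})"
      by (simp add: has_vector_derivative_def)
    show "onorm (\<lambda>h. h *\<^sub>R f' t) \<le> C"
      using C t by (intro onorm_le) (auto simp: mult.commute[of C] intro!: mult_left_mono)
  qed (use that in auto)
  then show ?thesis using that C(1) by blast
qed

lemma AC_loc_C1:
  assumes der: "\<And>x. x \<ge> 0 \<Longrightarrow> (f has_vector_derivative f' x) (at x within {0..})"
    and cont: "continuous_on {0..} f'"
  shows "AC_loc f"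
  unfolding AC_loc_def
proof (intro allI impI)
  fix a b :: real assume "0 \<le> a"
  then obtain C where C: "C > 0" "\<And>x y. x \<in> {a..b} \<Longrightarrow> y \<in> {a..b} \<Longrightarrow> norm (f y - f x) \<le> C * norm (y - x)"
    using C1_lipschitz[OF der cont] by blast
  show "abs_cont_on a b f"
  proof (rule abs_cont_on_lipschitz[of C])
    fix x y assume "a \<le> x" "x \<le> y" "y \<le> b"
    then show "norm (f y - f x) \<le> C * (y - x)" using C(2)[of x y] by simp
  qed (use C in auto)
qed

section \<open>Variation of an absolutely continuous function\<close>

lemma disjoint_mono: "A \<inter> B = {} \<Longrightarrow> A' \<subseteq> A \<Longrightarrow> B' \<subseteq> B \<Longrightarrow> A' \<inter> B' = {}"
  by blast

lemma subint_family_measure: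
  assumes "subint_family a b I u v" "\<And>i. i \<in> I \<Longrightarrow> {u i<..<v i} \<subseteq> T" "T \<in> lmeasurable"
  shows "(\<Sum>i\<in>I. v i - u i) \<le> measure lebesgue T"
proof -
  have fin: "finite I" and uv: "\<And>i. i \<in> I \<Longrightarrow> a \<le> u i \<and> u i \<le> v i \<and> v i \<le> b"
    using assms(1) by (auto simp: subint_family_def)
  have "(\<Sum>i\<in>I. v i - u i) = (\<Sum>i\<in>I. measure lebesgue {u i<..<v i})"
    using uv by (intro sum.cong) auto
  also have "\<dots> = measure lebesgue (\<Union>i\<in>I. {u i<..<v i})"
    using assms(1) uv
    by (intro measure_UNION'[symmetric]) (auto simp: subint_family_def pairwise_def disjnt_def)
  also have "\<dots> \<le> measure lebesgue T"
    using assms(2,3) fin by (intro measure_mono_fmeasurable) auto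
  finally show ?thesis .
qed

lemma subint_family_length:
  assumes "subint_family a b I u v" "a \<le> b"
  shows "(\<Sum>i\<in>I. v i - u i) \<le> b - a"
proof -
  have "{u i<..<v i} \<subseteq> {a..b}" if "i \<in> I" for i
    using subint_familyD[OF assms(1) that] by auto
  then show ?thesis using subint_family_measure[OF assms(1), of "{a..b}"] assms(2) by auto
qed

lemma subint_family_mono:
  assumes "subint_family c d I u v" "a \<le> c" "d \<le> b"
  shows "subint_family a b I u v"
proof -
  have "a \<le> u i \<and> u i \<le> v i \<and> v i \<le> b" if "i \<in> I" for i
    using subint_familyD[OF assms(1) that] assms(2,3) by linarith
  then show ?thesis using assms(1) by (simp add: subint_family_def)
qed

lemma abs_cont_on_subinterval: "abs_cont_on a b F \<Longrightarrow> a \<le> c \<Longrightarrow> d \<le> b \<Longrightarrow> abs_cont_on c d F"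
  unfolding abs_cont_on_iff by (meson subint_family_mono)

definition var_sums :: "(real \<Rightarrow> complex) \<Rightarrow> real \<Rightarrow> real \<Rightarrow> real set" where
  "var_sums F a b = {(\<Sum>i<N. norm (F (v i) - F (u i))) | (N::nat) u v. subint_family a b {..<N} u v}"

text \<open>The families behind \<open>var_sums\<close> may leave gaps. Filling a gap cannot lower the sum, so the supremum
  is the usual total variation, while the sums are those in the definition of absolute continuity.\<close>

definition variation :: "(real \<Rightarrow> complex) \<Rightarrow> real \<Rightarrow> real \<Rightarrow> real" where
  "variation F a b = Sup (var_sums F a b)"

lemma var_sumsI:
  assumes "subint_family a b {..<N::nat} u v"
  shows "(\<Sum>i<N. norm (F (v i) - F (u i))) \<in> var_sums F a b"
  unfolding var_sums_def
  by (intro CollectI, rule exI[of _ N], rule exI[of _ u], rule exI[of _ v]) (simp add: assms)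

lemma zero_in_var_sums: "0 \<in> var_sums F a b"
  unfolding var_sums_def subint_family_def by (force intro!: exI[of _ "0::nat"])

text \<open>Every interval is cut at \<open>b\<close>. If it lies on one side of \<open>b\<close>, its other part is degenerate and
  contributes \<open>0\<close>.\<close>

lemma var_sums_split:
  assumes "S \<in> var_sums F a c" "a \<le> b" "b \<le> c"
  obtains S1 S2 where "S1 \<in> var_sums F a b" "S2 \<in> var_sums F b c" "S \<le> S1 + S2"
proof -
  obtain N :: nat and u v where S: "S = (\<Sum>i<N. norm (F (v i) - F (u i)))"
    and fam: "subint_family a c {..<N} u v"
    using assms(1) unfolding var_sums_def by blast
  have uv: "\<And>i. i < N \<Longrightarrow> a \<le> u i \<and> u i \<le> v i \<and> v i \<le> c"
    and disj: "\<And>i j. i < N \<Longrightarrow> j < N \<Longrightarrow> i \<noteq> j \<Longrightarrow> {u i<..<v i} \<inter> {u j<..<v j} = {}"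
    using fam by (auto simp: subint_family_def)
  have sub1: "{min b (u i)<..<min b (v i)} \<subseteq> {u i<..<v i}"
    and sub2: "{max b (u i)<..<max b (v i)} \<subseteq> {u i<..<v i}" for i
    by (auto simp: min_less_iff_disj less_max_iff_disj)
  have f1: "subint_family a b {..<N} (\<lambda>i. min b (u i)) (\<lambda>i. min b (v i))"
    unfolding subint_family_def
  proof (intro conjI ballI impI)
    fix i j assume "i \<in> {..<N}" "j \<in> {..<N}" "i \<noteq> j"
    then have "{u i<..<v i} \<inter> {u j<..<v j} = {}" by (intro disj) auto
    then show "{min b (u i)<..<min b (v i)} \<inter> {min b (u j)<..<min b (v j)} = {}"
      by (rule disjoint_mono) (rule sub1)+
  qed (use uv assms in \<open>fastforce simp: min_def max_def\<close>)+
  have f2: "subint_family b c {..<N} (\<lambda>i. max b (u i)) (\<lambda>i. max b (v i))"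
    unfolding subint_family_def
  proof (intro conjI ballI impI)
    fix i j assume "i \<in> {..<N}" "j \<in> {..<N}" "i \<noteq> j"
    then have "{u i<..<v i} \<inter> {u j<..<v j} = {}" by (intro disj) auto
    then show "{max b (u i)<..<max b (v i)} \<inter> {max b (u j)<..<max b (v j)} = {}"
      by (rule disjoint_mono) (rule sub2)+
  qed (use uv assms in \<open>fastforce simp: min_def max_def\<close>)+
  let ?S1 = "\<Sum>i<N. norm (F (min b (v i)) - F (min b (u i)))"
  let ?S2 = "\<Sum>i<N. norm (F (max b (v i)) - F (max b (u i)))"
  have "norm (F (v i) - F (u i)) \<le> norm (F (min b (v i)) - F (min b (u i))) + norm (F (max b (v i)) - F (max b (u i)))"
    if "i < N" for i
  proof -
    have "F (v i) - F (u i) = (F (min b (v i)) - F (min b (u i))) + (F (max b (v i)) - F (max b (u i)))"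
      using uv[OF that] by (auto simp: min_def max_def)
    then show ?thesis by (metis norm_triangle_ineq)
  qed
  then have "S \<le> ?S1 + ?S2" unfolding S sum.distrib[symmetric] by (intro sum_mono) auto
  moreover have "?S1 \<in> var_sums F a b" "?S2 \<in> var_sums F b c"
    using var_sumsI[OF f1] var_sumsI[OF f2] .
  ultimately show ?thesis using that by blast
qed

text \<open>If \<open>d\<close> belongs to \<open>\<epsilon> = 1\<close>, all sums over an interval shorter than \<open>d\<close> are below \<open>1\<close>, and finitely many
  steps of length \<open>d/2\<close> lead from \<open>a\<close> to \<open>b\<close>.\<close>

lemma var_sums_bdd:
  assumes F: "abs_cont_on a b F" and ab: "a \<le> b"
  shows "bdd_above (var_sums F a b)"
proof -
  obtain d where d: "d > 0" "\<forall>(I::nat set) u v. subint_family a b I u v \<longrightarrow> (\<Sum>i\<in>I. v i - u i) < d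
        \<longrightarrow> (\<Sum>i\<in>I. norm (F (v i) - F (u i))) < 1"
    by (rule abs_cont_on_finite_index[OF F, of 1]) simp_all
  have *: "S \<le> real n" if "a \<le> x" "x \<le> b" "x \<le> a + real n * (d/2)" "S \<in> var_sums F a x" for n x S
    using that
  proof (induction n arbitrary: x S)
    case 0
    then have "x = a" by simp
    with 0 obtain N :: nat and u v where S: "S = (\<Sum>i<N. norm (F (v i) - F (u i)))"
      and fam: "subint_family a a {..<N} u v"
      unfolding var_sums_def by blast
    have "u i = v i" if "i < N" for i using subint_familyD[OF fam, of i] that by auto
    then show ?case by (simp add: S)
  next
    case (Suc n)
    define y where "y = max a (x - d/2)"
    have "x \<le> a + real n * (d/2) + d/2" "real n * (d/2) \<ge> 0"
      using Suc.prems(3) d(1) by (auto simp: field_simps)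
    then have y: "a \<le> y" "y \<le> x" "y \<le> a + real n * (d/2)" "x - y < d"
      using Suc.prems(1) d(1) unfolding y_def max_def by auto
    obtain S1 S2 where S12: "S1 \<in> var_sums F a y" "S2 \<in> var_sums F y x" "S \<le> S1 + S2"
      using var_sums_split[OF Suc.prems(4) y(1,2)] by blast
    have 1: "S1 \<le> real n" using Suc.IH[of y S1] y Suc.prems S12 by auto
    obtain N :: nat and u v where S2: "S2 = (\<Sum>i<N. norm (F (v i) - F (u i)))"
      and fam: "subint_family y x {..<N} u v"
      using S12(2) unfolding var_sums_def by blast
    have "(\<Sum>i<N. v i - u i) < d" using subint_family_length[OF fam y(2)] y(4) by linarith
    then have "S2 < 1" unfolding S2
      using d(2)[rule_format, OF subint_family_mono[OF fam y(1) Suc.prems(2)]] by simp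
    then show ?case using 1 S12(3) by simp
  qed
  obtain n where "real n > (b - a) / (d/2)" using reals_Archimedean2 by blast
  then have "b \<le> a + real n * (d/2)" using d(1) by (simp add: field_simps)
  then show ?thesis using *[OF ab order.refl] by (auto simp: bdd_above_def)
qed

lemma variation_upper: "abs_cont_on a b F \<Longrightarrow> a \<le> b \<Longrightarrow> S \<in> var_sums F a b \<Longrightarrow> S \<le> variation F a b"
  unfolding variation_def by (intro cSup_upper var_sums_bdd)

lemma variation_subadd:
  assumes F: "abs_cont_on a c F" and "a \<le> b" "b \<le> c"
  shows "variation F a c \<le> variation F a b + variation F b c"
  unfolding variation_def[of F a c]
proof (rule cSup_least)
  show "var_sums F a c \<noteq> {}" using zero_in_var_sums by blast
  fix S assume "S \<in> var_sums F a c"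
  then obtain S1 S2 where "S1 \<in> var_sums F a b" "S2 \<in> var_sums F b c" "S \<le> S1 + S2"
    using var_sums_split assms(2,3) by blast
  moreover have "abs_cont_on a b F" "abs_cont_on b c F"
    using abs_cont_on_subinterval[OF F] assms by auto
  ultimately show "S \<le> variation F a b + variation F b c"
    using variation_upper[of a b F S1] variation_upper[of b c F S2] assms(2,3) by linarith
qed

lemma variation_step:
  assumes F: "abs_cont_on a c F" and "a \<le> b" "b \<le> c"
  shows "variation F a b + norm (F c - F b) \<le> variation F a c"
proof -
  have "variation F a b \<le> variation F a c - norm (F c - F b)"
    unfolding variation_def[of F a b]
  proof (rule cSup_least)
    show "var_sums F a b \<noteq> {}" using zero_in_var_sums by blast
    fix S assume "S \<in> var_sums F a b"
    then obtain N :: nat and u v where S: "S = (\<Sum>i<N. norm (F (v i) - F (u i)))"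
      and fam: "subint_family a b {..<N} u v"
      unfolding var_sums_def by blast
    have "subint_family a c {..<Suc N} (u(N := b)) (v(N := c))"
      using fam assms(2,3) unfolding subint_family_def lessThan_Suc
      by (force simp: disjoint_iff)
    then have "(\<Sum>i<Suc N. norm (F ((v(N := c)) i) - F ((u(N := b)) i))) \<in> var_sums F a c"
      by (rule var_sumsI)
    then have "(\<Sum>i<Suc N. norm (F ((v(N := c)) i) - F ((u(N := b)) i))) \<le> variation F a c"
      using variation_upper F assms by simp
    then show "S \<le> variation F a c - norm (F c - F b)" by (simp add: S)
  qed
  then show ?thesis by simp
qed

text \<open>On each interval of a short family the increment of the variation is nearly attained by a sum
  over subintervals. All these subintervals together form a short family for \<open>F\<close>.\<close>

lemma variation_abs_cont:
  assumes F: "abs_cont_on a b F"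
  shows "abs_cont_on a b (\<lambda>x. complex_of_real (variation F a x))"
  unfolding abs_cont_on_iff
proof (intro allI impI)
  fix e :: real assume e: "e > 0"
  then have e2: "e/2 > 0" by simp
  obtain d where d: "d > 0" "\<forall>(I::(nat \<times> nat) set) u v. subint_family a b I u v \<longrightarrow> (\<Sum>i\<in>I. v i - u i) < d
        \<longrightarrow> (\<Sum>i\<in>I. norm (F (v i) - F (u i))) < e/2"
    by (rule abs_cont_on_finite_index[OF F e2])
  have "(\<Sum>i<N. norm (complex_of_real (variation F a (v i)) - complex_of_real (variation F a (u i)))) < e"
    if fam: "subint_family a b {..<N} u v" and len: "(\<Sum>i<N. v i - u i) < d" for N :: nat and u v
  proof -
    have uv: "a \<le> u i" "u i \<le> v i" "v i \<le> b" if "i < N" for i using subint_familyD[OF fam] that by auto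
    \<comment> \<open>\<open>N\<close> errors of size \<open>\<eta>\<close> add up to less than
        \<open>e/2\<close>, also for \<open>N = 0\<close>.\<close>
    define \<eta> where "\<eta> = e / (2 * (real N + 1))"
    have \<eta>: "\<eta> > 0" using e by (simp add: \<eta>_def)
    have "\<exists>n u' v'. subint_family (u i) (v i) {..<n::nat} u' v' \<and>
            variation F (u i) (v i) - \<eta> < (\<Sum>j<n. norm (F (v' j) - F (u' j)))" for i
    proof -
      have "\<exists>S\<in>var_sums F (u i) (v i). variation F (u i) (v i) - \<eta> < S"
        unfolding variation_def
        using less_cSupD[of "var_sums F (u i) (v i)" "Sup (var_sums F (u i) (v i)) - \<eta>"] \<eta> zero_in_var_sums
        by fastforce
      then show ?thesis unfolding var_sums_def by blast
    qed
    then obtain n u' v' where fam': "\<And>i. subint_family (u i) (v i) {..<n i::nat} (u' i) (v' i)"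
       and near: "\<And>i. variation F (u i) (v i) - \<eta> < (\<Sum>j<n i. norm (F (v' i j) - F (u' i j)))"
      by metis
    let ?I = "Sigma {..<N} (\<lambda>i. {..<n i})"
    have sub: "{u' i j<..<v' i j} \<subseteq> {u i<..<v i}" if "j < n i" for i j
      using subint_familyD[OF fam'[of i], of j] that by auto
    have "subint_family a b ?I (\<lambda>(i,j). u' i j) (\<lambda>(i,j). v' i j)"
      unfolding subint_family_def
    proof (intro conjI ballI impI)
      show "finite ?I" by auto
    next
      fix p assume "p \<in> ?I"
      then obtain i j where p: "p = (i,j)" "i < N" "j < n i" by auto
      have "u i \<le> u' i j \<and> u' i j \<le> v' i j \<and> v' i j \<le> v i" using subint_familyD[OF fam'] p by simp
      then show "a \<le> (case p of (i,j) \<Rightarrow> u' i j)" "(case p of (i,j) \<Rightarrow> u' i j) \<le> (case p of (i,j) \<Rightarrow> v' i j)"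
        "(case p of (i,j) \<Rightarrow> v' i j) \<le> b"
        using uv[OF p(2)] by (auto simp: p(1))
    next
      fix p p' assume pI: "p \<in> ?I" "p' \<in> ?I" and ne: "p \<noteq> p'"
      obtain i j where p: "p = (i,j)" "i < N" "j < n i" using pI(1) by auto
      obtain i' j' where p': "p' = (i',j')" "i' < N" "j' < n i'" using pI(2) by auto
      have "{u' i j<..<v' i j} \<inter> {u' i' j'<..<v' i' j'} = {}"
      proof (cases "i = i'")
        case True
        then show ?thesis using fam'[of i] p p' ne unfolding subint_family_def by auto
      next
        case False
        then have "{u i<..<v i} \<inter> {u i'<..<v i'} = {}" using fam p p' unfolding subint_family_def by simp
        then show ?thesis using sub[OF p(3)] sub[OF p'(3)] by (meson disjoint_mono)
      qed
      then show "{case p of (i,j) \<Rightarrow> u' i j<..<case p of (i,j) \<Rightarrow> v' i j} \<inter>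
                 {case p' of (i,j) \<Rightarrow> u' i j<..<case p' of (i,j) \<Rightarrow> v' i j} = {}"
        by (simp add: p(1) p'(1))
    qed
    moreover have "(\<Sum>p\<in>?I. (case p of (i,j) \<Rightarrow> v' i j) - (case p of (i,j) \<Rightarrow> u' i j)) < d"
    proof -
      have "(\<Sum>p\<in>?I. (case p of (i,j) \<Rightarrow> v' i j) - (case p of (i,j) \<Rightarrow> u' i j)) = (\<Sum>i<N. \<Sum>j<n i. v' i j - u' i j)"
        by (subst sum.Sigma) (auto simp: case_prod_unfold)
      also have "\<dots> \<le> (\<Sum>i<N. v i - u i)"
        by (intro sum_mono subint_family_length[OF fam']) (use uv in auto)
      finally show ?thesis using len by simp
    qed
    ultimately have "(\<Sum>p\<in>?I. norm (F (case p of (i,j) \<Rightarrow> v' i j) - F (case p of (i,j) \<Rightarrow> u' i j))) < e/2"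
      by (rule d(2)[rule_format])
    moreover have "(\<Sum>p\<in>?I. norm (F (case p of (i,j) \<Rightarrow> v' i j) - F (case p of (i,j) \<Rightarrow> u' i j)))
        = (\<Sum>i<N. \<Sum>j<n i. norm (F (v' i j) - F (u' i j)))"
      by (subst sum.Sigma) (auto simp: case_prod_unfold)
    ultimately have lt: "(\<Sum>i<N. \<Sum>j<n i. norm (F (v' i j) - F (u' i j))) < e/2" by simp
    have "(\<Sum>i<N. norm (complex_of_real (variation F a (v i)) - complex_of_real (variation F a (u i))))
        \<le> (\<Sum>i<N. (\<Sum>j<n i. norm (F (v' i j) - F (u' i j))) + \<eta>)"
    proof (rule sum_mono)
      fix i assume "i \<in> {..<N}"
      then have i: "i < N" by simp
      have ac: "abs_cont_on a (v i) F" by (rule abs_cont_on_subinterval[OF F]) (use uv[OF i] in auto)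
      have "variation F a (u i) \<le> variation F a (v i)"
        using variation_step[OF ac uv(1,2)[OF i]] norm_ge_zero[of "F (v i) - F (u i)"] by linarith
      moreover have "variation F a (v i) \<le> variation F a (u i) + variation F (u i) (v i)"
        by (rule variation_subadd[OF ac uv(1,2)[OF i]])
      ultimately have "\<bar>variation F a (v i) - variation F a (u i)\<bar> \<le> variation F (u i) (v i)" by linarith
      then show "norm (complex_of_real (variation F a (v i)) - complex_of_real (variation F a (u i)))
          \<le> (\<Sum>j<n i. norm (F (v' i j) - F (u' i j))) + \<eta>"
        using near[of i] by (simp flip: of_real_diff)
    qed
    also have "\<dots> = (\<Sum>i<N. \<Sum>j<n i. norm (F (v' i j) - F (u' i j))) + real N * \<eta>"
      by (simp add: sum.distrib)
    also have "\<dots> < e/2 + e/2"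
    proof -
      have "real N * \<eta> \<le> e/2" using e by (simp add: \<eta>_def field_simps)
      then show ?thesis using lt by linarith
    qed
    finally show ?thesis by simp
  qed
  then show "\<exists>d>0. \<forall>(N::nat) u v. subint_family a b {..<N} u v \<and> (\<Sum>i<N. v i - u i) < d \<longrightarrow>
      (\<Sum>i<N. norm (complex_of_real (variation F a (v i)) - complex_of_real (variation F a (u i)))) < e"
    using d(1) by blast
qed

section \<open>The fundamental theorem of calculus for absolutely continuous functions\<close>

text \<open>A null set is covered by nonoverlapping intervals of small total length; over finitely many of
  them the increments of \<open>G\<close> have a small sum, and a limit gives the countable union. The function \<open>H\<close>
  extends \<open>G\<close> by constants because a distribution function lives on the whole line.\<close>

lemma mono_abs_cont_null:
  assumes ac: "abs_cont_on a b (\<lambda>x. complex_of_real (G x))" and ab: "a \<le> b"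
    and H: "\<And>x. H x = G (max a (min b x))"
    and Hmono: "\<And>x y. x \<le> y \<Longrightarrow> H x \<le> H y" and Hcont: "continuous_on UNIV H"
    and A: "A \<in> null_sets lborel" "A \<subseteq> {a..b}"
  shows "emeasure (interval_measure H) A = 0"
proof -
  let ?\<mu> = "interval_measure H"
  have Hrc: "\<And>x. continuous (at_right x) H" 
    using Hcont by (auto simp: continuous_on_eq_continuous_within intro: continuous_within_subset)
  have Aborel: "A \<in> sets borel" using A(1) by auto
  have "emeasure ?\<mu> A \<le> ennreal e" if e: "e > 0" for e
  proof -
    obtain d where d: "d > 0" "\<forall>(I::real set set) u v. subint_family a b I u v \<longrightarrow> (\<Sum>i\<in>I. v i - u i) < d
        \<longrightarrow> (\<Sum>i\<in>I. norm (complex_of_real (G (v i)) - complex_of_real (G (u i)))) < e"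
      by (rule abs_cont_on_finite_index[OF ac e])
    have nullA: "A \<in> null_sets lebesgue" using A(1) by (simp add: null_sets_completionI)
    then have mA: "A \<in> lmeasurable" "measure lebesgue A = 0"
      by (auto simp: fmeasurable_def null_sets_def measure_def)
    obtain \<D> where \<D>: "countable \<D>"
        "\<And>K. K \<in> \<D> \<Longrightarrow> K \<subseteq> cbox a b \<and> K \<noteq> {} \<and> (\<exists>c d. K = cbox c d)"
        "pairwise (\<lambda>A B. interior A \<inter> interior B = {}) \<D>"
        "A \<subseteq> \<Union>\<D>" "\<Union>\<D> \<in> lmeasurable" "measure lebesgue (\<Union>\<D>) \<le> measure lebesgue A + d/2"
      using measurable_outer_intervals_bounded[of A a b "d/2"] mA(1) A(2) d(1) by (metis cbox_interval half_gt_zero)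
    have lt: "measure lebesgue (\<Union>\<D>) < d" using \<D>(6) mA(2) d(1) by simp
    have "\<forall>K. \<exists>c d. K \<in> \<D> \<longrightarrow> K = {c..d} \<and> c \<le> d" using \<D>(2) by (metis atLeastatMost_empty_iff2 cbox_interval)
    then obtain u v where uv: "\<And>K. K \<in> \<D> \<Longrightarrow> K = {u K..v K} \<and> u K \<le> v K" by metis
    have uv2: "a \<le> u K \<and> u K \<le> v K \<and> v K \<le> b" if "K \<in> \<D>" for K
    proof -
      have "{u K..v K} \<subseteq> {a..b}" "u K \<le> v K" using uv[OF that] \<D>(2)[OF that] by auto
      then show ?thesis by simp
    qed
    have Kb: "K \<in> sets borel" if "K \<in> \<D>" for K
      using uv[OF that] by (metis atLeastAtMost_borel)
    have fin: "emeasure ?\<mu> (\<Union>D) \<le> ennreal e" if D: "D \<subseteq> \<D>" "finite D" for D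
    proof -
      have fam: "subint_family a b D u v"
        unfolding subint_family_def
      proof (intro conjI ballI impI)
        fix i j assume ij: "i \<in> D" "j \<in> D" "i \<noteq> j"
        then have "interior i \<inter> interior j = {}" using \<D>(3) D by (auto simp: pairwise_def)
        moreover have "interior i = {u i<..<v i}" "interior j = {u j<..<v j}"
          using uv ij D by (metis interior_atLeastAtMost_real subsetD)+
        ultimately show "{u i<..<v i} \<inter> {u j<..<v j} = {}" by simp
      qed (use D uv2 in auto)
      have "{u K<..<v K} \<subseteq> \<Union>\<D>" if "K \<in> D" for K
      proof -
        have "{u K<..<v K} \<subseteq> K" using uv[of K] that D(1) by (metis greaterThanLessThan_subseteq_atLeastAtMost_iff order.refl subsetD)
        then show ?thesis using that D by blast
      qed
      then have "(\<Sum>K\<in>D. v K - u K) < d" using subint_family_measure[OF fam _ \<D>(5)] lt by fastforce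
      then have less: "(\<Sum>K\<in>D. norm (complex_of_real (G (v K)) - complex_of_real (G (u K)))) < e"
        using d(2)[rule_format, OF fam] by simp
      have "emeasure ?\<mu> (\<Union>D) \<le> (\<Sum>K\<in>D. emeasure ?\<mu> K)"
        using emeasure_subadditive_finite[of D "\<lambda>K. K" ?\<mu>] D Kb by auto
      also have "\<dots> = (\<Sum>K\<in>D. ennreal (H (v K) - H (u K)))"
        using D uv by (intro sum.cong refl) (metis Hcont Hmono emeasure_interval_measure_Icc subsetD)
      also have "\<dots> = ennreal (\<Sum>K\<in>D. H (v K) - H (u K))"
        using D uv2 by (intro sum_ennreal) (auto intro!: Hmono)
      also have "\<dots> \<le> ennreal e"
      proof (rule ennreal_leI)
        have "(\<Sum>K\<in>D. H (v K) - H (u K)) \<le> (\<Sum>K\<in>D. norm (complex_of_real (G (v K)) - complex_of_real (G (u K))))"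
        proof (rule sum_mono)
          fix K assume "K \<in> D"
          then have "H (v K) = G (v K)" "H (u K) = G (u K)"
            using uv2[of K] D unfolding H by (auto simp: min_absorb2 max_absorb2)
          then show "H (v K) - H (u K) \<le> norm (complex_of_real (G (v K)) - complex_of_real (G (u K)))"
            by (simp flip: of_real_diff)
        qed
        then show "(\<Sum>K\<in>D. H (v K) - H (u K)) \<le> e" using less by linarith
      qed
      finally show ?thesis .
    qed
    have "emeasure ?\<mu> (\<Union>\<D>) \<le> ennreal e"
    proof (cases "\<D> = {}")
      case True then show ?thesis by simp
    next
      case False
      define U where "U n = (\<Union>i\<le>n. from_nat_into \<D> i)" for n :: nat
      have Um: "U n \<in> sets ?\<mu>" for n
        unfolding U_def using Kb from_nat_into[OF False] by auto
      have "incseq U" unfolding U_def incseq_def by force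
      then have "(SUP n. emeasure ?\<mu> (U n)) = emeasure ?\<mu> (\<Union>n. U n)"
        using Um by (intro SUP_emeasure_incseq) auto
      moreover have "emeasure ?\<mu> (U n) \<le> ennreal e" for n
        unfolding U_def using fin[of "from_nat_into \<D> ` {..n}"] from_nat_into[OF False] by auto
      then have "(SUP n. emeasure ?\<mu> (U n)) \<le> ennreal e" by (intro SUP_least)
      moreover have "(\<Union>n. U n) = \<Union>\<D>"
      proof -
        have "(\<Union>n. U n) = \<Union>(range (from_nat_into \<D>))" unfolding U_def by auto
        then show ?thesis using range_from_nat_into[OF False \<D>(1)] by simp
      qed
      ultimately show ?thesis by simp
    qed
    moreover have "emeasure ?\<mu> A \<le> emeasure ?\<mu> (\<Union>\<D>)"
      using \<D>(1,4) Kb by (intro emeasure_mono) (auto intro!: sets.countable_Union)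
    ultimately show ?thesis by (rule order.trans[rotated])
  qed
  then have "emeasure ?\<mu> A \<le> 0 + ennreal e" if "e > 0" for e using that by simp
  then show ?thesis by (metis ennreal_le_epsilon le_zero_eq)
qed

text \<open>The measure with distribution function \<open>G\<close> has no mass on null sets, so it has a density by the
  Radon--Nikodym theorem.\<close>

lemma mono_abs_cont_integral:
  assumes ac: "abs_cont_on a b (\<lambda>x. complex_of_real (G x))" and ab: "a \<le> b"
    and mono: "\<And>x y. a \<le> x \<Longrightarrow> x \<le> y \<Longrightarrow> y \<le> b \<Longrightarrow> G x \<le> G y"
  obtains h where "h absolutely_integrable_on {a..b}" "\<And>x. x \<in> {a..b} \<Longrightarrow> G x - G a = integral {a..x} h"
proof -
  define H where "H x = G (max a (min b x))" for x
  have Hmono: "H x \<le> H y" if "x \<le> y" for x y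
    unfolding H_def using that ab by (intro mono) (auto simp: min_def max_def)
  have "continuous_on {a..b} (\<lambda>x. Re (complex_of_real (G x)))"
    by (intro continuous_intros abs_cont_on_continuous[OF ac])
  then have Gc: "continuous_on {a..b} G" by simp
  have "continuous_on UNIV (\<lambda>x. G (max a (min b x)))"
    by (rule continuous_on_compose2[OF Gc]) (use ab in \<open>auto intro!: continuous_intros\<close>)
  then have Hcont: "continuous_on UNIV H" unfolding H_def .
  have Hrc: "\<And>x. continuous (at_right x) H" 
    using Hcont by (auto simp: continuous_on_eq_continuous_within intro: continuous_within_subset)
  let ?\<mu> = "interval_measure H"
  have "absolutely_continuous lborel ?\<mu>"
    unfolding absolutely_continuous_def
  proof
    fix A :: "real set" assume A: "A \<in> null_sets lborel"
    have Ab: "A \<in> sets borel" using A by auto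
    have "emeasure ?\<mu> (A \<inter> {a..b}) = 0"
    proof (rule mono_abs_cont_null[OF ac ab H_def Hmono Hcont])
      show "A \<inter> {a..b} \<in> null_sets lborel"
        by (rule null_sets_subset[OF A]) (use Ab in auto)
    qed auto
    then have 1: "A \<inter> {a..b} \<in> null_sets ?\<mu>" using Ab by auto
    have "{a - real n<..a} \<in> null_sets ?\<mu>" for n
    proof -
      have "emeasure ?\<mu> {a - real n<..a} = H a - H (a - real n)"
        by (rule emeasure_interval_measure_Ioc) (use Hmono Hrc in auto)
      also have "H (a - real n) = H a" using ab by (auto simp: H_def min_def max_def)
      finally show ?thesis by auto
    qed
    then have 2: "(\<Union>n. {a - real n<..a}) \<in> null_sets ?\<mu>" by blast
    have "{b<..b + real n} \<in> null_sets ?\<mu>" for n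
    proof -
      have "emeasure ?\<mu> {b<..b + real n} = H (b + real n) - H b"
        by (rule emeasure_interval_measure_Ioc) (use Hmono Hrc in auto)
      also have "H (b + real n) = H b" using ab by (auto simp: H_def min_def max_def)
      finally show ?thesis by auto
    qed
    then have 3: "(\<Union>n. {b<..b + real n}) \<in> null_sets ?\<mu>" by blast
    have "A \<subseteq> (A \<inter> {a..b}) \<union> (\<Union>n. {a - real n<..a}) \<union> (\<Union>n. {b<..b + real n})"
    proof
      fix x assume x: "x \<in> A"
      obtain n where "real n > \<bar>x\<bar> + \<bar>a\<bar> + \<bar>b\<bar>" using reals_Archimedean2 by blast
      then have "x \<in> {a..b} \<or> x \<in> {a - real n<..a} \<or> x \<in> {b<..b + real n}" by auto
      then show "x \<in> (A \<inter> {a..b}) \<union> (\<Union>n. {a - real n<..a}) \<union> (\<Union>n. {b<..b + real n})" using x by blast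
    qed
    moreover have "(A \<inter> {a..b}) \<union> (\<Union>n. {a - real n<..a}) \<union> (\<Union>n. {b<..b + real n}) \<in> null_sets ?\<mu>"
      using 1 2 3 by blast
    ultimately show "A \<in> null_sets ?\<mu>" using Ab by (metis null_sets_subset sets_interval_measure)
  qed
  then obtain f where f: "f \<in> borel_measurable lborel" "density lborel f = ?\<mu>"
    using sigma_finite_measure.Radon_Nikodym[OF lborel.sigma_finite_measure_axioms, of ?\<mu>] by auto
  define h where "h t = enn2real (f t)" for t
  have nn: "(\<integral>\<^sup>+t. f t * indicator {a..x} t \<partial>lborel) = ennreal (G x - G a)" if "x \<in> {a..b}" for x
  proof -
    have "(\<integral>\<^sup>+t. f t * indicator {a..x} t \<partial>lborel) = emeasure ?\<mu> {a..x}"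
      using f by (metis emeasure_density atLeastAtMost_borel sets_lborel)
    also have "\<dots> = H x - H a"
      by (rule emeasure_interval_measure_Icc) (use that Hmono Hcont in auto)
    also have "H x - H a = G x - G a" using that by (auto simp: H_def)
    finally show ?thesis .
  qed
  have "AE t in lborel. f t * indicator {a..b} t \<noteq> \<infinity>"
    by (rule nn_integral_noteq_infinite) (use f nn[of b] ab in auto)
  then have ae: "AE t in lborel. t \<in> {a..b} \<longrightarrow> f t = ennreal (h t)"
    by eventually_elim (auto simp: h_def less_top)
  have hb: "has_bochner_integral lborel (\<lambda>t. indicator {a..x} t *\<^sub>R h t) (G x - G a)" if x: "x \<in> {a..b}" for x
  proof (rule has_bochner_integral_nn_integral)
    show "(\<lambda>t. indicator {a..x} t *\<^sub>R h t) \<in> borel_measurable lborel" using f(1) unfolding h_def by measurable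
    show "0 \<le> G x - G a" using mono[of a x] x by auto
    have "(\<integral>\<^sup>+t. ennreal (indicator {a..x} t *\<^sub>R h t) \<partial>lborel) = (\<integral>\<^sup>+t. f t * indicator {a..x} t \<partial>lborel)"
      by (rule nn_integral_cong_AE, use ae in eventually_elim) (use x in \<open>auto simp: indicator_def\<close>)
    then show "(\<integral>\<^sup>+t. ennreal (indicator {a..x} t *\<^sub>R h t) \<partial>lborel) = ennreal (G x - G a)" using nn[OF x] by simp
  qed (auto simp: h_def)
  have si: "set_integrable lborel {a..x} h" "(LINT t:{a..x}|lborel. h t) = G x - G a" if "x \<in> {a..b}" for x
    using hb[OF that] unfolding set_integrable_def set_lebesgue_integral_def has_bochner_integral_iff by auto
  show ?thesis
  proof (rule that)
    show "h absolutely_integrable_on {a..b}"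
      using si(1)[of b] ab unfolding set_integrable_def by (intro integrable_completion[THEN iffD2]) (auto dest: borel_measurable_integrable)
    show "G x - G a = integral {a..x} h" if "x \<in> {a..b}" for x
      using si[OF that] set_borel_integral_eq_integral(2) by metis
  qed
qed

text \<open>If \<open>V\<close> is the variation of \<open>F\<close>, then \<open>Re F = V - (V - Re F)\<close> is a difference of increasing absolutely
  continuous functions, and \<open>Im F\<close> likewise.\<close>

lemma abs_cont_on_indefinite_integral:
  assumes F: "abs_cont_on a b F" and ab: "a \<le> b"
  obtains h where "h absolutely_integrable_on {a..b}" "\<And>x. x \<in> {a..b} \<Longrightarrow> F x - F a = integral {a..x} h"
proof -
  define V where "V x = variation F a x" for x
  have V: "norm (F y - F x) \<le> V y - V x" if "a \<le> x" "x \<le> y" "y \<le> b" for x y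
    using variation_step[of a y F x] abs_cont_on_subinterval[OF F] that unfolding V_def by force
  have acV: "abs_cont_on a b (\<lambda>x. complex_of_real (V x))"
    unfolding V_def by (rule variation_abs_cont[OF F])
  have dom: "abs_cont_on a b (\<lambda>x. complex_of_real (V x - p (F x)))"
    if p: "\<And>z w. p z - p w = p (z - w)" "\<And>z. \<bar>p z\<bar> \<le> norm z" for p :: "complex \<Rightarrow> real"
  proof (rule abs_cont_on_dominated[OF acV F, of 1])
    fix x y assume xy: "a \<le> x" "x \<le> y" "y \<le> b"
    have "norm (complex_of_real (V y - p (F y)) - complex_of_real (V x - p (F x))) = \<bar>(V y - V x) - p (F y - F x)\<bar>"
      unfolding of_real_diff[symmetric] norm_of_real p(1)[symmetric] by (simp add: algebra_simps)
    also have "\<dots> \<le> \<bar>V y - V x\<bar> + norm (F y - F x)" using p(2)[of "F y - F x"] by linarith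
    finally show "norm (complex_of_real (V y - p (F y)) - complex_of_real (V x - p (F x)))
        \<le> 1 * norm (complex_of_real (V y) - complex_of_real (V x)) + 1 * norm (F y - F x)"
      by (simp flip: of_real_diff)
  qed simp
  have mono: "V x - p (F x) \<le> V y - p (F y)"
    if p: "\<And>z w. p z - p w = p (z - w)" "\<And>z. \<bar>p z\<bar> \<le> norm z" and xy: "a \<le> x" "x \<le> y" "y \<le> b" for p :: "complex \<Rightarrow> real" and x y
    using V[OF xy] p(2)[of "F y - F x"] p(1)[of "F y" "F x"] by linarith
  have Vmono: "V x \<le> V y" if "a \<le> x" "x \<le> y" "y \<le> b" for x y
    using V[OF that] norm_ge_zero[of "F y - F x"] by linarith
  obtain h where h: "h absolutely_integrable_on {a..b}" "\<And>x. x \<in> {a..b} \<Longrightarrow> V x - V a = integral {a..x} h"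
    using mono_abs_cont_integral[OF acV ab Vmono] by blast
  obtain r where r: "r absolutely_integrable_on {a..b}"
      "\<And>x. x \<in> {a..b} \<Longrightarrow> (V x - Re (F x)) - (V a - Re (F a)) = integral {a..x} r"
    using mono_abs_cont_integral[OF dom[of Re] ab mono[of Re]] abs_Re_le_cmod by auto
  obtain i where i: "i absolutely_integrable_on {a..b}"
      "\<And>x. x \<in> {a..b} \<Longrightarrow> (V x - Im (F x)) - (V a - Im (F a)) = integral {a..x} i"
    using mono_abs_cont_integral[OF dom[of Im] ab mono[of Im]] abs_Im_le_cmod by auto
  define w where "w t = complex_of_real (h t - r t) + \<i> * complex_of_real (h t - i t)" for t
  have hr: "(\<lambda>t. h t - r t) absolutely_integrable_on {a..b}" "(\<lambda>t. h t - i t) absolutely_integrable_on {a..b}"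
    using h r i by (auto intro: set_integral_diff)
  have c1: "(\<lambda>t. complex_of_real (h t - r t)) absolutely_integrable_on {a..b}"
    using absolutely_integrable_linear[OF hr(1) bounded_linear_of_real[where 'a=complex]] by (simp only: o_def)
  have c2: "(\<lambda>t. \<i> * complex_of_real (h t - i t)) absolutely_integrable_on {a..b}"
    using absolutely_integrable_linear[OF hr(2) bounded_linear_compose[OF bounded_linear_mult_right[of \<i>] bounded_linear_of_real]]
    by (simp only: o_def)
  show ?thesis
  proof (rule that)
    show "w absolutely_integrable_on {a..b}"
      unfolding w_def using set_integral_add(1)[OF c1 c2] .
    fix x assume x: "x \<in> {a..b}"
    have sub: "{a..x} \<subseteq> {a..b}" using x by auto
    have int: "h integrable_on {a..x}" "r integrable_on {a..x}" "i integrable_on {a..x}"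
      using h(1) r(1) i(1) sub by (auto intro: set_lebesgue_integral_eq_integral absolutely_integrable_on_subinterval
          dest!: absolutely_integrable_on_def[THEN iffD1] intro: integrable_on_subinterval)
    have hI: "(h has_integral (V x - V a)) {a..x}"
      "(r has_integral ((V x - Re (F x)) - (V a - Re (F a)))) {a..x}"
      "(i has_integral ((V x - Im (F x)) - (V a - Im (F a)))) {a..x}"
      using int h(2)[OF x] r(2)[OF x] i(2)[OF x] by (metis integrable_integral)+
    have 1: "((\<lambda>t. h t - r t) has_integral (Re (F x - F a))) {a..x}"
      using has_integral_diff[OF hI(1,2)] by simp
    have 2: "((\<lambda>t. h t - i t) has_integral (Im (F x - F a))) {a..x}"
      using has_integral_diff[OF hI(1,3)] by simp
    have "(w has_integral (complex_of_real (Re (F x - F a)) + \<i> * complex_of_real (Im (F x - F a)))) {a..x}"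
      unfolding w_def
      by (intro has_integral_add has_integral_mult_right has_integral_of_real 1 2)
    then have "(w has_integral (F x - F a)) {a..x}" by (simp only: complex_eq[symmetric])
    then show "F x - F a = integral {a..x} w" by (simp add: integral_unique)
  qed
qed

text \<open>At almost every \<open>x\<close> the averages of \<open>f\<close> over \<open>[x, x + h]\<close> with \<open>h > 0\<close> converge to \<open>f x\<close>. Used for \<open>f\<close> and
  for its reflection, this yields both one-sided derivatives of \<open>F\<close>.\<close>

lemma indefinite_integral_ae_derivative:
  fixes f :: "real \<Rightarrow> complex"
  assumes f: "f integrable_on {a..b}" and ab: "a \<le> b" 
    and F: "\<And>x. x \<in> {a..b} \<Longrightarrow> F x - F a = integral {a..x} f"
  obtains N where "negligible N" "\<And>x. x \<in> {a..b} - N \<Longrightarrow> (F has_vector_derivative f x) (at x)"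
proof -
  define g where "g x = (if x \<in> {a..b} then f x else 0)" for x
  have "g integrable_on UNIV" unfolding g_def using f by (simp only: integrable_restrict_UNIV)
  then have gi: "g integrable_on cbox c d" for c d
    by (metis integrable_on_subcbox subset_UNIV)
  have gi': "(\<lambda>x. g (- x)) integrable_on cbox c d" for c d
    using gi[of "-d" "-c"] Henstock_Kurzweil_Integration.integrable_reflect_real[where f=g and a="-d" and b="-c"] by simp
  have Fg: "F y - F x = integral {x..y} g" if "x \<in> {a..b}" "y \<in> {a..b}" "x \<le> y" for x y
  proof -
    have "integral {a..x} f + integral {x..y} f = integral {a..y} f"
      using that by (intro Henstock_Kurzweil_Integration.integral_combine integrable_on_subinterval[OF f]) auto
    then have "F y - F x = integral {x..y} f" using F[OF that(1)] F[OF that(2)] by (simp add: algebra_simps)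
    also have "\<dots> = integral {x..y} g" using that by (intro integral_cong) (auto simp: g_def)
    finally show ?thesis .
  qed
  obtain N1 where N1: "negligible N1" "\<And>x e. \<lbrakk>x \<notin> N1; 0 < e\<rbrakk> \<Longrightarrow>
       \<exists>d>0. \<forall>h. 0 < h \<and> h < d \<longrightarrow> norm (integral (cbox x (x + h *\<^sub>R One)) g /\<^sub>R h ^ DIM(real) - g x) < e"
    using integrable_ccontinuous_explicit[of g] gi by blast
  obtain N2 where N2: "negligible N2" "\<And>x e. \<lbrakk>x \<notin> N2; 0 < e\<rbrakk> \<Longrightarrow>
       \<exists>d>0. \<forall>h. 0 < h \<and> h < d \<longrightarrow> norm (integral (cbox x (x + h *\<^sub>R One)) (\<lambda>x. g (- x)) /\<^sub>R h ^ DIM(real) - g (- x)) < e"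
    using integrable_ccontinuous_explicit[of "\<lambda>x. g (- x)"] gi' by blast
  have "negligible (uminus ` N2)" using N2(1)
    by (rule negligible_differentiable_image_negligible[rotated]) (auto intro!: derivative_intros)
  then have neg: "negligible (N1 \<union> uminus ` N2 \<union> {a, b})" using N1(1) by (intro negligible_Un) auto
  show ?thesis
  proof (rule that[OF neg])
    fix x assume x: "x \<in> {a..b} - (N1 \<union> uminus ` N2 \<union> {a, b})"
    then have xab: "a < x" "x < b" "x \<notin> N1" "- x \<notin> N2" by (auto simp: image_iff) 
    have gx: "g x = f x" using xab by (simp add: g_def)
    show "(F has_vector_derivative f x) (at x)"
      unfolding has_vector_derivative_def has_derivative_within'
    proof (intro conjI allI impI)
      show "bounded_linear (\<lambda>h. h *\<^sub>R f x)" by (rule bounded_linear_scaleR_left)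
      fix e :: real assume e: "e > 0"
      obtain d1 where d1: "d1 > 0" "\<And>h. 0 < h \<Longrightarrow> h < d1 \<Longrightarrow> norm (integral {x..x+h} g /\<^sub>R h - f x) < e"
        using N1(2)[OF xab(3) e] by (auto simp: gx)
      obtain d2 where d2: "d2 > 0" "\<And>h. 0 < h \<Longrightarrow> h < d2 \<Longrightarrow> norm (integral {-x..-x+h} (\<lambda>x. g (-x)) /\<^sub>R h - f x) < e"
        using N2(2)[OF xab(4) e] by (auto simp: gx)
      define d where "d = min (min d1 d2) (min (x - a) (b - x))"
      have "norm (F y - F x - (y - x) *\<^sub>R f x) / norm (y - x) < e"
        if y: "0 < norm (y - x)" "norm (y - x) < d" for y
      proof (cases "x < y")
        case True
        define h where "h = y - x"
        have h: "h > 0" "h < d1" "y = x + h" "y \<in> {a..b}" using True y xab by (auto simp: h_def d_def)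
        have "F y - F x = integral {x..x+h} g" using Fg[of x y] h xab by auto
        then have "(F y - F x - (y - x) *\<^sub>R f x) = h *\<^sub>R (integral {x..x+h} g /\<^sub>R h - f x)"
          using h by (simp add: algebra_simps)
        then have "norm (F y - F x - (y - x) *\<^sub>R f x) / norm (y - x) = norm (integral {x..x+h} g /\<^sub>R h - f x)"
          using h by simp
        then show ?thesis using d1(2)[OF h(1,2)] by simp
      next
        case False
        define h where "h = x - y"
        have h: "h > 0" "h < d2" "y = x - h" "y \<in> {a..b}" using False y xab by (auto simp: h_def d_def)
        have "F x - F y = integral {x-h..x} g" using Fg[of y x] h xab by auto
        also have "\<dots> = integral {-x..-x+h} (\<lambda>x. g (-x))"
          using Henstock_Kurzweil_Integration.integral_reflect_real[of "x" "x-h" g] by (simp add: add.commute)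
        finally have Fxy: "F x - F y = integral {-x..-x+h} (\<lambda>x. g (-x))" .
        have "(F y - F x - (y - x) *\<^sub>R f x) = - (h *\<^sub>R (integral {-x..-x+h} (\<lambda>x. g (-x)) /\<^sub>R h - f x))"
          unfolding Fxy[symmetric] using h(1) by (simp add: scaleR_diff_right) (simp add: h_def algebra_simps)
        then have "norm (F y - F x - (y - x) *\<^sub>R f x) / norm (y - x) = norm (integral {-x..-x+h} (\<lambda>x. g (-x)) /\<^sub>R h - f x)"
          using h by simp
        then show ?thesis using d2(2)[OF h(1,2)] by simp
      qed
      moreover have "d > 0" using d1 d2 xab by (auto simp: d_def)
      ultimately show "\<exists>d>0. \<forall>x'\<in>UNIV. 0 < norm (x' - x) \<and> norm (x' - x) < d \<longrightarrow>
           norm (F x' - F x - (x' - x) *\<^sub>R f x) / norm (x' - x) < e" by blast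
    qed
  qed
qed

text \<open>Lebesgue's theorem. For elements of the maximal domain the last derivative that enters Green's form
  need not be differentiable everywhere, so the elementary fundamental theorem does not suffice.\<close>

theorem abs_cont_on_FTC:
  assumes F: "abs_cont_on a b F" and ab: "a \<le> b"
  obtains N h where "negligible N" "\<And>x. x \<in> {a..b} - N \<Longrightarrow> (F has_vector_derivative h x) (at x)"
    "h absolutely_integrable_on {a..b}" "(h has_integral (F b - F a)) {a..b}"
proof -
  obtain h where h: "h absolutely_integrable_on {a..b}" "\<And>x. x \<in> {a..b} \<Longrightarrow> F x - F a = integral {a..x} h"
    using abs_cont_on_indefinite_integral[OF F ab] by blast
  have hi: "h integrable_on {a..b}" using h(1) by (rule set_lebesgue_integral_eq_integral(1))
  obtain N where N: "negligible N" "\<And>x. x \<in> {a..b} - N \<Longrightarrow> (F has_vector_derivative h x) (at x)"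
    using indefinite_integral_ae_derivative[OF hi ab h(2)] by blast
  have "(h has_integral (F b - F a)) {a..b}" using h(2)[of b] hi ab by (metis atLeastAtMost_iff integrable_integral order.refl)
  then show ?thesis using that N h(1) by blast
qed

section \<open>Linear systems and determinants\<close>

text \<open>Gaussian elimination: an equation with a nonzero coefficient is solved for one unknown and
  substituted into the others. Every comparison of dimensions below reduces to this lemma.\<close>

lemma underdetermined_system:
  fixes A :: "'i \<Rightarrow> 'j \<Rightarrow> complex"
  assumes "finite I" "finite J" "card I < card J"
  shows "\<exists>x. (\<exists>j\<in>J. x j \<noteq> 0) \<and> (\<forall>i\<in>I. (\<Sum>j\<in>J. A i j * x j) = 0)"
  using assms
proof (induction I arbitrary: J A rule: finite_induct)
  case empty
  then obtain j where "j \<in> J" by fastforce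
  then show ?case by (intro exI[of _ "\<lambda>_. 1"]) auto
next
  case (insert i0 I)
  show ?case
  proof (cases "\<forall>j\<in>J. A i0 j = 0")
    case True
    have "card I < card J" using insert by simp
    then obtain x where "\<exists>j\<in>J. x j \<noteq> 0" "\<forall>i\<in>I. (\<Sum>j\<in>J. A i j * x j) = 0"
      using insert.IH[OF insert.prems(1), of A] by blast
    then show ?thesis using True by (intro exI[of _ x]) auto
  next
    case False
    then obtain j0 where j0: "j0 \<in> J" "A i0 j0 \<noteq> 0" by blast
    define J' where "J' = J - {j0}"
    have J: "J = insert j0 J'" "j0 \<notin> J'" "finite J'" using j0 insert.prems by (auto simp: J'_def)
    have "card I < card J'" using insert J by simp
    then obtain x where x: "\<exists>j\<in>J'. x j \<noteq> 0"
        "\<forall>i\<in>I. (\<Sum>j\<in>J'. (A i j - A i j0 * A i0 j / A i0 j0) * x j) = 0"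
      using insert.IH[OF J(3), of "\<lambda>i j. A i j - A i j0 * A i0 j / A i0 j0"] by blast
    \<comment> \<open>The value that equation \<open>i0\<close> dictates for the eliminated unknown.\<close>
    define t where "t = - (\<Sum>j\<in>J'. A i0 j * x j) / A i0 j0"
    define z where "z = x(j0 := t)"
    have z: "(\<Sum>j\<in>J. A i j * z j) = A i j0 * t + (\<Sum>j\<in>J'. A i j * x j)" for i
    proof -
      have "(\<Sum>j\<in>J'. A i j * z j) = (\<Sum>j\<in>J'. A i j * x j)"
        using J(2) by (intro sum.cong) (auto simp: z_def)
      then show ?thesis unfolding J(1) using J by (simp add: z_def)
    qed
    have "(\<Sum>j\<in>J. A i j * z j) = 0" if "i \<in> insert i0 I" for i
    proof (cases "i = i0")
      case True then show ?thesis unfolding z t_def using j0 by simp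
    next
      case False
      then have "0 = (\<Sum>j\<in>J'. (A i j - A i j0 * A i0 j / A i0 j0) * x j)" using x(2) that by simp
      also have "\<dots> = (\<Sum>j\<in>J'. A i j * x j) - A i j0 / A i0 j0 * (\<Sum>j\<in>J'. A i0 j * x j)"
        by (simp add: left_diff_distrib sum_subtractf sum_distrib_left mult.assoc)
      also have "\<dots> = (\<Sum>j\<in>J. A i j * z j)" unfolding z t_def by simp
      finally show ?thesis by simp
    qed
    moreover have "\<exists>j\<in>J. z j \<noteq> 0" using x(1) J by (auto simp: z_def)
    ultimately show ?thesis by blast
  qed
qed

text \<open>With \<open>- y\<close> as an additional column there are more unknowns than equations. By injectivity the
  additional unknown is nonzero in a nontrivial solution, and dividing by it solves \<open>A x = y\<close>.\<close>

lemma square_system_surj: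
  fixes A :: "'i \<Rightarrow> 'j \<Rightarrow> complex"
  assumes fin: "finite I" "finite J" "card I \<le> card J"
    and inj: "\<And>x. (\<And>i. i \<in> I \<Longrightarrow> (\<Sum>j\<in>J. A i j * x j) = 0) \<Longrightarrow> (\<And>j. j \<in> J \<Longrightarrow> x j = 0)"
  shows "\<exists>x. \<forall>i\<in>I. (\<Sum>j\<in>J. A i j * x j) = y i"
proof -
  define A' where "A' i p = (case p of None \<Rightarrow> - y i | Some j \<Rightarrow> A i j)" for i and p :: "'j option"
  let ?J = "insert None (Some ` J)"
  have J: "finite ?J" "card I < card ?J" using fin by (auto simp: card_image)
  obtain z where z: "\<exists>p\<in>?J. z p \<noteq> 0" "\<forall>i\<in>I. (\<Sum>p\<in>?J. A' i p * z p) = 0"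
    using underdetermined_system[OF fin(1) J, of A'] by blast
  have eq: "(\<Sum>j\<in>J. A i j * z (Some j)) = y i * z None" if "i \<in> I" for i
  proof -
    have "(\<Sum>p\<in>?J. A' i p * z p) = - y i * z None + (\<Sum>j\<in>J. A i j * z (Some j))"
      using fin by (simp add: A'_def sum.reindex)
    then show ?thesis using z(2) that by simp
  qed
  have "z None \<noteq> 0"
  proof
    assume "z None = 0"
    then have "z (Some j) = 0" if "j \<in> J" for j
      using inj[of "\<lambda>j. z (Some j)"] eq that by simp
    then show False using z(1) \<open>z None = 0\<close> by auto
  qed
  then have "(\<Sum>j\<in>J. A i j * (z (Some j) / z None)) = y i" if "i \<in> I" for i
    using eq[OF that] by (simp add: sum_divide_distrib[symmetric])
  then show ?thesis by (intro exI[of _ "\<lambda>j. z (Some j) / z None"]) blast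
qed

text \<open>The left kernel is used because it belongs to the linear combinations of the functions that index
  the rows.\<close>

lemma det_eq_0_iff_kernel:
  fixes A :: "nat \<Rightarrow> nat \<Rightarrow> complex"
  shows "Determinant.det (mat n n (\<lambda>(i, j). A i j)) = 0 \<longleftrightarrow>
    (\<exists>x. (\<exists>i<n. x i \<noteq> 0) \<and> (\<forall>j<n. (\<Sum>i<n. x i * A i j) = 0))"
proof -
  let ?M = "mat n n (\<lambda>(i, j). A i j)"
  have M: "?M \<in> carrier_mat n n" by simp
  have entry: "vec_index (transpose_mat ?M *\<^sub>v v) j = (\<Sum>i<n. vec_index v i * A i j)" if "v \<in> carrier_vec n" "j < n" for v j
    using that by (simp add: scalar_prod_def atLeast0LessThan mult.commute)
  have "Determinant.det ?M = 0 \<longleftrightarrow> Determinant.det (transpose_mat ?M) = 0"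
    by (simp add: Determinant.det_transpose[OF M])
  also have "\<dots> \<longleftrightarrow> (\<exists>v\<in>carrier_vec n. v \<noteq> 0\<^sub>v n \<and> transpose_mat ?M *\<^sub>v v = 0\<^sub>v n)"
    by (subst det_0_iff_vec_prod_zero[of _ n]) auto
  also have "\<dots> \<longleftrightarrow> (\<exists>x. (\<exists>i<n. x i \<noteq> 0) \<and> (\<forall>j<n. (\<Sum>i<n. x i * A i j) = 0))"
  proof
    assume "\<exists>v\<in>carrier_vec n. v \<noteq> 0\<^sub>v n \<and> transpose_mat ?M *\<^sub>v v = 0\<^sub>v n"
    then obtain v where v: "v \<in> carrier_vec n" "v \<noteq> 0\<^sub>v n" "transpose_mat ?M *\<^sub>v v = 0\<^sub>v n" by blast
    have "\<exists>i<n. vec_index v i \<noteq> 0" using v(1,2) by (metis carrier_vecD eq_vecI index_zero_vec(1,2))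
    moreover have "\<forall>j<n. (\<Sum>i<n. vec_index v i * A i j) = 0" using entry[OF v(1)] v(3) by simp
    ultimately show "\<exists>x. (\<exists>i<n. x i \<noteq> 0) \<and> (\<forall>j<n. (\<Sum>i<n. x i * A i j) = 0)" by blast
  next
    assume "\<exists>x. (\<exists>i<n. x i \<noteq> 0) \<and> (\<forall>j<n. (\<Sum>i<n. x i * A i j) = 0)"
    then obtain x where x: "\<exists>i<n. x i \<noteq> 0" "\<forall>j<n. (\<Sum>i<n. x i * A i j) = 0" by blast
    have "Matrix.vec n x \<noteq> 0\<^sub>v n" using x(1) by (metis index_vec index_zero_vec(1))
    moreover have "transpose_mat ?M *\<^sub>v Matrix.vec n x = 0\<^sub>v n"
    proof (rule eq_vecI)
      fix j assume "j < dim_vec (0\<^sub>v n :: complex Matrix.vec)"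
      then have "j < n" by simp
      then show "vec_index (transpose_mat ?M *\<^sub>v Matrix.vec n x) j = vec_index (0\<^sub>v n) j"
        using entry[of "Matrix.vec n x" j] x(2) by simp
    qed auto
    ultimately show "\<exists>v\<in>carrier_vec n. v \<noteq> 0\<^sub>v n \<and> transpose_mat ?M *\<^sub>v v = 0\<^sub>v n"
      by (intro bexI[of _ "Matrix.vec n x"]) auto
  qed
  finally show ?thesis .
qed

text \<open>A nonzero vector that annihilates \<open>B\<close> from the left exists as \<open>m < n\<close>, and it annihilates the product.\<close>

lemma det_low_rank_eq_0:
  fixes B C :: "nat \<Rightarrow> nat \<Rightarrow> complex"
  assumes "m < n" "\<And>i j. i < n \<Longrightarrow> j < n \<Longrightarrow> A i j = (\<Sum>l<m. B i l * C l j)"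
  shows "Determinant.det (mat n n (\<lambda>(i, j). A i j)) = 0"
proof -
  obtain x where x: "\<exists>i\<in>{..<n}. x i \<noteq> 0" "\<forall>l\<in>{..<m}. (\<Sum>i<n. B i l * x i) = 0"
    using underdetermined_system[of "{..<m}" "{..<n}" "\<lambda>l i. B i l"] assms(1) by auto
  have "(\<Sum>i<n. x i * A i j) = 0" if "j < n" for j
  proof -
    have "(\<Sum>i<n. x i * A i j) = (\<Sum>i<n. \<Sum>l<m. x i * (B i l * C l j))"
      using assms(2) that by (simp add: sum_distrib_left)
    also have "\<dots> = (\<Sum>l<m. \<Sum>i<n. x i * (B i l * C l j))" by (rule sum.swap)
    also have "\<dots> = (\<Sum>l<m. (\<Sum>i<n. B i l * x i) * C l j)"
      by (intro sum.cong refl) (simp add: sum_distrib_right mult.assoc mult.left_commute)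
    finally show ?thesis using x(2) by simp
  qed
  then show ?thesis unfolding det_eq_0_iff_kernel using x(1) by auto
qed

lemma det_diagonal_neq_0:
  fixes A :: "nat \<Rightarrow> nat \<Rightarrow> complex"
  assumes "\<And>i. i < n \<Longrightarrow> A i i \<noteq> 0" "\<And>i j. i < n \<Longrightarrow> j < n \<Longrightarrow> i \<noteq> j \<Longrightarrow> A i j = 0"
  shows "Determinant.det (mat n n (\<lambda>(i, j). A i j)) \<noteq> 0"
proof -
  have "x j = 0" if "\<forall>j<n. (\<Sum>i<n. x i * A i j) = 0" "j < n" for x j
  proof -
    have "(\<Sum>i<n. x i * A i j) = x j * A j j"
      using assms(2) that(2) by (subst sum.remove[of _ j]) (auto intro!: sum.neutral)
    then show ?thesis using that assms(1) by simp
  qed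
  then show ?thesis unfolding det_eq_0_iff_kernel by blast
qed

section \<open>Hermitian forms on spaces of functions\<close>

definition lcomb :: "'i set \<Rightarrow> ('i \<Rightarrow> complex) \<Rightarrow> ('i \<Rightarrow> real \<Rightarrow> complex) \<Rightarrow> real \<Rightarrow> complex" where
  "lcomb I c e = (\<lambda>x. \<Sum>i\<in>I. c i * e i x)"

lemma lcomb_closed:
  assumes "finite I" "\<And>i. i \<in> I \<Longrightarrow> P (e i)" "P (\<lambda>_. 0)" "\<And>a f g. P f \<Longrightarrow> P g \<Longrightarrow> P (\<lambda>x. a * f x + g x)"
  shows "P (lcomb I c e)"
  using assms(1,2) unfolding lcomb_def
  by (induction I rule: finite_induct) (auto intro: assms(3,4))

lemma lcomb_linear:
  assumes "finite I" "\<And>i. i \<in> I \<Longrightarrow> e i \<in> X" "(\<lambda>_. 0) \<in> X"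
    and closed: "\<And>a f g. f \<in> X \<Longrightarrow> g \<in> X \<Longrightarrow> (\<lambda>x. a * f x + g x) \<in> X"
    and lin: "\<And>a f g. f \<in> X \<Longrightarrow> g \<in> X \<Longrightarrow> L (\<lambda>x. a * f x + g x) = a * L f + (L g :: complex)"
  shows "lcomb I c e \<in> X \<and> L (lcomb I c e) = (\<Sum>i\<in>I. c i * L (e i))"
  using assms(1,2)
proof (induction I rule: finite_induct)
  case empty
  have "L (\<lambda>_. 0) = 0" using lin[OF assms(3,3), of 1] by simp
  then show ?case using assms(3) by (simp add: lcomb_def)
next
  case (insert i I)
  have "lcomb (insert i I) c e = (\<lambda>x. c i * e i x + lcomb I c e x)" using insert by (simp add: lcomb_def)
  then show ?case using insert closed[of "e i" "lcomb I c e" "c i"] lin[of "e i" "lcomb I c e" "c i"] by simp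
qed

text \<open>Closure under \<open>a * f + g\<close> together with \<open>0\<close> covers sums and multiples, so that each kind of linearity
  is a single axiom.\<close>

locale hermitian_form =
  fixes X :: "(real \<Rightarrow> complex) set" and G :: "(real \<Rightarrow> complex) \<Rightarrow> (real \<Rightarrow> complex) \<Rightarrow> complex"
  assumes zero_mem: "(\<lambda>_. 0) \<in> X"
    and lin_mem: "f \<in> X \<Longrightarrow> g \<in> X \<Longrightarrow> (\<lambda>x. a * f x + g x) \<in> X"
    and form_lin: "f \<in> X \<Longrightarrow> g \<in> X \<Longrightarrow> h \<in> X \<Longrightarrow> G (\<lambda>x. a * f x + g x) h = a * G f h + G g h"
    and form_herm: "f \<in> X \<Longrightarrow> g \<in> X \<Longrightarrow> G g f = cnj (G f g)"
begin

lemma form_zero: "h \<in> X \<Longrightarrow> G (\<lambda>_. 0) h = 0"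
  using form_lin[OF zero_mem zero_mem, of h 1] by simp

lemma form_lin_right:
  assumes "f \<in> X" "g \<in> X" "h \<in> X"
  shows "G h (\<lambda>x. a * f x + g x) = cnj a * G h f + G h g"
  using form_herm[of "\<lambda>x. a * f x + g x" h] form_lin[OF assms, of a] form_herm[of f h] form_herm[of g h] lin_mem[of f g a] assms
  by simp

lemma lcomb_mem: "finite I \<Longrightarrow> (\<And>i. i \<in> I \<Longrightarrow> e i \<in> X) \<Longrightarrow> lcomb I c e \<in> X"
  by (rule lcomb_closed[where P = "\<lambda>f. f \<in> X"]) (auto intro: zero_mem lin_mem)

lemma form_lcomb:
  assumes "finite I" "\<And>i. i \<in> I \<Longrightarrow> e i \<in> X" "h \<in> X"
  shows "G (lcomb I c e) h = (\<Sum>i\<in>I. c i * G (e i) h)"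
  using lcomb_linear[of I e X "\<lambda>f. G f h" c] assms zero_mem lin_mem form_lin by simp

lemma form_lcomb_right:
  assumes "finite I" "\<And>i. i \<in> I \<Longrightarrow> e i \<in> X" "h \<in> X"
  shows "G h (lcomb I c e) = (\<Sum>i\<in>I. cnj (c i) * G h (e i))"
proof -
  have "G h (lcomb I c e) = cnj (G (lcomb I c e) h)"
    by (rule form_herm[OF lcomb_mem[OF assms(1,2)] assms(3)])
  also have "\<dots> = (\<Sum>i\<in>I. cnj (c i) * cnj (G (e i) h))"
    by (simp add: form_lcomb[OF assms] cnj_sum)
  also have "\<dots> = (\<Sum>i\<in>I. cnj (c i) * G h (e i))"
    using form_herm[OF assms(2) assms(3)] by (intro sum.cong) auto
  finally show ?thesis .
qed

lemma form_self_real: "f \<in> X \<Longrightarrow> Im (G f f) = 0"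
  using form_herm[of f f] by (metis Im_complex_of_real Reals_cnj_iff of_real_Re)

text \<open>No member is isotropic, so the projection onto the span of the family is defined.\<close>

definition orth_family :: "nat \<Rightarrow> (nat \<Rightarrow> real \<Rightarrow> complex) \<Rightarrow> bool" where
  "orth_family N h \<longleftrightarrow> (\<forall>i<N. h i \<in> X \<and> G (h i) (h i) \<noteq> 0) \<and> (\<forall>i<N. \<forall>j<N. i \<noteq> j \<longrightarrow> G (h i) (h j) = 0)"

text \<open>If all combinations were isotropic, \<open>f + g\<close> and \<open>\<i> f + g\<close> would show that the real and the imaginary
  part of \<open>G f g\<close> vanish. The summand \<open>0\<close> brings the combinations into the shape \<open>a * f + g\<close> for which
  linearity is stated.\<close>

lemma polarization:
  assumes "f \<in> X" "g \<in> X" "G f g \<noteq> 0"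
  obtains a b where "G (\<lambda>x. a * f x + (b * g x + 0)) (\<lambda>x. a * f x + (b * g x + 0)) \<noteq> 0"
proof (rule ccontr)
  assume "\<not> thesis"
  then have *: "G (\<lambda>x. a * f x + (b * g x + 0)) (\<lambda>x. a * f x + (b * g x + 0)) = 0" for a b
    using that by blast
  have ex: "G (\<lambda>x. a * f x + (b * g x + 0)) (\<lambda>x. a * f x + (b * g x + 0)) =
      a * cnj a * G f f + a * cnj b * G f g + b * cnj a * cnj (G f g) + b * cnj b * G g g" for a b
  proof -
    have mem: "(\<lambda>x. b * g x + 0) \<in> X" using lin_mem[OF assms(2) zero_mem] .
    have m2: "(\<lambda>x. a * f x + (b * g x + 0)) \<in> X" using lin_mem[OF assms(1) mem] .
    have r: "G u (\<lambda>x. a * f x + (b * g x + 0)) = cnj a * G u f + cnj b * G u g" if "u \<in> X" for u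
      using form_lin_right[OF assms(1) mem that] form_lin_right[OF assms(2) zero_mem that]
        form_herm[OF zero_mem that] form_zero[OF that] by simp
    have "G (\<lambda>x. a * f x + (b * g x + 0)) (\<lambda>x. a * f x + (b * g x + 0)) =
       a * G f (\<lambda>x. a * f x + (b * g x + 0)) + b * G g (\<lambda>x. a * f x + (b * g x + 0))"
      using form_lin[OF assms(1) mem m2] form_lin[OF assms(2) zero_mem m2] form_zero[OF m2] by simp
    then show ?thesis using r[OF assms(1)] r[OF assms(2)] form_herm[OF assms(1,2)] by (simp add: algebra_simps)
  qed
  have "G f f = 0" using *[of 1 0] ex[of 1 0] by simp
  moreover have "G g g = 0" using *[of 0 1] ex[of 0 1] by simp
  moreover have "G f g + cnj (G f g) = 0" using *[of 1 1] ex[of 1 1] calculation by simp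
  moreover have "\<i> * G f g - \<i> * cnj (G f g) = 0" using *[of \<i> 1] ex[of \<i> 1] calculation by simp
  ultimately show False using assms(3) by (simp add: complex_eq_iff)
qed

text \<open>By hypothesis the components of \<open>f\<close> and \<open>g\<close> orthogonal to the family do not pair to \<open>0\<close>. By
  polarization some combination of the two components is not isotropic, and it extends the family.\<close>

lemma orth_family_extend:
  assumes h: "orth_family N h" and fg: "f \<in> X" "g \<in> X"
    and ne: "G f g \<noteq> (\<Sum>l<N. G f (h l) * G (h l) g / G (h l) (h l))"
  shows "\<exists>u. orth_family (Suc N) (h(N := u))"
proof -
  have hX: "h i \<in> X" "G (h i) (h i) \<noteq> 0" if "i < N" for i using h that by (auto simp: orth_family_def)
  have ho: "G (h i) (h j) = 0" if "i < N" "j < N" "i \<noteq> j" for i j using h that by (auto simp: orth_family_def)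
  define pr where "pr f = (\<lambda>x. 1 * f x + lcomb {..<N} (\<lambda>l. - G f (h l) / G (h l) (h l)) h x)" for f
  have mem: "lcomb {..<N} c h \<in> X" for c using hX by (intro lcomb_mem) auto
  have prX: "pr f \<in> X" if "f \<in> X" for f unfolding pr_def by (rule lin_mem[OF that mem])
  have prG: "G (pr f) u = G f u - (\<Sum>l<N. G f (h l) * G (h l) u / G (h l) (h l))" if "f \<in> X" "u \<in> X" for f u
  proof -
    have "G (pr f) u = G f u + (\<Sum>l<N. - G f (h l) / G (h l) (h l) * G (h l) u)"
      unfolding pr_def using form_lin[OF that(1) mem that(2), of 1] form_lcomb[of "{..<N}" h u] hX that by simp
    then show ?thesis by (simp add: sum_negf)
  qed
  have orth: "G (pr f) (h j) = 0" if "f \<in> X" "j < N" for f j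
  proof -
    have "(\<Sum>l<N. G f (h l) * G (h l) (h j) / G (h l) (h l)) = G f (h j) * G (h j) (h j) / G (h j) (h j)"
      using ho that(2) by (subst sum.remove[of _ j]) (auto intro!: sum.neutral)
    then show ?thesis using prG[OF that(1) hX(1)[OF that(2)]] hX(2)[OF that(2)] by simp
  qed
  have "G (pr f) (pr g) = cnj (G (pr g) (pr f))" using form_herm prX fg by blast
  also have "G (pr g) (pr f) = G g (pr f)"
  proof -
    have "G (h l) (pr f) = 0" if "l < N" for l
      using form_herm[OF prX[OF fg(1)] hX(1)[OF that]] orth[OF fg(1) that] by simp
    then show ?thesis using prG[OF fg(2) prX[OF fg(1)]] by simp
  qed
  also have "cnj (G g (pr f)) = G (pr f) g" by (rule form_herm[OF fg(2) prX[OF fg(1)], symmetric])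
  finally have "G (pr f) (pr g) \<noteq> 0" using prG[OF fg] ne by simp
  then obtain a b where ab: "G (\<lambda>x. a * pr f x + (b * pr g x + 0)) (\<lambda>x. a * pr f x + (b * pr g x + 0)) \<noteq> 0"
    using polarization[OF prX[OF fg(1)] prX[OF fg(2)]] by blast
  define u where "u = (\<lambda>x. a * pr f x + (b * pr g x + 0))"
  have m1: "(\<lambda>x. b * pr g x + 0) \<in> X" using lin_mem[OF prX[OF fg(2)] zero_mem] .
  have uX: "u \<in> X" unfolding u_def using lin_mem[OF prX[OF fg(1)] m1] .
  have uh: "G u (h j) = 0" "G (h j) u = 0" if "j < N" for j
  proof -
    show "G u (h j) = 0"
      unfolding u_def using form_lin[OF prX[OF fg(1)] m1 hX(1)[OF that]] form_lin[OF prX[OF fg(2)] zero_mem hX(1)[OF that]]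
        orth[OF fg(1) that] orth[OF fg(2) that] form_zero[OF hX(1)[OF that]] by simp
    then show "G (h j) u = 0" using form_herm[OF uX hX(1)[OF that]] by simp
  qed
  have "orth_family (Suc N) (h(N := u))"
    unfolding orth_family_def
  proof (intro conjI allI impI)
    fix i assume "i < Suc N"
    then show "(h(N := u)) i \<in> X" "G ((h(N := u)) i) ((h(N := u)) i) \<noteq> 0"
      using hX uX ab[folded u_def] by (cases "i = N"; simp)+
    fix j assume "j < Suc N" "i \<noteq> j"
    then show "G ((h(N := u)) i) ((h(N := u)) j) = 0"
      using \<open>i < Suc N\<close> ho[of i j] uh[of i] uh[of j] by (cases "i = N"; cases "j = N") simp_all
  qed
  then show ?thesis by blast
qed

text \<open>A family of maximal length has no extension, and by \<open>orth_family_extend\<close> this forces the expansion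
  of the form.\<close>

lemma maximal_orth_family:
  assumes bound: "\<And>N h. orth_family N h \<Longrightarrow> N \<le> B"
  obtains N h where "orth_family N h"
    "\<And>f g. f \<in> X \<Longrightarrow> g \<in> X \<Longrightarrow> G f g = (\<Sum>l<N. G f (h l) * G (h l) g / G (h l) (h l))"
proof -
  define P where "P N \<longleftrightarrow> (\<exists>h. orth_family N h)" for N
  have P0: "P 0" by (simp add: P_def orth_family_def)
  have PB: "\<forall>N. P N \<longrightarrow> N < Suc B" using bound unfolding P_def by (metis less_Suc_eq_le)
  obtain N where N: "P N" "\<forall>N'. P N' \<longrightarrow> N' \<le> N"
    using ex_has_greatest_nat[where P = P and f = "\<lambda>x. x", OF P0 PB] by blast
  obtain h where h: "orth_family N h" using N(1) unfolding P_def by blast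
  have "G f g = (\<Sum>l<N. G f (h l) * G (h l) g / G (h l) (h l))" if "f \<in> X" "g \<in> X" for f g
  proof (rule ccontr)
    assume "G f g \<noteq> (\<Sum>l<N. G f (h l) * G (h l) g / G (h l) (h l))"
    then have "P (Suc N)" unfolding P_def using orth_family_extend[OF h that] by blast
    then show False using N(2) by fastforce
  qed
  then show ?thesis using that h by blast
qed

lemma form_lcomb_orth:
  assumes "orth_family N h" "I \<subseteq> {..<N}"
  shows "G (lcomb I c h) (lcomb I c h) = (\<Sum>i\<in>I. of_real ((cmod (c i))\<^sup>2) * G (h i) (h i))"
proof -
  have fin: "finite I" using assms(2) finite_subset by blast
  have hX: "h i \<in> X" if "i \<in> I" for i using assms that by (auto simp: orth_family_def)
  have "G (lcomb I c h) (lcomb I c h) = (\<Sum>i\<in>I. c i * (\<Sum>j\<in>I. cnj (c j) * G (h i) (h j)))"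
    using form_lcomb[OF fin hX lcomb_mem[OF fin hX]] form_lcomb_right[OF fin hX hX] by simp
  also have "\<dots> = (\<Sum>i\<in>I. of_real ((cmod (c i))\<^sup>2) * G (h i) (h i))"
  proof (rule sum.cong[OF refl])
    fix i assume i: "i \<in> I"
    have "(\<Sum>j\<in>I. cnj (c j) * G (h i) (h j)) = cnj (c i) * G (h i) (h i)"
      using assms i fin by (subst sum.remove[of _ i]) (auto intro!: sum.neutral simp: orth_family_def subset_eq)
    then show "c i * (\<Sum>j\<in>I. cnj (c j) * G (h i) (h j)) = of_real ((cmod (c i))\<^sup>2) * G (h i) (h i)"
      by (simp add: complex_norm_square[symmetric] mult.assoc[symmetric])
  qed
  finally show ?thesis .
qed

lemma orth_family_independent:
  assumes "orth_family N h" "lcomb {..<N} c h \<in> X" "\<And>j. j < N \<Longrightarrow> G (lcomb {..<N} c h) (h j) = 0" "j < N"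
  shows "c j = 0"
proof -
  have "G (lcomb {..<N} c h) (h j) = (\<Sum>i<N. c i * G (h i) (h j))"
    using assms(1,4) by (intro form_lcomb) (auto simp: orth_family_def)
  also have "\<dots> = c j * G (h j) (h j)"
    using assms(1,4) by (subst sum.remove[of _ j]) (auto intro!: sum.neutral simp: orth_family_def)
  finally show ?thesis using assms(1,3,4) by (auto simp: orth_family_def)
qed

text \<open>In the expansion of \<open>G f f\<close> only the negative members of the family contribute.\<close>

lemma form_nonpos_on_positive_complement:
  assumes h: "orth_family N h"
    and rep: "\<And>f g. f \<in> X \<Longrightarrow> g \<in> X \<Longrightarrow> G f g = (\<Sum>l<N. G f (h l) * G (h l) g / G (h l) (h l))"
    and f: "f \<in> X" and orth: "\<And>l. l < N \<Longrightarrow> Re (G (h l) (h l)) > 0 \<Longrightarrow> G f (h l) = 0"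
  shows "Re (G f f) \<le> 0"
proof -
  have "Re (G f (h l) * G (h l) f / G (h l) (h l)) \<le> 0" if l: "l < N" for l
  proof -
    have hX: "h l \<in> X" using h l by (auto simp: orth_family_def)
    have "G (h l) (h l) = of_real (Re (G (h l) (h l)))" using form_self_real[OF hX] by (simp add: complex_eq_iff)
    then have "G f (h l) * G (h l) f / G (h l) (h l) = of_real ((cmod (G f (h l)))\<^sup>2 / Re (G (h l) (h l)))"
      using form_herm[OF f hX] by (metis complex_norm_square of_real_divide)
    then have "Re (G f (h l) * G (h l) f / G (h l) (h l)) = (cmod (G f (h l)))\<^sup>2 / Re (G (h l) (h l))" by simp
    then show ?thesis using orth[OF l] by (cases "Re (G (h l) (h l)) > 0") (auto intro: divide_nonneg_nonpos)
  qed
  then show ?thesis unfolding rep[OF f f] Re_sum by (intro sum_nonpos) auto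
qed

end

section \<open>The differential expression and Green's form in terms of derivatives\<close>

lemma D_mult_Leibniz:
  fixes u v :: "real \<Rightarrow> complex"
  assumes "0 \<le> x" "n > 0 \<Longrightarrow> dd (n - 1) x u" "n > 0 \<Longrightarrow> dd (n - 1) x v"
  shows "D n (\<lambda>t. u t * v t) x = (\<Sum>i\<le>n. of_nat (n choose i) * D (n - i) u x * D i v x)"
  using assms
proof (induction n arbitrary: x)
  case 0 then show ?case by simp
next
  case (Suc n)
  have dn: "dd n x u" "dd n x v" using Suc.prems by auto
  have all: "dd (n - 1) t u" "dd (n - 1) t v" if "n > 0" "0 \<le> t" for t
    using dn that by (auto simp: dd_def differentiable_on_def)
  have eq: "D n (\<lambda>t. u t * v t) t = (\<Sum>i\<le>n. of_nat (n choose i) * D (n - i) u t * D i v t)" if "0 \<le> t" for t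
    using Suc.IH[OF that] all that by blast
  define a where "a i = D (Suc n - i) u x * D i v x" for i
  have "((\<lambda>t. \<Sum>i\<le>n. of_nat (n choose i) * D (n - i) u t * D i v t) has_vector_derivative
     (\<Sum>i\<le>n. of_nat (n choose i) * a i + of_nat (n choose i) * a (Suc i))) (at x within {0..})"
  proof (rule has_vector_derivative_sum)
    fix i assume "i \<in> {..n}"
    then have i: "i \<le> n" by simp
    have "((\<lambda>t. of_nat (n choose i) * (D (n - i) u t * D i v t)) has_vector_derivative
       of_nat (n choose i) * (D (n - i) u x * D (Suc i) v x + D (Suc (n - i)) u x * D i v x)) (at x within {0..})"
      using dn Suc.prems(1) i
      by (intro has_vector_derivative_mult_right has_vector_derivative_mult dd_has[where n = n]) auto
    moreover have "Suc (n - i) = Suc n - i" using i by auto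
    ultimately show "((\<lambda>t. of_nat (n choose i) * D (n - i) u t * D i v t) has_vector_derivative
       of_nat (n choose i) * a i + of_nat (n choose i) * a (Suc i)) (at x within {0..})"
      by (simp add: a_def distrib_left mult.assoc add.commute)
  qed
  then have "hderiv (\<lambda>t. \<Sum>i\<le>n. of_nat (n choose i) * D (n - i) u t * D i v t) x =
     (\<Sum>i\<le>n. of_nat (n choose i) * a i + of_nat (n choose i) * a (Suc i))"
    using hderiv_eqI Suc.prems(1) by blast
  then have "D (Suc n) (\<lambda>t. u t * v t) x = (\<Sum>i\<le>n. of_nat (n choose i) * a i) + (\<Sum>i\<le>n. of_nat (n choose i) * a (Suc i))"
    unfolding D_Suc using hderiv_cong[OF eq Suc.prems(1)] by (simp add: sum.distrib)
  also have "(\<Sum>i\<le>n. of_nat (n choose i) * a i) = a 0 + (\<Sum>i\<le>n. of_nat (n choose Suc i) * a (Suc i))"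
  proof -
    have "(\<Sum>i\<le>n. of_nat (n choose i) * a i) = (\<Sum>i\<le>Suc n. of_nat (n choose i) * a i)" by simp
    also have "\<dots> = a 0 + (\<Sum>i\<le>n. of_nat (n choose Suc i) * a (Suc i))"
      by (subst sum.atMost_Suc_shift) simp
    finally show ?thesis .
  qed
  also have "a 0 + (\<Sum>i\<le>n. of_nat (n choose Suc i) * a (Suc i)) + (\<Sum>i\<le>n. of_nat (n choose i) * a (Suc i))
     = a 0 + (\<Sum>i\<le>n. of_nat (Suc n choose Suc i) * a (Suc i))"
    by (simp add: sum.distrib[symmetric] distrib_right add.commute)
  also have "\<dots> = (\<Sum>i\<le>Suc n. of_nat (Suc n choose i) * a i)"
    by (subst sum.atMost_Suc_shift) simp
  finally show ?case by (simp only: a_def mult.assoc)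
qed

lemma D_zero: "0 \<le> x \<Longrightarrow> D j (\<lambda>_. 0::'a::real_normed_vector) x = 0"
proof (induction j arbitrary: x)
  case (Suc j)
  then show ?case unfolding D_Suc using hderiv_cong[of "D j (\<lambda>_. 0::'a)" "\<lambda>_. 0"]
      hderiv_eqI[OF has_vector_derivative_const] by simp
qed simp

lemma dd_const:
  fixes c :: complex
  assumes "0 \<le> x"
  shows "dd n x (\<lambda>_. c)"
proof (induction n arbitrary: c)
  case 0 then show ?case by (auto simp: dd_def)
next
  case (Suc n)
  have "dd n x (hderiv (\<lambda>_. c)) \<longleftrightarrow> dd n x (\<lambda>_. 0::complex)"
    by (intro dd_cong hderiv_eqI has_vector_derivative_const) (use assms in auto)
  then show ?case using Suc unfolding dd_Suc by (auto intro: differentiable_on_const)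
qed

lemma D_lin:
  assumes "0 \<le> x" "n > 0 \<Longrightarrow> dd (n - 1) x f" "n > 0 \<Longrightarrow> dd (n - 1) x g"
  shows "D n (\<lambda>t. a * f t + g t) x = a * D n f x + (D n g x :: complex)"
  using assms
proof (induction n arbitrary: x)
  case 0 then show ?case by simp
next
  case (Suc n)
  have d: "dd n x f" "dd n x g" using Suc.prems by auto
  have eq: "D n (\<lambda>t. a * f t + g t) t = a * D n f t + D n g t" if "0 \<le> t" for t
    using Suc.IH[OF that] d that by (auto simp: dd_def differentiable_on_def)
  have "((\<lambda>t. a * D n f t + D n g t) has_vector_derivative (a * D (Suc n) f x + D (Suc n) g x)) (at x within {0..})"
    using d Suc.prems(1) by (intro has_vector_derivative_add has_vector_derivative_mult_right dd_has[where n = n]) auto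
  then have "hderiv (\<lambda>t. a * D n f t + D n g t) x = a * D (Suc n) f x + D (Suc n) g x"
    using hderiv_eqI Suc.prems(1) by blast
  then show ?case unfolding D_Suc using hderiv_cong[OF eq Suc.prems(1)] by simp
qed

lemma D_of_real:
  assumes "0 \<le> x" "n > 0 \<Longrightarrow> dd (n - 1) x c"
  shows "D n (\<lambda>t. complex_of_real (c t)) x = of_real (D n c x)"
  using assms
proof (induction n arbitrary: x)
  case 0 then show ?case by simp
next
  case (Suc n)
  have d: "dd n x c" using Suc.prems by auto
  have eq: "D n (\<lambda>t. complex_of_real (c t)) t = of_real (D n c t)" if "0 \<le> t" for t
    using Suc.IH[OF that] d that by (auto simp: dd_def differentiable_on_def)
  have "D n c differentiable (at x within {0..})" using d by (simp add: dd_def)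
  then have "hderiv (\<lambda>t. complex_of_real (D n c t)) x = of_real (hderiv (D n c) x)"
    using has_of_real hderiv_eqI Suc.prems(1) by blast
  then show ?case unfolding D_Suc using hderiv_cong[OF eq Suc.prems(1)] by simp
qed

text \<open>The derivatives of order below \<open>m\<close> exist on the half-line. These are the ones that occur in Green's
  form if the order of the expression is \<open>m\<close>.\<close>

definition smooth :: "nat \<Rightarrow> (real \<Rightarrow> complex) \<Rightarrow> bool" where
  "smooth m f \<longleftrightarrow> (\<forall>j<m-1. D j f differentiable_on {0..})"

lemma D_coeff_Leibniz:
  fixes f :: "real \<Rightarrow> complex"
  assumes c: "C_half p c" and f: "n > 0 \<Longrightarrow> dd (r + n - 1) x f" and n: "n \<le> p" and x: "0 \<le> x"
  shows "D n (\<lambda>t. of_real (c t) * D r f t) x =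
    (\<Sum>i\<le>n. of_nat (n choose i) * of_real (D (n - i) c x) * D (r + i) f x)"
proof -
  have dc: "dd j x c" if "j < n" for j using C_half_dd[OF c] that n x by auto
  have "D n (\<lambda>t. complex_of_real (c t) * D r f t) x =
     (\<Sum>i\<le>n. of_nat (n choose i) * D (n - i) (\<lambda>t. complex_of_real (c t)) x * D i (D r f) x)"
  proof (rule D_mult_Leibniz[OF x])
    show "dd (n - 1) x (\<lambda>t. complex_of_real (c t))" if "n > 0" using dc that x by (intro dd_of_real) auto
    show "dd (n - 1) x (D r f)" if "n > 0" by (rule dd_D[OF f[OF that] _ x]) (use that in auto)
  qed
  also have "\<dots> = (\<Sum>i\<le>n. of_nat (n choose i) * of_real (D (n - i) c x) * D (r + i) f x)"
    by (intro sum.cong refl arg_cong2[of _ _ _ _ "(*)"] D_of_real x)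
       (use dc in \<open>auto simp: D_add add.commute\<close>)
  finally show ?thesis .
qed

lemma smooth_dd: "smooth m f \<Longrightarrow> j < m - 1 \<Longrightarrow> 0 \<le> x \<Longrightarrow> dd j x f"
  by (auto simp: smooth_def dd_def differentiable_on_def)

lemma C_half_continuous:
  assumes "C_half p c" "j \<le> p"
  shows "continuous_on {0..} (\<lambda>x. complex_of_real (D j c x))"
proof (cases "j = p")
  case True then show ?thesis using assms by (auto simp: C_half_def intro: continuous_intros)
next
  case False
  then have "D j c differentiable_on {0..}" using assms by (auto simp: C_half_def)
  then show ?thesis by (intro continuous_intros differentiable_imp_continuous_on)
qed

lemma C_half_AC:
  assumes "C_half p c" "j < p"
  shows "AC_loc (\<lambda>x. complex_of_real (D j c x))"
proof (rule AC_loc_C1)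
  fix x :: real assume "x \<ge> 0"
  then have "D j c differentiable (at x within {0..})"
    using assms by (auto simp: C_half_def differentiable_on_def)
  then show "((\<lambda>x. complex_of_real (D j c x)) has_vector_derivative of_real (D (Suc j) c x)) (at x within {0..})"
    unfolding D_Suc by (rule has_of_real)
next
  show "continuous_on {0..} (\<lambda>x. complex_of_real (D (Suc j) c x))"
    using C_half_continuous[OF assms(1), of "Suc j"] assms(2) by simp
qed

text \<open>What matters about the terms of lower order is that their coefficients are continuous, not what the
  coefficients are.\<close>

definition ldo :: "nat \<Rightarrow> ((real \<Rightarrow> complex) \<Rightarrow> real \<Rightarrow> complex) \<Rightarrow> bool" where
  "ldo m T \<longleftrightarrow> (\<exists>a. (\<forall>j<m. continuous_on {0..} (a j)) \<and>
     (\<forall>f x. 0 \<le> x \<longrightarrow> dd (m - 1) x f \<longrightarrow> T f x = (\<Sum>j<m. a j x * D j f x)))"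

lemma ldoE:
  assumes "ldo m T"
  obtains a where "\<And>j. j < m \<Longrightarrow> continuous_on {0..} (a j)"
    "\<And>f x. 0 \<le> x \<Longrightarrow> dd (m - 1) x f \<Longrightarrow> T f x = (\<Sum>j<m. a j x * D j f x)"
proof -
  obtain a where a: "(\<forall>j<m. continuous_on {0..} (a j)) \<and>
     (\<forall>f x. 0 \<le> x \<longrightarrow> dd (m - 1) x f \<longrightarrow> T f x = (\<Sum>j<m. a j x * D j f x))"
    using assms unfolding ldo_def by (rule exE)
  show ?thesis by (rule that[of a]) (use a in blast)+
qed

lemma ldo_add: "ldo m T \<Longrightarrow> ldo m S \<Longrightarrow> ldo m (\<lambda>f x. T f x + S f x)"
proof -
  assume T: "ldo m T" and S: "ldo m S"
  obtain a where "\<And>j. j < m \<Longrightarrow> continuous_on {0..} (a j)"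
    "\<And>f x. 0 \<le> x \<Longrightarrow> dd (m - 1) x f \<Longrightarrow> T f x = (\<Sum>j<m. a j x * D j f x)"
    using ldoE[OF T] by blast
  moreover obtain b where "\<And>j. j < m \<Longrightarrow> continuous_on {0..} (b j)"
    "\<And>f x. 0 \<le> x \<Longrightarrow> dd (m - 1) x f \<Longrightarrow> S f x = (\<Sum>j<m. b j x * D j f x)"
    using ldoE[OF S] by blast
  ultimately show ?thesis unfolding ldo_def
    by (intro exI[of _ "\<lambda>j x. a j x + b j x"]) (auto simp: sum.distrib distrib_right intro!: continuous_intros)
qed

lemma ldo_term: "continuous_on {0..} c \<Longrightarrow> j < m \<Longrightarrow> ldo m (\<lambda>f x. c x * D j f x)"
  unfolding ldo_def
  by (intro exI[of _ "\<lambda>i. if i = j then c else (\<lambda>x. 0)"])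
     (auto simp: if_distrib[of "\<lambda>y. y _ * _"] cong: if_cong)

lemma ldo_zero: "ldo m (\<lambda>f x. 0)"
  unfolding ldo_def by (intro exI[of _ "\<lambda>i x. 0"]) auto

lemma ldo_mult: "ldo m T \<Longrightarrow> ldo m (\<lambda>f x. c * T f x)"
proof -
  assume T: "ldo m T"
  obtain a where "\<And>j. j < m \<Longrightarrow> continuous_on {0..} (a j)"
    "\<And>f x. 0 \<le> x \<Longrightarrow> dd (m - 1) x f \<Longrightarrow> T f x = (\<Sum>j<m. a j x * D j f x)"
    using ldoE[OF T] by blast
  then show ?thesis unfolding ldo_def
    by (intro exI[of _ "\<lambda>j x. c * a j x"]) (auto simp: sum_distrib_left mult.assoc intro!: continuous_intros)
qed

lemma ldo_sum: "finite I \<Longrightarrow> (\<And>i. i \<in> I \<Longrightarrow> ldo m (T i)) \<Longrightarrow> ldo m (\<lambda>f x. \<Sum>i\<in>I. T i f x)"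
  by (induction I rule: finite_induct) (auto intro: ldo_zero ldo_add)

lemma ldo_cong:
  assumes "ldo m T" "\<And>f x. 0 \<le> x \<Longrightarrow> dd (m - 1) x f \<Longrightarrow> S f x = T f x"
  shows "ldo m S"
proof -
  obtain a where "\<And>j. j < m \<Longrightarrow> continuous_on {0..} (a j)"
    "\<And>f x. 0 \<le> x \<Longrightarrow> dd (m - 1) x f \<Longrightarrow> T f x = (\<Sum>j<m. a j x * D j f x)"
    using ldoE[OF assms(1)] by blast
  then show ?thesis unfolding ldo_def using assms(2) by (intro exI[of _ a]) simp
qed

lemma ldo_coeff:
  assumes c: "C_half p c" and n: "n \<le> p" "r + n < m"
  shows "ldo m (\<lambda>f. D n (\<lambda>t. of_real (c t) * D r f t))"
proof (rule ldo_cong)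
  show "ldo m (\<lambda>f x. \<Sum>i\<le>n. (of_nat (n choose i) * of_real (D (n - i) c x)) * D (r + i) f x)"
    by (rule ldo_sum[OF finite_atMost], rule ldo_term)
       (use n in \<open>auto intro!: continuous_on_mult continuous_on_const C_half_continuous[OF c]\<close>)
  fix f :: "real \<Rightarrow> complex" and x :: real assume x: "0 \<le> x" and f: "dd (m - 1) x f"
  show "D n (\<lambda>t. of_real (c t) * D r f t) x = (\<Sum>i\<le>n. (of_nat (n choose i) * of_real (D (n - i) c x)) * D (r + i) f x)"
  proof (rule D_coeff_Leibniz[OF c _ n(1) x])
    show "dd (r + n - 1) x f" if "n > 0" by (rule dd_mono[OF f _ x]) (use n that in auto)
  qed
qed

text \<open>Order \<open>2 k\<close> is reached only for \<open>r = k\<close> and if no derivative falls on \<open>s k\<close>.\<close>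

lemma M_expr_rep:
  assumes k: "k \<ge> 1" and s: "\<And>r. r \<le> k \<Longrightarrow> C_half r (s r)" and q: "\<And>r. r < k \<Longrightarrow> C_half (r + 1) (q r)"
  obtains a where "\<And>j. j < 2*k \<Longrightarrow> continuous_on {0..} (a j)"
    "\<And>f x. 0 \<le> x \<Longrightarrow> dd (2*k-1) x f \<Longrightarrow>
        M_expr k s q f x = (-1)^k * of_real (s k x) * D (2*k) f x + (\<Sum>j<2*k. a j x * D j f x)"
proof -
  define L where "L f x = (\<Sum>r<k. (-1)^r * D r (\<lambda>t. of_real (s r t) * D r f t) x)
      + (-1)^k * (\<Sum>i<k. (of_nat (k choose i) * of_real (D (k - i) (s k) x)) * D (k + i) f x)
      + 1/2 * (\<Sum>r<k. \<i>^(2*r+1) *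
         (D (r+1) (\<lambda>t. of_real (q r t) * D r f t) x + D r (\<lambda>t. of_real (q r t) * D (r+1) f t) x))" for f x
  have 1: "ldo (2*k) (\<lambda>f x. \<Sum>r<k. (-1)^r * D r (\<lambda>t. of_real (s r t) * D r f t) x)"
    by (rule ldo_sum[OF finite_lessThan], rule ldo_mult, rule ldo_coeff[OF s]) auto
  have 2: "ldo (2*k) (\<lambda>f x. (-1)^k * (\<Sum>i<k. (of_nat (k choose i) * of_real (D (k - i) (s k) x)) * D (k + i) f x))"
    by (rule ldo_mult, rule ldo_sum[OF finite_lessThan], rule ldo_term)
       (auto intro!: continuous_on_mult continuous_on_const C_half_continuous[OF s])
  have 3: "ldo (2*k) (\<lambda>f. D (r+1) (\<lambda>t. of_real (q r t) * D r f t))" if "r < k" for r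
    by (rule ldo_coeff[OF q]) (use that in auto)
  have 4: "ldo (2*k) (\<lambda>f. D r (\<lambda>t. of_real (q r t) * D (r+1) f t))" if "r < k" for r
    by (rule ldo_coeff[OF q]) (use that in auto)
  have 5: "ldo (2*k) (\<lambda>f x. 1/2 * (\<Sum>r<k. \<i>^(2*r+1) *
         (D (r+1) (\<lambda>t. of_real (q r t) * D r f t) x + D r (\<lambda>t. of_real (q r t) * D (r+1) f t) x)))"
    by (rule ldo_mult, rule ldo_sum[OF finite_lessThan], rule ldo_mult, rule ldo_add) (use 3 4 in auto)
  have "ldo (2*k) L"
    unfolding L_def[abs_def] by (rule ldo_add[OF ldo_add[OF 1 2] 5])
  then obtain a where a: "\<And>j. j < 2*k \<Longrightarrow> continuous_on {0..} (a j)"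
    "\<And>f x. 0 \<le> x \<Longrightarrow> dd (2*k - 1) x f \<Longrightarrow> L f x = (\<Sum>j<2*k. a j x * D j f x)"
    using ldoE by blast
  have "M_expr k s q f x = (-1)^k * of_real (s k x) * D (2*k) f x + L f x" if "0 \<le> x" "dd (2*k-1) x f" for f x
  proof -
    have "D k (\<lambda>t. of_real (s k t) * D k f t) x = (\<Sum>i\<le>k. of_nat (k choose i) * of_real (D (k - i) (s k) x) * D (k + i) f x)"
      using k that by (intro D_coeff_Leibniz[OF s]) (auto simp: mult_2)
    also have "\<dots> = of_real (s k x) * D (2*k) f x + (\<Sum>i<k. of_nat (k choose i) * of_real (D (k - i) (s k) x) * D (k + i) f x)"
      by (simp add: lessThan_Suc_atMost[symmetric] mult_2)
    finally have *: "D k (\<lambda>t. of_real (s k t) * D k f t) x = \<dots>" .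
    have "{..k} = insert k {..<k}" by auto
    then show ?thesis unfolding M_expr_def L_def by (simp add: * distrib_left mult.assoc)
  qed
  then show ?thesis using that a by auto
qed

definition bil :: "nat \<Rightarrow> (nat \<Rightarrow> nat \<Rightarrow> real \<Rightarrow> complex) \<Rightarrow> (real \<Rightarrow> complex) \<Rightarrow> (real \<Rightarrow> complex) \<Rightarrow> real \<Rightarrow> complex" where
  "bil m B f g x = (\<Sum>j<m. \<Sum>l<m. B j l x * D j f x * cnj (D l g x))"

text \<open>The bound \<open>d\<close> on the total order \<open>j + l\<close> is recorded because it makes the matrix of coefficients of
  Green's form triangular; absolutely continuous coefficients make the form absolutely continuous.\<close>

definition bilin_rep :: "nat \<Rightarrow> nat \<Rightarrow> ((real \<Rightarrow> complex) \<Rightarrow> (real \<Rightarrow> complex) \<Rightarrow> real \<Rightarrow> complex) \<Rightarrow> bool" where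
  "bilin_rep m d \<Phi> \<longleftrightarrow> (\<exists>B. (\<forall>j l. AC_loc (B j l)) \<and> (\<forall>j l x. d < j + l \<longrightarrow> B j l x = 0) \<and>
     (\<forall>f g x. 0 \<le> x \<longrightarrow> smooth m f \<longrightarrow> smooth m g \<longrightarrow> \<Phi> f g x = bil m B f g x))"

lemma bilin_repE:
  assumes "bilin_rep m d \<Phi>"
  obtains B where "\<And>j l. AC_loc (B j l)" "\<And>j l x. d < j + l \<Longrightarrow> B j l x = 0"
    "\<And>f g x. 0 \<le> x \<Longrightarrow> smooth m f \<Longrightarrow> smooth m g \<Longrightarrow> \<Phi> f g x = bil m B f g x"
  using assms unfolding bilin_rep_def by metis

lemma bilin_rep_add: 
  assumes "bilin_rep m d T" "bilin_rep m d S"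
  shows "bilin_rep m d (\<lambda>f g x. T f g x + S f g x)"
proof -
  obtain A where A: "\<And>j l. AC_loc (A j l)" "\<And>j l x. d < j + l \<Longrightarrow> A j l x = 0"
    "\<And>f g x. 0 \<le> x \<Longrightarrow> smooth m f \<Longrightarrow> smooth m g \<Longrightarrow> T f g x = bil m A f g x"
    using bilin_repE[OF assms(1)] by metis
  obtain B where B: "\<And>j l. AC_loc (B j l)" "\<And>j l x. d < j + l \<Longrightarrow> B j l x = 0"
    "\<And>f g x. 0 \<le> x \<Longrightarrow> smooth m f \<Longrightarrow> smooth m g \<Longrightarrow> S f g x = bil m B f g x"
    using bilin_repE[OF assms(2)] by metis
  show ?thesis unfolding bilin_rep_def
    by (intro exI[of _ "\<lambda>j l x. A j l x + B j l x"])
       (auto simp: A B bil_def sum.distrib distrib_right intro!: AC_loc_add)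
qed

lemma bilin_rep_mult: 
  assumes "bilin_rep m d T"
  shows "bilin_rep m d (\<lambda>f g x. c * T f g x)"
proof -
  obtain A where A: "\<And>j l. AC_loc (A j l)" "\<And>j l x. d < j + l \<Longrightarrow> A j l x = 0"
    "\<And>f g x. 0 \<le> x \<Longrightarrow> smooth m f \<Longrightarrow> smooth m g \<Longrightarrow> T f g x = bil m A f g x"
    using bilin_repE[OF assms(1)] by metis
  show ?thesis unfolding bilin_rep_def
    by (intro exI[of _ "\<lambda>j l x. c * A j l x"])
       (auto simp: A bil_def sum_distrib_left mult.assoc intro!: AC_loc_mult AC_loc_const)
qed

lemma bilin_rep_cnj: 
  assumes "bilin_rep m d T"
  shows "bilin_rep m d (\<lambda>f g x. cnj (T g f x))"
proof -
  obtain A where A: "\<And>j l. AC_loc (A j l)" "\<And>j l x. d < j + l \<Longrightarrow> A j l x = 0"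
    "\<And>f g x. 0 \<le> x \<Longrightarrow> smooth m f \<Longrightarrow> smooth m g \<Longrightarrow> T f g x = bil m A f g x"
    using bilin_repE[OF assms(1)] by metis
  have "cnj (bil m A g f x) = bil m (\<lambda>j l x. cnj (A l j x)) f g x" for f g x
    unfolding bil_def cnj_sum by (subst sum.swap) (simp add: mult_ac)
  then show ?thesis unfolding bilin_rep_def
    by (intro exI[of _ "\<lambda>j l x. cnj (A l j x)"])
       (auto simp: A intro!: AC_loc_cnj)
qed

lemma bilin_rep_zero: "bilin_rep m d (\<lambda>f g x. 0)"
  unfolding bilin_rep_def by (intro exI[of _ "\<lambda>i j x. 0"]) (auto simp: bil_def intro: AC_loc_const)

lemma bilin_rep_diff: "bilin_rep m d T \<Longrightarrow> bilin_rep m d S \<Longrightarrow> bilin_rep m d (\<lambda>f g x. T f g x - S f g x)"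
  using bilin_rep_add[of m d T "\<lambda>f g x. (-1) * S f g x"] bilin_rep_mult[of m d S "-1"] by simp

lemma bilin_rep_sum: "finite I \<Longrightarrow> (\<And>i. i \<in> I \<Longrightarrow> bilin_rep m d (T i)) \<Longrightarrow> bilin_rep m d (\<lambda>f g x. \<Sum>i\<in>I. T i f g x)"
  by (induction I rule: finite_induct) (auto intro: bilin_rep_zero bilin_rep_add)

lemma bilin_rep_term:
  assumes "AC_loc c" "i < m" "n < m" "i + n \<le> d"
  shows "bilin_rep m d (\<lambda>f g x. c x * D i f x * cnj (D n g x))"
proof -
  define B where "B j l = (if j = i \<and> l = n then c else (\<lambda>x. 0))" for j l
  have "bil m B f g x = c x * D i f x * cnj (D n g x)" for f g x
  proof -
    have "bil m B f g x = (\<Sum>j<m. if j = i then (\<Sum>l<m. if l = n then c x * D j f x * cnj (D l g x) else 0) else 0)"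
      unfolding bil_def
    proof (intro sum.cong refl)
      fix j
      show "(\<Sum>l<m. B j l x * D j f x * cnj (D l g x)) =
          (if j = i then (\<Sum>l<m. if l = n then c x * D j f x * cnj (D l g x) else 0) else 0)"
      proof (cases "j = i")
        case True
        then show ?thesis unfolding True if_P[OF refl] by (intro sum.cong refl) (simp add: B_def)
      qed (simp add: B_def)
    qed
    then show ?thesis using assms(2,3) by simp
  qed
  moreover have "AC_loc (B j l)" for j l using assms(1) by (simp add: B_def AC_loc_const)
  moreover have "B j l x = 0" if "d < j + l" for j l x using that assms(4) by (auto simp: B_def)
  ultimately show ?thesis unfolding bilin_rep_def by (intro exI[of _ B]) auto
qed

lemma bilin_rep_cong:
  assumes "bilin_rep m d T" "\<And>f g x. 0 \<le> x \<Longrightarrow> smooth m f \<Longrightarrow> smooth m g \<Longrightarrow> S f g x = T f g x"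
  shows "bilin_rep m d S"
proof -
  obtain A where A: "\<And>j l. AC_loc (A j l)" "\<And>j l x. d < j + l \<Longrightarrow> A j l x = 0"
    "\<And>f g x. 0 \<le> x \<Longrightarrow> smooth m f \<Longrightarrow> smooth m g \<Longrightarrow> T f g x = bil m A f g x"
    using bilin_repE[OF assms(1)] by metis
  then show ?thesis unfolding bilin_rep_def using assms(2) by (intro exI[of _ A]) simp
qed

lemma bilin_rep_coeff:
  assumes c: "C_half p c" and n: "n < p" "r + n < m" "j < m" "r + n + j \<le> d"
  shows "bilin_rep m d (\<lambda>f g x. D n (\<lambda>t. of_real (c t) * D r f t) x * cnj (D j g x))"
proof (rule bilin_rep_cong)
  show "bilin_rep m d (\<lambda>f g x. \<Sum>i\<le>n. (of_nat (n choose i) * of_real (D (n - i) c x)) * D (r + i) f x * cnj (D j g x))"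
    using assms by (intro bilin_rep_sum bilin_rep_term AC_loc_mult AC_loc_const C_half_AC[OF c]) auto
  fix f g :: "real \<Rightarrow> complex" and x :: real assume "0 \<le> x" "smooth m f" "smooth m g"
  then show "D n (\<lambda>t. of_real (c t) * D r f t) x * cnj (D j g x) =
     (\<Sum>i\<le>n. (of_nat (n choose i) * of_real (D (n - i) c x)) * D (r + i) f x * cnj (D j g x))"
    using n by (subst D_coeff_Leibniz[OF c]) (auto simp: sum_distrib_right intro: smooth_dd)
qed

lemma bilin_rep_ibp:
  assumes c: "C_half p c" and n: "n \<le> p" "r + n \<le> m" "r + n \<le> d + 1"
  shows "bilin_rep m d (\<lambda>f g x. ibp n (\<lambda>t. of_real (c t) * D r f t) g x)"
  unfolding ibp_def
proof (rule bilin_rep_sum)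
  fix j assume "j \<in> {..<n}"
  then have j: "j < n" by simp
  have "bilin_rep m d (\<lambda>f g x. (-1)^j * (D (n-1-j) (\<lambda>t. of_real (c t) * D r f t) x * cnj (D j g x)))"
    using n j by (intro bilin_rep_mult bilin_rep_coeff[OF c]) auto
  then show "bilin_rep m d (\<lambda>f g x. (-1)^j * D (n-1-j) (\<lambda>t. of_real (c t) * D r f t) x * cnj (D j g x))"
    by (simp only: mult.assoc)
qed simp

text \<open>The coefficients of Green's form of total order \<open>2 k - 1\<close>, with \<open>w\<close> in place of the leading
  coefficient \<open>s k\<close>.\<close>

definition antidiagonal :: "nat \<Rightarrow> (real \<Rightarrow> real) \<Rightarrow> nat \<Rightarrow> nat \<Rightarrow> real \<Rightarrow> complex" where
  "antidiagonal k w j l x = (if j + l = 2*k - 1 then (if l < k then (-1)^(k+l) else - ((-1)^(k+j))) * of_real (w x) else 0)"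

lemma bil_antidiagonal:
  assumes k: "k \<ge> 1"
  shows "bil (2*k) (antidiagonal k w) f g x =
    (\<Sum>j<k. (-1)^(k+j) * of_real (w x) * (D (2*k-1-j) f x * cnj (D j g x) - D j f x * cnj (D (2*k-1-j) g x)))"
proof -
  define b where "b j l = antidiagonal k w j l x * D j f x * cnj (D l g x)" for j l
  have "bil (2*k) (antidiagonal k w) f g x = (\<Sum>j<2*k. b j (2*k-1-j))"
    unfolding bil_def b_def[symmetric]
  proof (rule sum.cong[OF refl])
    fix j assume "j \<in> {..<2*k}"
    then have j: "2*k-1-j < 2*k" "j \<le> 2*k-1" by auto
    have "b j l = 0" if "l \<noteq> 2*k-1-j" for l using that j unfolding b_def antidiagonal_def by auto
    then show "(\<Sum>l<2*k. b j l) = b j (2*k-1-j)"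
      using j by (subst sum.remove[of _ "2*k-1-j"]) (auto intro!: sum.neutral)
  qed
  also have "\<dots> = (\<Sum>j<k. b j (2*k-1-j)) + (\<Sum>j\<in>{k..<2*k}. b j (2*k-1-j))"
  proof -
    have "{..<2*k} = {..<k} \<union> {k..<2*k}" by auto
    then show ?thesis by (simp add: sum.union_disjoint ivl_disj_int)
  qed
  also have "(\<Sum>j\<in>{k..<2*k}. b j (2*k-1-j)) = (\<Sum>j<k. b (2*k-1-j) j)"
    by (rule sum.reindex_bij_witness[of _ "\<lambda>j. 2*k-1-j" "\<lambda>j. 2*k-1-j"]) auto
  also have "(\<Sum>j<k. b j (2*k-1-j)) + (\<Sum>j<k. b (2*k-1-j) j) = (\<Sum>j<k. b j (2*k-1-j) + b (2*k-1-j) j)"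
    by (simp add: sum.distrib)
  also have "\<dots> = (\<Sum>j<k. (-1)^(k+j) * of_real (w x) * (D (2*k-1-j) f x * cnj (D j g x) - D j f x * cnj (D (2*k-1-j) g x)))"
  proof (rule sum.cong[OF refl])
    fix j assume "j \<in> {..<k}"
    then have "j + (2*k-1-j) = 2*k-1" "\<not> 2*k-1-j < k" "j < k" by auto
    then show "b j (2*k-1-j) + b (2*k-1-j) j =
       (-1)^(k+j) * of_real (w x) * (D (2*k-1-j) f x * cnj (D j g x) - D j f x * cnj (D (2*k-1-j) g x))"
      unfolding b_def antidiagonal_def by (simp add: algebra_simps)
  qed
  finally show ?thesis .
qed

text \<open>The total order drops to at most \<open>2 k - 2\<close> as soon as a derivative falls on the coefficient.\<close>

lemma ibp_leading:
  assumes c: "C_half k c" and k: "k \<ge> 1"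
  shows "bilin_rep (2*k) (2*k-2) (\<lambda>f g x. ibp k (\<lambda>t. of_real (c t) * D k f t) g x
     - (\<Sum>j<k. (-1)^j * of_real (c x) * D (2*k-1-j) f x * cnj (D j g x)))"
proof (rule bilin_rep_cong)
  show "bilin_rep (2*k) (2*k-2) (\<lambda>f g x. \<Sum>j<k. \<Sum>i<k-1-j.
          ((-1)^j * (of_nat ((k-1-j) choose i) * of_real (D (k-1-j-i) c x))) * D (k+i) f x * cnj (D j g x))"
  proof (rule bilin_rep_sum[OF finite_lessThan], rule bilin_rep_sum[OF finite_lessThan], rule bilin_rep_term)
    fix j i assume "j \<in> {..<k}" "i \<in> {..<k-1-j}"
    then show "AC_loc (\<lambda>x. (-1)^j * (of_nat ((k-1-j) choose i) * complex_of_real (D (k-1-j-i) c x)))"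
      "k + i < 2*k" "j < 2*k" "k + i + j \<le> 2*k - 2"
      by (auto intro!: AC_loc_mult AC_loc_const C_half_AC[OF c])
  qed
  fix f g :: "real \<Rightarrow> complex" and x :: real assume x: "0 \<le> x" and f: "smooth (2*k) f" and g: "smooth (2*k) g"
  have *: "D (k-1-j) (\<lambda>t. of_real (c t) * D k f t) x = of_real (c x) * D (2*k-1-j) f x +
      (\<Sum>i<k-1-j. of_nat ((k-1-j) choose i) * of_real (D (k-1-j-i) c x) * D (k+i) f x)" if j: "j < k" for j
  proof -
    have "D (k-1-j) (\<lambda>t. of_real (c t) * D k f t) x =
      (\<Sum>i\<le>k-1-j. of_nat ((k-1-j) choose i) * of_real (D (k-1-j-i) c x) * D (k+i) f x)"
      using j x by (intro D_coeff_Leibniz[OF c] smooth_dd[OF f]) auto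
    moreover have "k + (k-1-j) = 2*k-1-j" using j by auto
    ultimately show ?thesis by (simp add: lessThan_Suc_atMost[symmetric])
  qed
  have "ibp k (\<lambda>t. of_real (c t) * D k f t) g x = (\<Sum>j<k. (-1)^j * of_real (c x) * D (2*k-1-j) f x * cnj (D j g x) +
     (\<Sum>i<k-1-j. ((-1)^j * (of_nat ((k-1-j) choose i) * of_real (D (k-1-j-i) c x))) * D (k+i) f x * cnj (D j g x)))"
    unfolding ibp_def
  proof (rule sum.cong[OF refl])
    fix j assume "j \<in> {..<k}"
    then have "j < k" by simp
    then show "(-1)^j * D (k-1-j) (\<lambda>t. of_real (c t) * D k f t) x * cnj (D j g x) =
      (-1)^j * of_real (c x) * D (2*k-1-j) f x * cnj (D j g x) +
     (\<Sum>i<k-1-j. ((-1)^j * (of_nat ((k-1-j) choose i) * of_real (D (k-1-j-i) c x))) * D (k+i) f x * cnj (D j g x))"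
      unfolding *[OF \<open>j < k\<close>] distrib_left distrib_right sum_distrib_left sum_distrib_right by (simp only: mult.assoc)
  qed
  then show "ibp k (\<lambda>t. of_real (c t) * D k f t) g x - (\<Sum>j<k. (-1)^j * of_real (c x) * D (2*k-1-j) f x * cnj (D j g x)) =
     (\<Sum>j<k. \<Sum>i<k-1-j. ((-1)^j * (of_nat ((k-1-j) choose i) * of_real (D (k-1-j-i) c x))) * D (k+i) f x * cnj (D j g x))"
    by (simp add: sum.distrib)
qed

text \<open>The matrix of coefficients is \<open>0\<close> where \<open>j + l \<ge> 2 k\<close> and \<open>\<plusminus> s k\<close> on the antidiagonal \<open>j + l = 2 k - 1\<close>:
  all terms other than the leading one have a smaller total order. This triangular shape yields both
  nondegeneracy and the isotropic subspace of dimension \<open>k\<close>.\<close>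

lemma green_form_rep:
  assumes k: "k \<ge> 1" and s: "\<And>r. r \<le> k \<Longrightarrow> C_half r (s r)" and q: "\<And>r. r < k \<Longrightarrow> C_half (r + 1) (q r)"
  obtains B where "\<And>j l. AC_loc (B j l)" "\<And>j l x. 2*k \<le> j + l \<Longrightarrow> B j l x = 0"
    "\<And>j x. j < 2*k \<Longrightarrow> 0 \<le> x \<Longrightarrow> s k x \<noteq> 0 \<Longrightarrow> B j (2*k-1-j) x \<noteq> 0"
    "\<And>f g x. 0 \<le> x \<Longrightarrow> smooth (2*k) f \<Longrightarrow> smooth (2*k) g \<Longrightarrow> green_form k s q f g x = bil (2*k) B f g x"
proof -
  define Lf where "Lf f r = (\<lambda>t. complex_of_real (s r t) * D r f t)" for f r
  define Pf where "Pf f r = (\<lambda>t. complex_of_real (q r t) * D r f t)" for f r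
  define Qf where "Qf f r = (\<lambda>t. complex_of_real (q r t) * D (r+1) f t)" for f r
  define E where "E f g x = ibp k (Lf f k) g x - (\<Sum>j<k. (-1)^j * of_real (s k x) * D (2*k-1-j) f x * cnj (D j g x))" for f g x
  define R where "R f g x = (\<Sum>r<k. (-1)^r * (ibp r (Lf f r) g x - cnj (ibp r (Lf g r) f x)))
      + (-1)^k * (E f g x - cnj (E g f x))
      + 1/2 * (\<Sum>r<k. \<i>^(2*r+1) * (ibp (r+1) (Pf f r) g x + ibp r (Qf f r) g x
         + cnj (ibp (r+1) (Pf g r) f x + ibp r (Qf g r) f x)))" for f g x
  have L: "bilin_rep (2*k) (2*k-2) (\<lambda>f. ibp r (Lf f r))" if "r < k" for r
    unfolding Lf_def by (rule bilin_rep_ibp[OF s]) (use that in auto)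
  have P: "bilin_rep (2*k) (2*k-2) (\<lambda>f. ibp (r+1) (Pf f r))" if "r < k" for r
    unfolding Pf_def by (rule bilin_rep_ibp[OF q]) (use that in auto)
  have Q: "bilin_rep (2*k) (2*k-2) (\<lambda>f. ibp r (Qf f r))" if "r < k" for r
    unfolding Qf_def by (rule bilin_rep_ibp[OF q]) (use that in auto)
  have E: "bilin_rep (2*k) (2*k-2) E"
    unfolding E_def[abs_def] Lf_def by (rule ibp_leading[OF s k]) simp
  have 1: "bilin_rep (2*k) (2*k-2) (\<lambda>f g x. \<Sum>r<k. (-1)^r * (ibp r (Lf f r) g x - cnj (ibp r (Lf g r) f x)))"
    by (rule bilin_rep_sum[OF finite_lessThan], rule bilin_rep_mult, rule bilin_rep_diff, rule L, simp,
        rule bilin_rep_cnj, rule L, simp)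
  have 2: "bilin_rep (2*k) (2*k-2) (\<lambda>f g x. (-1)^k * (E f g x - cnj (E g f x)))"
    by (rule bilin_rep_mult, rule bilin_rep_diff[OF E bilin_rep_cnj[OF E]])
  have 3: "bilin_rep (2*k) (2*k-2) (\<lambda>f g x. ibp (r+1) (Pf f r) g x + ibp r (Qf f r) g x)" if "r < k" for r
    by (rule bilin_rep_add[OF P[OF that] Q[OF that]])
  have 4: "bilin_rep (2*k) (2*k-2) (\<lambda>f g x. 1/2 * (\<Sum>r<k. \<i>^(2*r+1) * (ibp (r+1) (Pf f r) g x + ibp r (Qf f r) g x
         + cnj (ibp (r+1) (Pf g r) f x + ibp r (Qf g r) f x))))"
  proof (rule bilin_rep_mult, rule bilin_rep_sum[OF finite_lessThan], rule bilin_rep_mult)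
    fix r assume "r \<in> {..<k}"
    then have r: "r < k" by simp
    show "bilin_rep (2*k) (2*k-2) (\<lambda>f g x. ibp (r+1) (Pf f r) g x + ibp r (Qf f r) g x
         + cnj (ibp (r+1) (Pf g r) f x + ibp r (Qf g r) f x))"
      by (rule bilin_rep_add[OF 3[OF r] bilin_rep_cnj[OF 3[OF r]]])
  qed
  have R: "bilin_rep (2*k) (2*k-2) R"
    unfolding R_def[abs_def] by (rule bilin_rep_add[OF bilin_rep_add[OF 1 2] 4])
  obtain A where A: "\<And>j l. AC_loc (A j l)" "\<And>j l x. 2*k-2 < j + l \<Longrightarrow> A j l x = 0"
    "\<And>f g x. 0 \<le> x \<Longrightarrow> smooth (2*k) f \<Longrightarrow> smooth (2*k) g \<Longrightarrow> R f g x = bil (2*k) A f g x"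
    using bilin_repE[OF R] by metis
  define B where "B j l x = A j l x + antidiagonal k (s k) j l x" for j l x
  have eq: "green_form k s q f g x = R f g x + bil (2*k) (antidiagonal k (s k)) f g x" for f g x
  proof -
    have "(\<Sum>r\<le>k. (-1)^r * (ibp r (Lf f r) g x - cnj (ibp r (Lf g r) f x))) =
       (\<Sum>r<k. (-1)^r * (ibp r (Lf f r) g x - cnj (ibp r (Lf g r) f x))) + (-1)^k * (ibp k (Lf f k) g x - cnj (ibp k (Lf g k) f x))"
      by (simp add: lessThan_Suc_atMost[symmetric])
    moreover have "(-1)^k * (ibp k (Lf f k) g x - cnj (ibp k (Lf g k) f x)) =
        (-1)^k * (E f g x - cnj (E g f x)) + bil (2*k) (antidiagonal k (s k)) f g x"
      unfolding bil_antidiagonal[OF k] E_def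
      by (simp add: sum_subtractf sum_distrib_left power_add algebra_simps)
    ultimately show ?thesis unfolding green_form_def R_def Lf_def[symmetric] Pf_def[symmetric] Qf_def[symmetric] by simp
  qed
  show ?thesis
  proof (rule that[of B])
    fix j l
    have "AC_loc (antidiagonal k (s k) j l)"
    proof -
      have "C_half k (s k)" using s by simp
      then have "AC_loc (\<lambda>x. complex_of_real (D 0 (s k) x))" by (rule C_half_AC) (use k in simp)
      then have "AC_loc (\<lambda>x. c * complex_of_real (s k x))" for c
        by (intro AC_loc_mult AC_loc_const) simp
      from this[of "(-1)^(k+l)"] this[of "- ((-1)^(k+j))"] show ?thesis unfolding antidiagonal_def[abs_def]
        by (cases "j + l = 2*k-1"; cases "l < k") (simp_all add: AC_loc_const)
    qed
    then show "AC_loc (B j l)" unfolding B_def[abs_def] by (rule AC_loc_add[OF A(1)])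
  next
    fix j l x assume "2*k \<le> j + l"
    then show "B j l x = 0" using k unfolding B_def antidiagonal_def by (simp add: A(2))
  next
    fix j and x :: real assume j: "j < 2*k" and "s k x \<noteq> 0"
    moreover have "2*k-2 < 2*k-1" using k by linarith
    moreover have "j + (2*k-1-j) = 2*k-1" using j by simp
    ultimately show "B j (2*k-1-j) x \<noteq> 0" unfolding B_def antidiagonal_def by (simp del: One_nat_def add: A(2))
  next
    fix f g :: "real \<Rightarrow> complex" and x :: real assume "0 \<le> x" "smooth (2*k) f" "smooth (2*k) g"
    then show "green_form k s q f g x = bil (2*k) B f g x"
      unfolding eq using A(3)[of x f g] unfolding bil_def B_def by (simp add: sum.distrib distrib_right)
  qed
qed

section \<open>Linear initial value problems\<close>

text \<open>The terms of the series, that is, the differences of consecutive iterates; the solution is the sum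
  over \<open>n\<close>.\<close>

primrec picard :: "nat \<Rightarrow> (nat \<Rightarrow> nat \<Rightarrow> real \<Rightarrow> complex) \<Rightarrow> (nat \<Rightarrow> complex) \<Rightarrow> nat \<Rightarrow> nat \<Rightarrow> real \<Rightarrow> complex" where
  "picard m A v 0 = (\<lambda>j x. v j)"
| "picard m A v (Suc n) = (\<lambda>j x. integral {0..x} (\<lambda>t. \<Sum>l<m. A j l t * picard m A v n l t))"

lemma picard_continuous:
  assumes "\<And>j l. j < m \<Longrightarrow> l < m \<Longrightarrow> continuous_on {0..} (A j l)"
  shows "j < m \<Longrightarrow> continuous_on {0..} (picard m A v n j)"
proof (induction n arbitrary: j)
  case 0 then show ?case by (simp add: continuous_on_const)
next
  case (Suc n)
  have c: "continuous_on {0..} (\<lambda>t. \<Sum>l<m. A j l t * picard m A v n l t)"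
    using assms Suc by (intro continuous_on_sum continuous_on_mult) auto
  show ?case
    unfolding continuous_on_half_line_iff
  proof (intro allI impI)
    fix X :: real assume "X \<ge> 0"
    have "(\<lambda>t. \<Sum>l<m. A j l t * picard m A v n l t) integrable_on {0..X}"
      by (intro integrable_continuous_real continuous_on_subset[OF c]) auto
    then show "continuous_on {0..X} (picard m A v (Suc n) j)"
      using indefinite_integral_continuous_1 by simp
  qed
qed

lemma picard_bound:
  assumes A: "\<And>j l. j < m \<Longrightarrow> l < m \<Longrightarrow> continuous_on {0..} (A j l)"
    and K: "\<And>j l x. j < m \<Longrightarrow> l < m \<Longrightarrow> x \<in> {0..X} \<Longrightarrow> norm (A j l x) \<le> K" and C: "\<And>j. j < m \<Longrightarrow> norm (v j) \<le> C"
    and K0: "K \<ge> 0" and C0: "C \<ge> 0"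
  shows "j < m \<Longrightarrow> x \<in> {0..X} \<Longrightarrow> norm (picard m A v n j x) \<le> C * (real m * K * x) ^ n / fact n"
proof (induction n arbitrary: j x)
  case 0 then show ?case using C by simp
next
  case (Suc n)
  let ?f = "\<lambda>t. \<Sum>l<m. A j l t * picard m A v n l t"
  let ?g = "\<lambda>t. C * (real m * K) ^ Suc n / fact n * t ^ n"
  have c: "continuous_on {0..} ?f"
    using A picard_continuous[OF A] Suc by (intro continuous_on_sum continuous_on_mult) auto
  have "norm (integral {0..x} ?f) \<le> integral {0..x} ?g"
  proof (rule integral_norm_bound_integral)
    show "?f integrable_on {0..x}"
      by (intro integrable_continuous_real continuous_on_subset[OF c]) auto
    show "?g integrable_on {0..x}" by (intro integrable_continuous_real continuous_intros)
    fix t assume t: "t \<in> {0..x}"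
    have "norm (?f t) \<le> (\<Sum>l<m. K * (C * (real m * K * t) ^ n / fact n))"
    proof (rule sum_norm_le)
      fix l assume "l \<in> {..<m}"
      then have l: "l < m" by simp
      have tX: "t \<in> {0..X}" using t Suc.prems by auto
      show "norm (A j l t * picard m A v n l t) \<le> K * (C * (real m * K * t) ^ n / fact n)"
        unfolding norm_mult using K[OF Suc.prems(1) l tX] Suc.IH[OF l tX] K0 by (intro mult_mono) auto
    qed
    also have "\<dots> = ?g t" by (simp add: power_mult_distrib)
    finally show "norm (?f t) \<le> ?g t" .
  qed
  also have "integral {0..x} ?g = C * (real m * K) ^ Suc n / fact n * (x ^ Suc n / Suc n)"
  proof (rule integral_unique)
    have "((\<lambda>t. t ^ n) has_integral (x ^ Suc n / Suc n - 0 ^ Suc n / Suc n)) {0..x}"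
    proof (rule fundamental_theorem_of_calculus)
      fix t :: real
      have "((\<lambda>t. t ^ Suc n / Suc n) has_real_derivative (real (Suc n) * t ^ n / Suc n)) (at t within {0..x})"
        by (intro DERIV_cdivide) (use DERIV_subset[OF DERIV_pow[of "Suc n" t]] in auto)
      then show "((\<lambda>t. t ^ Suc n / Suc n) has_vector_derivative t ^ n) (at t within {0..x})"
        by (simp add: has_real_derivative_iff_has_vector_derivative del: of_nat_Suc)
    qed (use Suc.prems in auto)
    then show "(?g has_integral C * (real m * K) ^ Suc n / fact n * (x ^ Suc n / Suc n)) {0..x}"
      by (intro has_integral_mult_right) simp
  qed
  also have "\<dots> = C * (real m * K * x) ^ Suc n / fact (Suc n)"
    by (simp add: power_mult_distrib mult_ac)
  finally show ?case by simp
qed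

text \<open>On every compact interval the Picard series is dominated by an exponential series, so it may be
  integrated term by term.\<close>

lemma linear_system_exists:
  fixes A :: "nat \<Rightarrow> nat \<Rightarrow> real \<Rightarrow> complex"
  assumes A: "\<And>j l. j < m \<Longrightarrow> l < m \<Longrightarrow> continuous_on {0..} (A j l)"
  obtains Y where "\<And>j. j < m \<Longrightarrow> Y j 0 = v j"
    "\<And>j x. j < m \<Longrightarrow> 0 \<le> x \<Longrightarrow>
        (Y j has_vector_derivative (\<Sum>l<m. A j l x * Y l x)) (at x within {0..})"
proof -
  define Z where "Z = picard m A v"
  define Y where "Y j x = suminf (\<lambda>n. Z n j x)" for j x
  define g where "g j x = (\<Sum>l<m. A j l x * Y l x)" for j x
  have Zc: "continuous_on {0..} (Z n j)" if "j < m" for n j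
    unfolding Z_def using picard_continuous[OF A that] .
  have key: "continuous_on {0..X} (g j) \<and> (\<forall>x\<in>{0..X}. Y j x = v j + integral {0..x} (g j))"
    if j: "j < m" and X: "X \<ge> 0" for j X
  proof -
    have "\<exists>K\<ge>0. \<forall>j<m. \<forall>l<m. \<forall>x\<in>{0..X}. norm (A j l x) \<le> K"
    proof -
      have "\<exists>K. \<forall>x\<in>{0..X}. norm (A j l x) \<le> K" if "j < m" "l < m" for j l
      proof -
        have "compact (A j l ` {0..X})"
          by (intro compact_continuous_image continuous_on_subset[OF A[OF that]]) auto
        then show ?thesis using compact_imp_bounded bounded_iff by (metis imageI)
      qed
      then obtain K where K: "\<And>j l x. j < m \<Longrightarrow> l < m \<Longrightarrow> x \<in> {0..X} \<Longrightarrow> norm (A j l x) \<le> K j l" by metis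
      have "norm (A j l x) \<le> (\<Sum>j<m. \<Sum>l<m. \<bar>K j l\<bar>)" if "j < m" "l < m" "x \<in> {0..X}" for j l x
      proof -
        have "norm (A j l x) \<le> \<bar>K j l\<bar>" using K[OF that] by linarith
        also have "\<dots> \<le> (\<Sum>l<m. \<bar>K j l\<bar>)" using that by (intro member_le_sum) auto
        also have "\<dots> \<le> (\<Sum>j<m. \<Sum>l<m. \<bar>K j l\<bar>)"
          using that by (intro member_le_sum[of j "{..<m}" "\<lambda>j. \<Sum>l<m. \<bar>K j l\<bar>"] sum_nonneg) (auto intro!: sum_nonneg)
        finally show ?thesis .
      qed
      moreover have "(\<Sum>j<m. \<Sum>l<m. \<bar>K j l\<bar>) \<ge> 0" by (intro sum_nonneg) auto
      ultimately show ?thesis by blast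
    qed
    then obtain K where K: "K \<ge> 0" "\<And>j l x. j < m \<Longrightarrow> l < m \<Longrightarrow> x \<in> {0..X} \<Longrightarrow> norm (A j l x) \<le> K" by blast
    define C where "C = (\<Sum>j<m. norm (v j))"
    have C: "C \<ge> 0" "\<And>j. j < m \<Longrightarrow> norm (v j) \<le> C"
      unfolding C_def by (auto intro!: sum_nonneg member_le_sum)
    define b where "b n = C * (real m * K * X) ^ n / fact n" for n
    have bsum: "summable b"
    proof -
      have "b = (\<lambda>n. C * (inverse (fact n) * (real m * K * X) ^ n))"
        by (simp add: fun_eq_iff b_def divide_inverse mult_ac)
      then show ?thesis using summable_mult[OF summable_exp[of "real m * K * X"]] by simp
    qed
    have Zb: "norm (Z n l x) \<le> b n" if "l < m" "x \<in> {0..X}" for n l x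
    proof -
      have "norm (Z n l x) \<le> C * (real m * K * x) ^ n / fact n"
        unfolding Z_def using that by (intro picard_bound[OF A K(2) C(2) K(1) C(1)]) auto
      also have "\<dots> \<le> b n"
        unfolding b_def using that C K by (intro divide_right_mono mult_left_mono power_mono) auto
      finally show ?thesis .
    qed
    have ul: "uniform_limit {0..X} (\<lambda>N x. \<Sum>n<N. Z n l x) (Y l) sequentially" if "l < m" for l
      unfolding Y_def[abs_def] by (rule Weierstrass_m_test[OF Zb[OF that] bsum])
    have Yc: "continuous_on {0..X} (Y l)" if "l < m" for l
      by (rule uniform_limit_theorem[OF _ ul[OF that]])
         (auto intro!: always_eventually continuous_on_sum continuous_on_subset[OF Zc[OF that]])
    have sumZ: "summable (\<lambda>n. Z n l x)" if "l < m" "x \<in> {0..X}" for l x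
      by (rule summable_comparison_test'[OF bsum]) (use Zb[OF that] in simp)
    have gc: "continuous_on {0..X} (g j)"
      unfolding g_def[abs_def] using j Yc by (intro continuous_on_sum continuous_on_mult continuous_on_subset[OF A]) auto
    define f where "f n x = (\<Sum>l<m. A j l x * Z n l x)" for n x
    have fb: "norm (f n x) \<le> real m * K * b n" if "x \<in> {0..X}" for n x
    proof -
      have "norm (f n x) \<le> (\<Sum>l<m. K * b n)"
        unfolding f_def using K Zb that j by (intro sum_norm_le) (auto simp: norm_mult intro!: mult_mono)
      then show ?thesis by simp
    qed
    have fg: "suminf (\<lambda>n. f n x) = g j x" if "x \<in> {0..X}" for x
    proof -
      have "suminf (\<lambda>n. f n x) = (\<Sum>l<m. suminf (\<lambda>n. A j l x * Z n l x))"
        unfolding f_def using sumZ that by (intro suminf_sum summable_mult) auto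
      also have "\<dots> = g j x"
        unfolding g_def Y_def using sumZ that by (intro sum.cong refl suminf_mult) auto
      finally show ?thesis .
    qed
    have fc: "continuous_on {0..X} (f n)" for n
      unfolding f_def[abs_def] using j by (intro continuous_on_sum continuous_on_mult continuous_on_subset[OF A] continuous_on_subset[OF Zc]) auto
    have "Y j x = v j + integral {0..x} (g j)" if x: "x \<in> {0..X}" for x
    proof -
      have sub: "{0..x} \<subseteq> {0..X}" using x by auto
      have "uniform_limit {0..x} (\<lambda>N t. \<Sum>n<N. f n t) (\<lambda>t. suminf (\<lambda>n. f n t)) sequentially"
        by (rule Weierstrass_m_test[where M = "\<lambda>n. real m * K * b n"]) (use fb sub bsum in \<open>auto intro: summable_mult\<close>)
      then obtain I J where I: "\<And>N. ((\<lambda>t. \<Sum>n<N. f n t) has_integral I N) {0..x}"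
        and J: "((\<lambda>t. suminf (\<lambda>n. f n t)) has_integral J) {0..x}" and lim: "I \<longlonglongrightarrow> J"
      proof (rule uniform_limit_integral)
        show "continuous_on {0..x} (\<lambda>t. \<Sum>n<N. f n t)" for N
          by (intro continuous_on_sum continuous_on_subset[OF fc sub])
      qed auto
      have "((\<lambda>t. suminf (\<lambda>n. f n t)) has_integral J) {0..x} = (g j has_integral J) {0..x}"
        by (rule has_integral_cong) (use fg sub in auto)
      then have Jg: "J = integral {0..x} (g j)" using J by (simp add: integral_unique)
      have "I N = (\<Sum>n<N. Z (Suc n) j x)" for N
      proof -
        have "((\<lambda>t. \<Sum>n<N. f n t) has_integral (\<Sum>n<N. Z (Suc n) j x)) {0..x}"
        proof (rule has_integral_sum)
          fix n
          have "f n integrable_on {0..x}" by (intro integrable_continuous_real continuous_on_subset[OF fc sub])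
          then show "(f n has_integral Z (Suc n) j x) {0..x}"
            unfolding Z_def f_def[abs_def] by (simp add: integrable_integral)
        qed simp
        then show ?thesis using I has_integral_unique by blast
      qed
      then have "(\<lambda>N. \<Sum>n<N. Z (Suc n) j x) \<longlonglongrightarrow> J" using lim by presburger
      then have "(\<lambda>n. Z (Suc n) j x) sums J" by (simp add: sums_def)
      then have "J = Y j x - Z 0 j x"
        unfolding Y_def using suminf_split_head[OF sumZ[OF j x]] sums_unique by metis
      then show ?thesis using Jg by (simp add: Z_def)
    qed
    then show ?thesis using gc by blast
  qed
  show ?thesis
  proof (rule that[of Y])
    show "Y j 0 = v j" if "j < m" for j using key[OF that, of 0] by simp
    fix j and x :: real assume j: "j < m" and x: "0 \<le> x"
    have X: "x + 1 \<ge> 0" using x by simp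
    note kk = key[OF j X]
    have "((\<lambda>u. integral {0..u} (g j)) has_vector_derivative g j x) (at x within {0..x+1})"
      by (rule integral_has_vector_derivative) (use kk x in auto)
    then have "((\<lambda>u. v j + integral {0..u} (g j)) has_vector_derivative g j x) (at x within {0..x+1})"
      using has_vector_derivative_add[OF has_vector_derivative_const] by fastforce
    then have "(Y j has_vector_derivative g j x) (at x within {0..x+1})"
      by (rule has_vector_derivative_transform[rotated 2]) (use kk x in auto)
    moreover have "at x within {0..x+1} = at x within {0..}"
      by (rule at_within_nhd[of _ "{..<x+1}"]) auto
    ultimately show "(Y j has_vector_derivative (\<Sum>l<m. A j l x * Y l x)) (at x within {0..})"
      unfolding g_def by simp
  qed
qed

locale symmetric_expr =
  fixes k :: nat and s q :: "nat \<Rightarrow> real \<Rightarrow> real"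
  assumes k_pos: "k \<ge> 1"
    and s_smooth: "\<And>r. r \<le> k \<Longrightarrow> C_half r (s r)"
    and q_smooth: "\<And>r. r < k \<Longrightarrow> C_half (r + 1) (q r)"
    and s_pos: "\<And>x. x \<ge> 0 \<Longrightarrow> s k x > 0"
begin

abbreviation "m \<equiv> 2 * k"
abbreviation "M \<equiv> M_expr k s q"
abbreviation "GF \<equiv> green_form k s q"

text \<open>The value \<open>0\<close> on the negative half-line is the convention of the maximal domain, so that square
  integrable solutions belong to it.\<close>

definition solution :: "complex \<Rightarrow> (real \<Rightarrow> complex) \<Rightarrow> bool" where
  "solution c u \<longleftrightarrow> (\<forall>x<0. u x = 0) \<and> (\<forall>j<m. D j u differentiable_on {0..}) \<and>
     continuous_on {0..} (D m u) \<and> (\<forall>x\<ge>0. M u x = c * u x)"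

text \<open>As \<open>s k > 0\<close>, the equation can be solved for the derivative of order \<open>2 k\<close>; this gives a companion
  system with continuous coefficients.\<close>

lemma solution_exists:
  obtains u where "solution c u" "\<And>j. j < m \<Longrightarrow> D j u 0 = v j"
proof -
  obtain a where a: "\<And>j. j < m \<Longrightarrow> continuous_on {0..} (a j)"
    "\<And>f x. 0 \<le> x \<Longrightarrow> dd (m-1) x f \<Longrightarrow> M f x = (-1)^k * of_real (s k x) * D m f x + (\<Sum>j<m. a j x * D j f x)"
    using M_expr_rep[OF k_pos s_smooth q_smooth] by blast
  \<comment> \<open>The last row of the companion matrix.\<close>
  define b where "b l x = (-1)^k / of_real (s k x) * ((if l = 0 then c else 0) - a l x)" for l x
  define A where "A j = (if j = m - 1 then b else (\<lambda>l x. if l = Suc j then 1 else 0))" for j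
  have sc: "continuous_on {0..} (\<lambda>x. complex_of_real (s k x))"
    using C_half_continuous[OF s_smooth[OF order.refl], of 0] by simp
  have bc: "continuous_on {0..} (b l)" if "l < m" for l
    unfolding b_def[abs_def] using s_pos by (intro continuous_intros a(1) that sc) (auto simp: less_imp_neq[symmetric])
  have Ac: "continuous_on {0..} (A j l)" if "j < m" "l < m" for j l
    using bc[OF that(2)] unfolding A_def by (auto intro: continuous_on_const)
  obtain Y where Y: "\<And>j. j < m \<Longrightarrow> Y j 0 = v j"
    "\<And>j x. j < m \<Longrightarrow> 0 \<le> x \<Longrightarrow> (Y j has_vector_derivative (\<Sum>l<m. A j l x * Y l x)) (at x within {0..})"
    using linear_system_exists[of m A v] Ac by blast
  have Y1: "(Y j has_vector_derivative Y (Suc j) x) (at x within {0..})" if "Suc j < m" "0 \<le> x" for j x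
  proof -
    have "(\<Sum>l<m. A j l x * Y l x) = Y (Suc j) x"
      using that unfolding A_def by (simp add: if_distrib[of "\<lambda>y. y * _"] cong: if_cong)
    then show ?thesis using Y(2)[of j x] that by simp
  qed
  have Y2: "(Y (m-1) has_vector_derivative (\<Sum>l<m. b l x * Y l x)) (at x within {0..})" if "0 \<le> x" for x
    using Y(2)[of "m-1" x] that k_pos by (simp add: A_def)
  define u where "u x = (if x < 0 then 0 else Y 0 x)" for x
  have Du: "D j u x = Y j x" if "j < m" "0 \<le> x" for j x
    using that
  proof (induction j arbitrary: x)
    case 0 then show ?case by (simp add: u_def)
  next
    case (Suc j)
    have "D (Suc j) u x = hderiv (Y j) x"
      unfolding D_Suc by (rule hderiv_cong) (use Suc in auto)
    also have "\<dots> = Y (Suc j) x" by (rule hderiv_eqI[OF Y1]) (use Suc in auto)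
    finally show ?case .
  qed
  have Dm: "D m u x = (\<Sum>l<m. b l x * Y l x)" if "0 \<le> x" for x
  proof -
    have "D (Suc (m-1)) u x = hderiv (Y (m-1)) x"
      unfolding D_Suc by (rule hderiv_cong) (use Du k_pos that in auto)
    also have "\<dots> = (\<Sum>l<m. b l x * Y l x)" by (rule hderiv_eqI[OF Y2]) (use that in auto)
    finally show ?thesis using k_pos by simp
  qed
  have dY: "Y j differentiable (at x within {0..})" if "j < m" "0 \<le> x" for j x
    using Y(2)[OF that] by (auto intro: differentiableI_vector)
  have dif: "D j u differentiable_on {0..}" if "j < m" for j
    unfolding differentiable_on_def
  proof
    fix x :: real assume "x \<in> {0..}"
    then have x: "0 \<le> x" by simp
    show "D j u differentiable at x within {0..}"
      using diff_cong[of "D j u" "Y j" x] Du[OF that] dY[OF that x] x by blast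
  qed
  have Yc: "continuous_on {0..} (Y j)" if "j < m" for j
    by (intro differentiable_imp_continuous_on) (use dY[OF that] in \<open>auto simp: differentiable_on_def\<close>)
  have "continuous_on {0..} (\<lambda>x. \<Sum>l<m. b l x * Y l x)"
    using bc Yc by (intro continuous_on_sum continuous_on_mult) auto
  then have Dmc: "continuous_on {0..} (D m u)"
    by (rule continuous_on_eq) (use Dm in auto)
  have "M u x = c * u x" if x: "0 \<le> x" for x
  proof -
    have "dd (m-1) x u" using dif k_pos x by (auto simp: dd_def differentiable_on_def)
    then have "M u x = (-1)^k * of_real (s k x) * (\<Sum>l<m. b l x * Y l x) + (\<Sum>j<m. a j x * Y j x)"
      using a(2)[OF x] Dm[OF x] Du x by simp
    also have "(-1)^k * of_real (s k x) * (\<Sum>l<m. b l x * Y l x) = (\<Sum>l<m. ((if l = 0 then c else 0) - a l x) * Y l x)"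
    proof -
      have "(-1)^k * complex_of_real (s k x) * (b l x * Y l x) = ((if l = 0 then c else 0) - a l x) * Y l x" for l
        using s_pos[OF x] by (simp add: b_def mult.assoc[symmetric] flip: power_add)
      then show ?thesis by (simp only: sum_distrib_left)
    qed
    also have "\<dots> + (\<Sum>j<m. a j x * Y j x) = (\<Sum>l<m. if l = 0 then c * Y l x else 0)"
      unfolding sum.distrib[symmetric] by (intro sum.cong) (auto simp: algebra_simps)
    also have "\<dots> = c * u x" using k_pos x by (simp add: u_def)
    finally show ?thesis .
  qed
  then have "solution c u" unfolding solution_def using dif Dmc by (auto simp: u_def)
  then show ?thesis using that Du Y(1) by auto
qed

end

section \<open>Square integrable functions\<close>

text \<open>For a measurable nonnegative function, Henstock--Kurzweil and Lebesgue integrability agree. The set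
  \<open>S\<close> is a parameter because compact intervals and the half-line are used side by side.\<close>

definition sq_int :: "real set \<Rightarrow> (real \<Rightarrow> complex) \<Rightarrow> bool" where
  "sq_int S f \<longleftrightarrow> f \<in> borel_measurable (lebesgue_on S) \<and> (\<lambda>x. (norm (f x))\<^sup>2) integrable_on S"

definition ip :: "real set \<Rightarrow> (real \<Rightarrow> complex) \<Rightarrow> (real \<Rightarrow> complex) \<Rightarrow> complex" where
  "ip S f g = integral S (\<lambda>x. f x * cnj (g x))"

definition sqn :: "real set \<Rightarrow> (real \<Rightarrow> complex) \<Rightarrow> real" where
  "sqn S f = integral S (\<lambda>x. (norm (f x))\<^sup>2)"

lemma ae_eq_measurable:
  assumes "f \<in> borel_measurable (lebesgue_on S)" "S \<in> sets lebesgue" "negligible N" "\<And>x. x \<in> S - N \<Longrightarrow> g x = f x"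
  shows "(g :: real \<Rightarrow> complex) \<in> borel_measurable (lebesgue_on S)"
  using measurable_on_spike[of f S N g] assms by (simp add: measurable_on_iff_borel_measurable)

lemma sq_int_ae_eq:
  assumes "sq_int S f" "S \<in> sets lebesgue" "negligible N" "\<And>x. x \<in> S - N \<Longrightarrow> g x = f x"
  shows "sq_int S g"
  using assms ae_eq_measurable[of f S N g] integrable_spike[of "\<lambda>x. (norm (f x))\<^sup>2" S N "\<lambda>x. (norm (g x))\<^sup>2"]
  by (auto simp: sq_int_def)

lemma negligible_origin: "negligible (({0<..} - {0..}) \<union> ({0..} - {0<..} :: real set))"
proof -
  have "({0<..} - {0..}) \<union> ({0..} - {0<..}) = {0::real}" by auto
  then show ?thesis by simp
qed

lemma L2_iff_sq_int: "L2 f \<longleftrightarrow> sq_int {0..} f"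
proof -
  have 1: "{0<..} \<in> sets (lebesgue :: real measure)" "{0..} \<in> sets (lebesgue :: real measure)" by auto
  have a: "f \<in> borel_measurable (lebesgue_on {0<..}) \<longleftrightarrow> f \<in> borel_measurable (lebesgue_on {0..})"
    unfolding measurable_on_iff_borel_measurable[OF 1(1), symmetric] measurable_on_iff_borel_measurable[OF 1(2), symmetric]
  proof
    show "f measurable_on {0<..} \<Longrightarrow> f measurable_on {0..}"
      by (erule measurable_on_spike_set[OF _ negligible_origin])
    have "negligible (({0..} - {0<..}) \<union> ({0<..} - {0..} :: real set))"
      using negligible_origin by (simp only: Un_commute)
    then show "f measurable_on {0..} \<Longrightarrow> f measurable_on {0<..}"
      by (rule measurable_on_spike_set[rotated])
  qed
  have b: "integrable (lebesgue_on {0<..}) (\<lambda>x. (norm (f x))\<^sup>2) \<longleftrightarrow> (\<lambda>x. (norm (f x))\<^sup>2) integrable_on {0<..}"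
    if "f \<in> borel_measurable (lebesgue_on {0<..})"
  proof -
    have "integrable (lebesgue_on {0<..}) (\<lambda>x. (norm (f x))\<^sup>2) \<longleftrightarrow> (\<lambda>x. (norm (f x))\<^sup>2) absolutely_integrable_on {0<..}"
      unfolding set_integrable_def by (subst integrable_restrict_space) auto
    also have "\<dots> \<longleftrightarrow> (\<lambda>x. (norm (f x))\<^sup>2) integrable_on {0<..}"
      by (auto intro: nonnegative_absolutely_integrable_1 set_lebesgue_integral_eq_integral(1))
    finally show ?thesis .
  qed
  show ?thesis unfolding L2_def sq_int_def using a b integrable_spike_set_eq[OF negligible_origin] by blast
qed

lemma sq_int_subset:
  assumes "sq_int T f" "S \<subseteq> T" "S \<in> sets lebesgue"
  shows "sq_int S f"
  unfolding sq_int_def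
proof
  show "f \<in> borel_measurable (lebesgue_on S)"
    using assms unfolding sq_int_def by (auto intro: measurable_restrict_mono)
  have "(\<lambda>x. (norm (f x))\<^sup>2) absolutely_integrable_on T"
    using assms unfolding sq_int_def by (auto intro: nonnegative_absolutely_integrable_1)
  then have "(\<lambda>x. (norm (f x))\<^sup>2) absolutely_integrable_on S" by (rule set_integrable_subset[OF _ assms(3,2)])
  then show "(\<lambda>x. (norm (f x))\<^sup>2) integrable_on S" by (rule set_lebesgue_integral_eq_integral(1))
qed

lemma sqn_mono: "sq_int T f \<Longrightarrow> S \<subseteq> T \<Longrightarrow> S \<in> sets lebesgue \<Longrightarrow> sqn S f \<le> sqn T f"
  using sq_int_subset[of T f S] unfolding sqn_def sq_int_def by (intro integral_subset_le) auto

lemma sqn_nonneg: "sqn S f \<ge> 0"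
  unfolding sqn_def
  by (cases "(\<lambda>x. (norm (f x))\<^sup>2) integrable_on S") (auto intro: integral_nonneg simp: not_integrable_integral)

lemma norm_mult_le_sqs:
  fixes z w :: complex
  assumes "e > 0"
  shows "norm (z * cnj w) \<le> (norm z)\<^sup>2 / (2*e) + e * (norm w)\<^sup>2 / 2"
proof -
  have "0 \<le> (norm z - e * norm w)\<^sup>2" by simp
  also have "\<dots> = (norm z)\<^sup>2 + e * (e * (norm w)\<^sup>2) - 2 * e * (norm z * norm w)"
    by (simp add: power2_eq_square algebra_simps)
  finally have "2 * e * (norm z * norm w) \<le> (norm z)\<^sup>2 + e * (e * (norm w)\<^sup>2)" by simp
  then show ?thesis using assms by (simp add: norm_mult field_simps)
qed

lemma sq_int_mult:
  assumes f: "sq_int S f" and g: "sq_int S g" and S: "S \<in> sets lebesgue"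
  shows "(\<lambda>x. f x * cnj (g x)) absolutely_integrable_on S"
proof (rule measurable_bounded_by_integrable_imp_absolutely_integrable[OF _ S])
  have "cnj \<in> borel_measurable borel" by (intro borel_measurable_continuous_onI continuous_intros)
  then show "(\<lambda>x. f x * cnj (g x)) \<in> borel_measurable (lebesgue_on S)"
    using f g unfolding sq_int_def by (auto intro!: borel_measurable_times measurable_compose[of g _ borel cnj])
  show "(\<lambda>x. (norm (f x))\<^sup>2 / (2*1) + 1 * (norm (g x))\<^sup>2 / 2) integrable_on S"
    using f g unfolding sq_int_def
    by (intro integrable_add) (auto intro: integrable_on_cmult_right integrable_on_divide)
  show "norm (f x * cnj (g x)) \<le> (norm (f x))\<^sup>2 / (2*1) + 1 * (norm (g x))\<^sup>2 / 2" for x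
    by (rule norm_mult_le_sqs) simp
qed

text \<open>The additive form of the Cauchy--Schwarz inequality, with a weight that can be chosen at each use.\<close>

lemma ip_bound:
  assumes f: "sq_int S f" and g: "sq_int S g" and S: "S \<in> sets lebesgue" and e: "e > 0"
  shows "norm (ip S f g) \<le> sqn S f / (2*e) + e * sqn S g / 2"
proof -
  have fg: "(\<lambda>x. (norm (f x))\<^sup>2) integrable_on S" "(\<lambda>x. (norm (g x))\<^sup>2) integrable_on S"
    using f g by (auto simp: sq_int_def)
  have i: "(\<lambda>x. (norm (f x))\<^sup>2 / (2*e)) integrable_on S" "(\<lambda>x. e * (norm (g x))\<^sup>2 / 2) integrable_on S"
    using fg by (auto intro: integrable_on_divide integrable_on_mult_right)
  have "norm (ip S f g) \<le> integral S (\<lambda>x. (norm (f x))\<^sup>2 / (2*e) + e * (norm (g x))\<^sup>2 / 2)"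
    unfolding ip_def
    by (rule integral_norm_bound_integral)
       (auto intro!: integrable_add i norm_mult_le_sqs e set_lebesgue_integral_eq_integral(1)[OF sq_int_mult[OF f g S]])
  also have "\<dots> = sqn S f / (2*e) + e * sqn S g / 2"
    using integral_add[OF i] by (simp add: sqn_def)
  finally show ?thesis .
qed

lemma sq_int_continuous:
  assumes "continuous_on {a..b} f"
  shows "sq_int {a..b} f"
  unfolding sq_int_def using assms
  by (auto intro!: continuous_imp_measurable_on_sets_lebesgue integrable_continuous_real continuous_intros)

lemma sq_int_lin:
  assumes f: "sq_int S f" and g: "sq_int S g" and S: "S \<in> sets lebesgue"
  shows "sq_int S (\<lambda>x. a * f x + g x)"
  unfolding sq_int_def
proof
  show meas: "(\<lambda>x. a * f x + g x) \<in> borel_measurable (lebesgue_on S)"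
    using f g unfolding sq_int_def by auto
  have "(\<lambda>x. (norm (a * f x + g x))\<^sup>2) absolutely_integrable_on S"
  proof (rule measurable_bounded_by_integrable_imp_absolutely_integrable[OF _ S])
    show "(\<lambda>x. (norm (a * f x + g x))\<^sup>2) \<in> borel_measurable (lebesgue_on S)" using meas by auto
    show "(\<lambda>x. 2 * (norm a)\<^sup>2 * (norm (f x))\<^sup>2 + 2 * (norm (g x))\<^sup>2) integrable_on S"
      using f g unfolding sq_int_def by (auto intro!: integrable_add integrable_on_mult_right)
    show "norm ((norm (a * f x + g x))\<^sup>2) \<le> 2 * (norm a)\<^sup>2 * (norm (f x))\<^sup>2 + 2 * (norm (g x))\<^sup>2" for x
    proof -
      have "(norm (a * f x + g x))\<^sup>2 \<le> (norm a * norm (f x) + norm (g x))\<^sup>2"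
        by (intro power_mono) (auto simp: norm_mult[symmetric] norm_triangle_ineq)
      also have "\<dots> \<le> 2 * (norm a * norm (f x))\<^sup>2 + 2 * (norm (g x))\<^sup>2"
        using sum_squares_bound[of "norm a * norm (f x)" "norm (g x)"] by (simp add: power2_sum)
      finally show ?thesis by (simp add: power_mult_distrib)
    qed
  qed
  then show "(\<lambda>x. (norm (a * f x + g x))\<^sup>2) integrable_on S" by (rule set_lebesgue_integral_eq_integral(1))
qed

lemma sq_int_zero: "sq_int S (\<lambda>_. 0)"
  by (auto simp: sq_int_def intro: integrable_0)

lemma ip_self: "ip S f f = of_real (sqn S f)" if "sq_int S f"
proof -
  have "((\<lambda>x. (norm (f x))\<^sup>2) has_integral sqn S f) S"
    using that unfolding sqn_def sq_int_def by (simp add: integrable_integral)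
  then have "((\<lambda>x. complex_of_real ((norm (f x))\<^sup>2)) has_integral of_real (sqn S f)) S"
    by (rule has_integral_of_real)
  then have "((\<lambda>x. f x * cnj (f x)) has_integral of_real (sqn S f)) S"
    by (simp only: complex_norm_square)
  then show ?thesis unfolding ip_def by (rule integral_unique)
qed

lemma ip_lin_left:
  assumes "sq_int S f" "sq_int S g" "sq_int S h" "S \<in> sets lebesgue"
  shows "ip S (\<lambda>x. a * f x + g x) h = a * ip S f h + ip S g h"
proof -
  have i: "(\<lambda>x. f x * cnj (h x)) integrable_on S" "(\<lambda>x. g x * cnj (h x)) integrable_on S"
    using assms by (auto intro: set_lebesgue_integral_eq_integral(1) sq_int_mult)
  have "((\<lambda>x. a * (f x * cnj (h x)) + g x * cnj (h x)) has_integral (a * ip S f h + ip S g h)) S"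
    unfolding ip_def by (intro has_integral_add has_integral_mult_right integrable_integral i)
  then have "((\<lambda>x. (a * f x + g x) * cnj (h x)) has_integral (a * ip S f h + ip S g h)) S"
    by (simp only: distrib_right mult.assoc)
  then show ?thesis unfolding ip_def by (rule integral_unique)
qed

lemma ip_cnj: "ip S g f = cnj (ip S f g)"
proof -
  have "cnj (ip S f g) = integral S (\<lambda>x. cnj (f x * cnj (g x)))"
    unfolding ip_def by (rule Henstock_Kurzweil_Integration.integral_cnj)
  then show ?thesis by (simp add: ip_def mult.commute)
qed

lemma abs_integrable_half_line_tendsto:
  fixes f :: "real \<Rightarrow> complex"
  assumes f: "f absolutely_integrable_on {0..}"
  shows "((\<lambda>b. integral {0..b} f) \<longlongrightarrow> integral {0..} f) at_top"
proof -
  have fi: "integrable (lebesgue_on {0..}) f"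
    using f unfolding set_integrable_def by (subst integrable_restrict_space) auto
  have m: "f \<in> borel_measurable (lebesgue_on {0..})" using fi by (rule borel_measurable_integrable)
  have lim: "((\<lambda>b. integral\<^sup>L (lebesgue_on {0..}) (\<lambda>x. indicator {..b} x *\<^sub>R f x)) \<longlongrightarrow> integral\<^sup>L (lebesgue_on {0..}) f) at_top"
  proof (rule integral_dominated_convergence_at_top[where w = "\<lambda>x. norm (f x)"])
    show "(\<lambda>x. indicator {..b} x *\<^sub>R f x) \<in> borel_measurable (lebesgue_on {0..})" for b
    proof -
      have "(indicator {..b} :: real \<Rightarrow> real) \<in> borel_measurable (lebesgue_on {0..})"
        by (rule measurable_restrict_space1, rule borel_measurable_indicator) auto
      then show ?thesis using m by (rule borel_measurable_scaleR)
    qed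
    show "\<forall>\<^sub>F i in at_top. AE x in lebesgue_on {0..}. norm (indicator {..i} x *\<^sub>R f x) \<le> norm (f x)"
      by (auto simp: indicator_def)
    show "AE x in lebesgue_on {0..}. ((\<lambda>i. indicator {..i} x *\<^sub>R f x) \<longlongrightarrow> f x) at_top"
    proof (rule AE_I2)
      fix x :: real
      have "\<forall>\<^sub>F i in at_top. indicator {..i} x *\<^sub>R f x = f x"
        using eventually_ge_at_top[of x] by eventually_elim (simp add: indicator_def)
      then show "((\<lambda>i. indicator {..i} x *\<^sub>R f x) \<longlongrightarrow> f x) at_top" by (rule tendsto_eventually)
    qed
  qed (use m fi in auto)
  have eq: "integral\<^sup>L (lebesgue_on {0..}) (\<lambda>x. indicator {..b} x *\<^sub>R f x) = integral {0..b} f" for b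
  proof -
    have "f absolutely_integrable_on {0..b}" by (rule set_integrable_subset[OF f]) auto
    then have "integral {0..b} f = integral\<^sup>L lebesgue (\<lambda>x. indicator {0..b} x *\<^sub>R f x)"
      using set_lebesgue_integral_eq_integral(2) unfolding set_lebesgue_integral_def by metis
    also have "\<dots> = integral\<^sup>L lebesgue (\<lambda>x. indicator {0..} x *\<^sub>R (indicator {..b} x *\<^sub>R f x))"
      by (intro Bochner_Integration.integral_cong) (auto simp: indicator_def)
    also have "\<dots> = integral\<^sup>L (lebesgue_on {0..}) (\<lambda>x. indicator {..b} x *\<^sub>R f x)"
      by (rule integral_restrict_space[symmetric]) auto
    finally show ?thesis by simp
  qed
  have "integral\<^sup>L (lebesgue_on {0..}) f = integral {0..} f"
    by (rule lebesgue_integral_eq_integral[OF fi]) auto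
  then show ?thesis using lim eq by simp
qed

section \<open>Green's formula on the maximal domain\<close>

lemma differentiable_on_half_line_cong:
  fixes f g :: "real \<Rightarrow> 'a::real_normed_vector"
  assumes "\<And>t. 0 \<le> t \<Longrightarrow> f t = g t" "g differentiable_on {0..}"
  shows "f differentiable_on {0..}"
  unfolding differentiable_on_def
proof
  fix x :: real assume "x \<in> {0..}"
  then have x: "0 \<le> x" by simp
  then have "g differentiable (at x within {0..})" using assms(2) by (simp add: differentiable_on_def)
  then show "f differentiable (at x within {0..})" using diff_cong[OF assms(1) x] by simp
qed

lemma AC_loc_ae_differentiable:
  assumes "AC_loc f"
  obtains N where "negligible N" "\<And>x. x \<in> {0..} - N \<Longrightarrow> f differentiable (at x within {0..})"
proof -
  have "\<exists>N. negligible N \<and> (\<forall>x\<in>{0..real n} - N. f differentiable (at x))" for n :: nat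
  proof -
    have "abs_cont_on 0 (real n) f" using assms by (simp add: AC_loc_def)
    then obtain N h where N: "negligible N" "\<And>x. x \<in> {0..real n} - N \<Longrightarrow> (f has_vector_derivative h x) (at x)"
      and "h absolutely_integrable_on {0..real n}" "(h has_integral (f (real n) - f 0)) {0..real n}"
      using abs_cont_on_FTC[OF _ of_nat_0_le_iff] by blast
    have "f differentiable (at x)" if "x \<in> {0..real n} - N" for x
      using N(2)[OF that] by (rule differentiableI_vector)
    then show ?thesis using N(1) by blast
  qed
  then obtain N where N: "\<And>n. negligible (N n)" "\<And>n x. x \<in> {0..real n} - N n \<Longrightarrow> f differentiable (at x)" by metis
  show ?thesis
  proof (rule that[of "\<Union>n. N n"])
    show "negligible (\<Union>n. N n)" by (rule negligible_countable_Union) (use N(1) in auto)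
    fix x assume x: "x \<in> {0..} - (\<Union>n. N n)"
    obtain n where "x \<le> real n" using real_arch_simple by blast
    then show "f differentiable (at x within {0..})" using N(2)[of x n] x by (auto intro: differentiable_at_withinI)
  qed
qed

context symmetric_expr
begin

text \<open>The conditions on elements of the maximal domain without square integrability; they suffice for
  Green's formula on compact intervals and hold for all solutions.\<close>

definition loc_dom :: "(real \<Rightarrow> complex) \<Rightarrow> bool" where
  "loc_dom f \<longleftrightarrow> smooth m f \<and> AC_loc (D (m - 1) f)"

lemma loc_dom_AC: "loc_dom f \<Longrightarrow> j < m \<Longrightarrow> AC_loc (D j f)"
proof -
  assume f: "loc_dom f" and j: "j < m"
  show "AC_loc (D j f)"
  proof (cases "j = m - 1")
    case True then show ?thesis using f by (simp add: loc_dom_def)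
  next
    case False
    then have j1: "j < m - 1" using j by simp
    show ?thesis
    proof (rule AC_loc_C1)
      fix x :: real assume "0 \<le> x"
      then show "(D j f has_vector_derivative D (Suc j) f x) (at x within {0..})"
        using f j1 unfolding D_Suc loc_dom_def smooth_def by (intro hderiv_has) (auto simp: differentiable_on_def)
    next
      show "continuous_on {0..} (D (Suc j) f)"
      proof (cases "Suc j = m - 1")
        case True then show ?thesis using f by (auto simp: loc_dom_def intro: AC_loc_continuous)
      next
        case False
        then have "D (Suc j) f differentiable_on {0..}" using f j1 by (auto simp: loc_dom_def smooth_def)
        then show ?thesis by (rule differentiable_imp_continuous_on)
      qed
    qed
  qed
qed

lemma loc_dom_continuous: "loc_dom f \<Longrightarrow> continuous_on {0..} f"
  using loc_dom_AC[of f 0] k_pos AC_loc_continuous by simp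

lemma loc_dom_ae_dd:
  assumes "loc_dom f"
  obtains N where "negligible N" "\<And>x. x \<in> {0..} - N \<Longrightarrow> dd (m - 1) x f"
proof -
  have "AC_loc (D (m - 1) f)" using assms by (simp add: loc_dom_def)
  then obtain N where "negligible N" "\<And>x. x \<in> {0..} - N \<Longrightarrow> D (m - 1) f differentiable (at x within {0..})"
    using AC_loc_ae_differentiable by blast
  then show ?thesis using assms by (intro that[of N]) (auto simp: loc_dom_def smooth_def dd_def)
qed

lemma D_lin_loc_dom:
  assumes "loc_dom f" "loc_dom g" "j < m" "0 \<le> x"
  shows "D j (\<lambda>t. a * f t + g t) x = a * D j f x + D j g x"
  using assms by (intro D_lin smooth_dd[of m]) (auto simp: loc_dom_def)

lemma loc_dom_lin:
  assumes f: "loc_dom f" and g: "loc_dom g"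
  shows "loc_dom (\<lambda>t. a * f t + g t)"
  unfolding loc_dom_def smooth_def
proof (intro conjI allI impI)
  fix j assume j: "j < m - 1"
  have "(\<lambda>x. a * D j f x + D j g x) differentiable_on {0..}"
    using f g j by (intro derivative_intros) (auto simp: loc_dom_def smooth_def)
  then show "D j (\<lambda>t. a * f t + g t) differentiable_on {0..}"
    by (rule differentiable_on_half_line_cong[rotated]) (use D_lin_loc_dom[OF f g] j in simp)
next
  have "AC_loc (\<lambda>x. a * D (m-1) f x + D (m-1) g x)"
    using f g by (intro AC_loc_add AC_loc_mult AC_loc_const) (auto simp: loc_dom_def)
  then show "AC_loc (D (m - 1) (\<lambda>t. a * f t + g t))"
    by (rule AC_loc_cong) (use D_lin_loc_dom[OF f g] k_pos in auto)
qed

lemma M_lin: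
  assumes "0 \<le> x" "dd (m-1) x f" "dd (m-1) x g"
  shows "M (\<lambda>t. a * f t + g t) x = a * M f x + M g x"
proof -
  obtain c where "\<And>j. j < m \<Longrightarrow> continuous_on {0..} (c j)"
    and c: "\<And>f x. 0 \<le> x \<Longrightarrow> dd (m-1) x f \<Longrightarrow> M f x = (-1)^k * of_real (s k x) * D m f x + (\<Sum>j<m. c j x * D j f x)"
    using M_expr_rep[OF k_pos s_smooth q_smooth] by blast
  have "dd (m-1) x (\<lambda>t. a * f t + g t)"
    by (rule dd_add[OF dd_mult[OF dd_const[OF assms(1)] assms(2,1)] assms(3,1)])
  note d = assms(2,3) this
  have D: "D j (\<lambda>t. a * f t + g t) x = a * D j f x + D j g x" if "j \<le> m" for j
    by (rule D_lin[OF assms(1)]) (use assms that in \<open>auto intro: dd_mono[OF _ _ assms(1)]\<close>)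
  have "(\<Sum>j<m. c j x * D j (\<lambda>t. a * f t + g t) x) = a * (\<Sum>j<m. c j x * D j f x) + (\<Sum>j<m. c j x * D j g x)"
    unfolding sum_distrib_left sum.distrib[symmetric]
    by (intro sum.cong refl) (subst D, auto simp: algebra_simps)
  then show ?thesis
    unfolding c[OF assms(1) d(1)] c[OF assms(1) d(2)] c[OF assms(1) d(3)] D[OF order.refl] by (simp add: algebra_simps)
qed

lemma M_lin_ae:
  assumes f: "loc_dom f" and g: "loc_dom g"
  obtains N where "negligible N" "\<And>x. x \<in> {0..} - N \<Longrightarrow> M (\<lambda>t. a * f t + g t) x = a * M f x + M g x"
proof -
  obtain N1 where N1: "negligible N1" "\<And>x. x \<in> {0..} - N1 \<Longrightarrow> dd (m - 1) x f" using loc_dom_ae_dd[OF f] by blast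
  obtain N2 where N2: "negligible N2" "\<And>x. x \<in> {0..} - N2 \<Longrightarrow> dd (m - 1) x g" using loc_dom_ae_dd[OF g] by blast
  show ?thesis
    by (rule that[of "N1 \<union> N2"]) (use N1 N2 in \<open>auto intro!: M_lin\<close>)
qed

text \<open>Green's form is absolutely continuous, as it is built from absolutely continuous functions, and
  Lagrange's identity gives its derivative at almost every point.\<close>

lemma green_formula:
  assumes f: "loc_dom f" and g: "loc_dom g" and b: "0 \<le> b"
  shows "(\<lambda>x. cnj (g x) * M f x - f x * cnj (M g x)) absolutely_integrable_on {0..b}"
    and "((\<lambda>x. cnj (g x) * M f x - f x * cnj (M g x)) has_integral (GF f g b - GF f g 0)) {0..b}"
proof -
  obtain B where B: "\<And>j l. AC_loc (B j l)"
    "\<And>f g x. 0 \<le> x \<Longrightarrow> smooth m f \<Longrightarrow> smooth m g \<Longrightarrow> GF f g x = bil m B f g x"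
    using green_form_rep[OF k_pos s_smooth q_smooth] by metis
  have "AC_loc (bil m B f g)"
    unfolding bil_def[abs_def]
    by (intro AC_loc_sum AC_loc_mult AC_loc_cnj B(1) loc_dom_AC f g) auto
  then have "AC_loc (GF f g)"
    by (rule AC_loc_cong) (use B(2) f g in \<open>auto simp: loc_dom_def\<close>)
  then have "abs_cont_on 0 b (GF f g)" using b by (simp add: AC_loc_def)
  then obtain N h where N: "negligible N" "\<And>x. x \<in> {0..b} - N \<Longrightarrow> (GF f g has_vector_derivative h x) (at x)"
    and h: "h absolutely_integrable_on {0..b}" "(h has_integral (GF f g b - GF f g 0)) {0..b}"
    using abs_cont_on_FTC[OF _ b] by blast
  obtain N1 where N1: "negligible N1" "\<And>x. x \<in> {0..} - N1 \<Longrightarrow> dd (m - 1) x f" using loc_dom_ae_dd[OF f] by blast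
  obtain N2 where N2: "negligible N2" "\<And>x. x \<in> {0..} - N2 \<Longrightarrow> dd (m - 1) x g" using loc_dom_ae_dd[OF g] by blast
  let ?N = "N \<union> N1 \<union> N2"
  have neg: "negligible ?N" using N N1 N2 by (intro negligible_Un)
  have eq: "cnj (g x) * M f x - f x * cnj (M g x) = h x" if "x \<in> {0..b} - ?N" for x
  proof -
    have x: "0 \<le> x" and d: "dd (m-1) x f" "dd (m-1) x g" using that N1 N2 by auto
    have "(GF f g has_vector_derivative (cnj (g x) * M f x - f x * cnj (M g x))) (at x within {0..})"
      using d x by (intro lagrange_identity s_smooth q_smooth) (auto simp: dd_def)
    moreover have "(GF f g has_vector_derivative h x) (at x within {0..})"
      using N(2)[of x] that by (auto intro: has_vector_derivative_at_within)
    ultimately show ?thesis using hderiv_eqI x by metis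
  qed
  show "(\<lambda>x. cnj (g x) * M f x - f x * cnj (M g x)) absolutely_integrable_on {0..b}"
    by (rule absolutely_integrable_spike[OF h(1) neg eq])
  show "((\<lambda>x. cnj (g x) * M f x - f x * cnj (M g x)) has_integral (GF f g b - GF f g 0)) {0..b}"
    by (rule has_integral_spike[OF neg eq h(2)])
qed

lemma green_ip:
  assumes f: "loc_dom f" and g: "loc_dom g" and b: "0 \<le> b"
    and Mf: "sq_int {0..b} (M f)" and Mg: "sq_int {0..b} (M g)"
  shows "GF f g b - GF f g 0 = ip {0..b} (M f) g - ip {0..b} f (M g)"
proof -
  have c: "sq_int {0..b} f" "sq_int {0..b} g"
    using f g by (auto intro!: sq_int_continuous continuous_on_subset[OF loc_dom_continuous])
  have "((\<lambda>x. M f x * cnj (g x) - f x * cnj (M g x)) has_integral ip {0..b} (M f) g - ip {0..b} f (M g)) {0..b}"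
    unfolding ip_def using c Mf Mg
    by (intro has_integral_diff integrable_integral set_lebesgue_integral_eq_integral(1) sq_int_mult) auto
  then have "((\<lambda>x. cnj (g x) * M f x - f x * cnj (M g x)) has_integral ip {0..b} (M f) g - ip {0..b} f (M g)) {0..b}"
    by (simp only: mult.commute)
  then show ?thesis using green_formula(2)[OF f g b] has_integral_unique by blast
qed

abbreviation "DD \<equiv> Delta k s q"

lemma Delta_iff: "f \<in> DD \<longleftrightarrow> (\<forall>x<0. f x = 0) \<and> loc_dom f \<and> sq_int {0..} f \<and> sq_int {0..} (M f)"
  unfolding Delta_def loc_dom_def smooth_def L2_iff_sq_int by auto

lemma Delta_lin: "f \<in> DD \<Longrightarrow> g \<in> DD \<Longrightarrow> (\<lambda>x. a * f x + g x) \<in> DD"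
proof -
  assume f: "f \<in> DD" and g: "g \<in> DD"
  have ld: "loc_dom f" "loc_dom g" using f g by (auto simp: Delta_iff)
  obtain N where N: "negligible N" "\<And>x. x \<in> {0..} - N \<Longrightarrow> M (\<lambda>t. a * f t + g t) x = a * M f x + M g x"
    using M_lin_ae[OF ld] by blast
  have "sq_int {0..} (\<lambda>x. a * M f x + M g x)" using f g by (intro sq_int_lin) (auto simp: Delta_iff)
  then have "sq_int {0..} (M (\<lambda>t. a * f t + g t))" by (rule sq_int_ae_eq[OF _ _ N]) auto
  then show ?thesis unfolding Delta_iff using f g ld by (auto simp: Delta_iff intro!: loc_dom_lin sq_int_lin)
qed

lemma loc_dom_zero: "loc_dom (\<lambda>_. 0)"
proof -
  have "D j (\<lambda>_. 0::complex) differentiable_on {0..}" for j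
    by (rule differentiable_on_half_line_cong[of _ "\<lambda>_. 0"]) (auto simp: D_zero)
  moreover have "AC_loc (D j (\<lambda>_. 0::complex))" for j
    by (rule AC_loc_cong[OF AC_loc_const[of 0]]) (simp add: D_zero)
  ultimately show ?thesis by (simp add: loc_dom_def smooth_def)
qed

lemma Delta_zero: "(\<lambda>_. 0) \<in> DD"
proof -
  note 0 = sq_int_zero[of "{0..}"]
  \<comment> \<open>Linearity at \<open>0 = - 0 + 0\<close> makes \<open>M 0\<close> vanish almost
      everywhere.\<close>
  obtain N where N: "negligible N" "\<And>x. x \<in> {0..} - N \<Longrightarrow> M (\<lambda>t. (-1) * 0 + 0) x = (-1) * M (\<lambda>_. 0) x + M (\<lambda>_. 0) x"
    using M_lin_ae[OF loc_dom_zero loc_dom_zero] by blast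
  have "sq_int {0..} (M (\<lambda>_. 0))"
    by (rule sq_int_ae_eq[OF 0 _ N(1)]) (use N(2) in auto)
  then show ?thesis using 0 loc_dom_zero by (simp add: Delta_iff)
qed

lemma green_limit:
  assumes f: "f \<in> DD" and g: "g \<in> DD"
  shows "(GF f g \<longlongrightarrow> green_form_inf k s q f g) at_top"
    and "green_form_inf k s q f g - GF f g 0 = ip {0..} (M f) g - ip {0..} f (M g)"
proof -
  let ?e = "\<lambda>x. cnj (g x) * M f x - f x * cnj (M g x)"
  have 1: "(\<lambda>x. M f x * cnj (g x)) absolutely_integrable_on {0..}" "(\<lambda>x. f x * cnj (M g x)) absolutely_integrable_on {0..}"
    using f g by (auto simp: Delta_iff intro!: sq_int_mult)
  have "(\<lambda>x. M f x * cnj (g x) - f x * cnj (M g x)) absolutely_integrable_on {0..}"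
    by (rule set_integral_diff(1)[OF 1])
  then have ai: "?e absolutely_integrable_on {0..}" by (simp only: mult.commute)
  have ii: "integral {0..} ?e = ip {0..} (M f) g - ip {0..} f (M g)"
    unfolding ip_def using integral_diff[OF 1[THEN set_lebesgue_integral_eq_integral(1)]] by (simp only: mult.commute)
  have "((\<lambda>b. integral {0..b} ?e + GF f g 0) \<longlongrightarrow> integral {0..} ?e + GF f g 0) at_top"
    by (intro tendsto_add abs_integrable_half_line_tendsto[OF ai] tendsto_const)
  moreover have "\<forall>\<^sub>F b in at_top. integral {0..b} ?e + GF f g 0 = GF f g b"
    using eventually_ge_at_top[of 0]
  proof eventually_elim
    case (elim b)
    show ?case using integral_unique[OF green_formula(2)[OF _ _ elim]] f g by (simp add: Delta_iff)
  qed
  ultimately have lim: "(GF f g \<longlongrightarrow> integral {0..} ?e + GF f g 0) at_top"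
    by (rule Lim_transform_eventually)
  then have eq: "green_form_inf k s q f g = integral {0..} ?e + GF f g 0"
    unfolding green_form_inf_def by (rule tendsto_Lim[rotated]) simp
  show "(GF f g \<longlongrightarrow> green_form_inf k s q f g) at_top" using lim eq by simp
  show "green_form_inf k s q f g - GF f g 0 = ip {0..} (M f) g - ip {0..} f (M g)" using eq ii by simp
qed

end

section \<open>Solutions and their boundary values\<close>

lemma D_local:
  fixes f g :: "real \<Rightarrow> 'a::real_normed_vector"
  assumes "open T" "\<And>x. x \<in> T \<Longrightarrow> 0 \<le> x \<Longrightarrow> f x = g x" "x \<in> T" "0 \<le> x"
  shows "D j f x = D j g x"
  using assms(3,4)
proof (induction j arbitrary: x)
  case 0 then show ?case using assms(2) by simp
next
  case (Suc j)
  obtain d where d: "d > 0" "\<And>y. dist y x < d \<Longrightarrow> y \<in> T" using assms(1) Suc.prems(1) open_dist by blast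
  have "(D j f has_vector_derivative v) (at x within {0..}) \<longleftrightarrow> (D j g has_vector_derivative v) (at x within {0..})" for v
    using has_vector_derivative_transform_within[of "D j f" v x "{0..}" d "D j g"]
      has_vector_derivative_transform_within[of "D j g" v x "{0..}" d "D j f"] Suc d by auto
  then show ?case unfolding D_Suc hderiv_def vector_derivative_def by simp
qed

lemma sqn_eq_0_imp_zero:
  assumes "continuous_on {0..b} u" "sqn {0..b} u = 0" "x \<in> {0..b}" "0 < b"
  shows "u x = 0"
proof -
  have c: "continuous_on {0..b} (\<lambda>x. (norm (u x))\<^sup>2)" using assms(1) by (intro continuous_intros)
  have "(norm (u x))\<^sup>2 = 0"
    using integral_eq_0_iff[OF c] assms unfolding sqn_def by auto
  then show ?thesis by simp
qed

context symmetric_expr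
begin

lemma GF_herm: "GF g f x = - cnj (GF f g x)"
proof -
  have i: "cnj (\<i>^(2*r+1)) = - (\<i>^(2*r+1))" for r by (simp add: power_mult)
  have 1: "(\<Sum>r\<le>k. (-1)^r * (A' r - cnj (A r))) = - cnj (\<Sum>r\<le>k. (-1)^r * (A r - cnj (A' r)))" for A A' :: "nat \<Rightarrow> complex"
    unfolding cnj_sum sum_negf[symmetric] by (intro sum.cong refl) (simp add: algebra_simps)
  have 2: "1/2 * (\<Sum>r<k. \<i>^(2*r+1) * (P' r + Q' r + cnj (P r + Q r))) =
      - cnj (1/2 * (\<Sum>r<k. \<i>^(2*r+1) * (P r + Q r + cnj (P' r + Q' r))))" for P P' Q Q' :: "nat \<Rightarrow> complex"
  proof -
    have "(\<Sum>r<k. \<i>^(2*r+1) * (P' r + Q' r + cnj (P r + Q r))) = - cnj (\<Sum>r<k. \<i>^(2*r+1) * (P r + Q r + cnj (P' r + Q' r)))"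
      unfolding cnj_sum sum_negf[symmetric] complex_cnj_mult i by (intro sum.cong refl) (simp add: add_ac)
    then show ?thesis by simp
  qed
  show ?thesis unfolding green_form_def 1[of "\<lambda>r. ibp r (\<lambda>t. of_real (s r t) * D r g t) f x" "\<lambda>r. ibp r (\<lambda>t. of_real (s r t) * D r f t) g x"]
      2[of "\<lambda>r. ibp (r+1) (\<lambda>t. of_real (q r t) * D r g t) f x" "\<lambda>r. ibp r (\<lambda>t. of_real (q r t) * D (r+1) g t) f x"
           "\<lambda>r. ibp (r+1) (\<lambda>t. of_real (q r t) * D r f t) g x" "\<lambda>r. ibp r (\<lambda>t. of_real (q r t) * D (r+1) f t) g x"]
    by (simp only: complex_cnj_add minus_add_distrib)
qed

lemma GF_data:
  assumes "loc_dom f" "loc_dom g" "loc_dom f'" "loc_dom g'" "0 \<le> x"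
    "\<And>j. j < m \<Longrightarrow> D j f x = D j f' x" "\<And>j. j < m \<Longrightarrow> D j g x = D j g' x"
  shows "GF f g x = GF f' g' x"
proof -
  obtain B where B: "\<And>f g x. 0 \<le> x \<Longrightarrow> smooth m f \<Longrightarrow> smooth m g \<Longrightarrow> GF f g x = bil m B f g x"
    using green_form_rep[OF k_pos s_smooth q_smooth] by metis
  show ?thesis using assms by (simp add: B loc_dom_def bil_def)
qed

lemma GF_lin:
  assumes "loc_dom f" "loc_dom g" "loc_dom h" "0 \<le> x"
  shows "GF (\<lambda>t. a * f t + g t) h x = a * GF f h x + GF g h x"
proof -
  obtain B where B: "\<And>f g x. 0 \<le> x \<Longrightarrow> smooth m f \<Longrightarrow> smooth m g \<Longrightarrow> GF f g x = bil m B f g x"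
    using green_form_rep[OF k_pos s_smooth q_smooth] by metis
  have sm: "smooth m f" "smooth m g" "smooth m h" "smooth m (\<lambda>t. a * f t + g t)"
    using assms loc_dom_lin by (auto simp: loc_dom_def)
  show ?thesis
    unfolding B[OF assms(4) sm(4,3)] B[OF assms(4) sm(1,3)] B[OF assms(4) sm(2,3)] bil_def sum_distrib_left sum.distrib[symmetric]
    by (intro sum.cong refl, subst D_lin_loc_dom[OF assms(1,2) _ assms(4)]) (simp_all add: algebra_simps)
qed

lemma GF_zero: "loc_dom h \<Longrightarrow> 0 \<le> x \<Longrightarrow> GF (\<lambda>_. 0) h x = 0"
  using GF_lin[OF loc_dom_zero loc_dom_zero, of h x 1] by simp

lemma GF_lin_right:
  assumes "loc_dom f" "loc_dom g" "loc_dom h" "0 \<le> x"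
  shows "GF h (\<lambda>t. a * f t + g t) x = cnj a * GF h f x + GF h g x"
  using GF_lin[OF assms, of a] GF_herm[of h "\<lambda>t. a * f t + g t" x] GF_herm[of h f x] GF_herm[of h g x] by simp

lemma loc_dom_lcomb: "finite I \<Longrightarrow> (\<And>i. i \<in> I \<Longrightarrow> loc_dom (e i)) \<Longrightarrow> loc_dom (lcomb I c e)"
  by (rule lcomb_closed[where P = loc_dom]) (auto intro: loc_dom_zero loc_dom_lin)

lemma D_lcomb:
  assumes "finite I" "\<And>i. i \<in> I \<Longrightarrow> loc_dom (e i)" "j < m" "0 \<le> x"
  shows "D j (lcomb I c e) x = (\<Sum>i\<in>I. c i * D j (e i) x)"
  using lcomb_linear[of I e "Collect loc_dom" "\<lambda>f. D j f x" c] assms loc_dom_zero loc_dom_lin D_lin_loc_dom by simp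

lemma GF_lcomb:
  assumes "finite I" "\<And>i. i \<in> I \<Longrightarrow> loc_dom (e i)" "loc_dom h" "0 \<le> x"
  shows "GF (lcomb I c e) h x = (\<Sum>i\<in>I. c i * GF (e i) h x)"
  using lcomb_linear[of I e "Collect loc_dom" "\<lambda>f. GF f h x" c] assms loc_dom_zero loc_dom_lin GF_lin by simp

text \<open>Induction on \<open>j\<close>: the pairing with \<open>g (2 k - 1 - j)\<close> involves no \<open>D i f b\<close> with \<open>i > j\<close>, by the
  triangular shape of the coefficients, and the coefficient of \<open>D j f b\<close> is \<open>\<plusminus> s k b\<close>.\<close>

lemma GF_nondegenerate:
  assumes f: "loc_dom f" and b: "0 \<le> b"
    and g: "\<And>l. l < m \<Longrightarrow> loc_dom (g l)" "\<And>l j. l < m \<Longrightarrow> j < m \<Longrightarrow> D j (g l) b = (if j = l then 1 else 0)"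
    and zero: "\<And>l. l < m \<Longrightarrow> GF f (g l) b = 0"
  shows "j < m \<Longrightarrow> D j f b = 0"
proof (induction j rule: less_induct)
  case (less j)
  obtain B where "\<And>j l. AC_loc (B j l)" and B0: "\<And>j l x. m \<le> j + l \<Longrightarrow> B j l x = 0"
    and Bn: "\<And>j x. j < m \<Longrightarrow> 0 \<le> x \<Longrightarrow> s k x \<noteq> 0 \<Longrightarrow> B j (m-1-j) x \<noteq> 0"
    and B: "\<And>f g x. 0 \<le> x \<Longrightarrow> smooth m f \<Longrightarrow> smooth m g \<Longrightarrow> GF f g x = bil m B f g x"
    using green_form_rep[OF k_pos s_smooth q_smooth] by blast
  define l where "l = m - 1 - j"
  have l: "l < m" "j < m" "l = m - 1 - j" using less.prems by (auto simp: l_def)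
  have "0 = bil m B f (g l) b" using zero[OF l(1)] B[OF b, of f "g l"] f g(1)[OF l(1)] by (simp add: loc_dom_def)
  also have "\<dots> = (\<Sum>i<m. B i l b * D i f b)"
    unfolding bil_def
  proof (intro sum.cong refl)
    fix i
    have "(\<Sum>l'<m. B i l' b * D i f b * cnj (D l' (g l) b)) = (\<Sum>l'<m. if l' = l then B i l' b * D i f b else 0)"
      using g(2)[OF l(1)] by (intro sum.cong refl) auto
    then show "(\<Sum>l'<m. B i l' b * D i f b * cnj (D l' (g l) b)) = B i l b * D i f b" using l by simp
  qed
  also have "\<dots> = B j l b * D j f b"
  proof -
    have "B i l b * D i f b = 0" if "i < m" "i \<noteq> j" for i
      using that less.IH[of i] B0[of i l b] l by (cases "i < j") auto
    then have "(\<Sum>i<m. B i l b * D i f b) = (\<Sum>i\<in>{j}. B i l b * D i f b)"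
      using l(2) by (intro sum.mono_neutral_right) auto
    then show ?thesis by simp
  qed
  finally show ?case using Bn[OF l(2) b] s_pos[OF b] l(3) by simp
qed

lemma solution_loc_dom: "solution c u \<Longrightarrow> loc_dom u"
proof -
  assume u: "solution c u"
  have "AC_loc (D (m-1) u)"
  proof (rule AC_loc_C1)
    fix x :: real assume "0 \<le> x"
    then have "D (m-1) u differentiable (at x within {0..})"
      using u k_pos by (auto simp: solution_def differentiable_on_def)
    then have "(D (m-1) u has_vector_derivative D (Suc (m-1)) u x) (at x within {0..})"
      unfolding D_Suc by (rule hderiv_has)
    then show "(D (m-1) u has_vector_derivative D m u x) (at x within {0..})" using k_pos by simp
  next
    show "continuous_on {0..} (D m u)" using u by (simp add: solution_def)
  qed
  then show ?thesis using u by (simp add: loc_dom_def smooth_def solution_def)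
qed

lemma solution_dd: "solution c u \<Longrightarrow> 0 \<le> x \<Longrightarrow> dd (m-1) x u"
  using k_pos by (auto simp: solution_def dd_def differentiable_on_def)

lemma solution_lin: 
  assumes u: "solution c u" and v: "solution c v"
  shows "solution c (\<lambda>x. a * u x + v x)"
  unfolding solution_def
proof (intro conjI allI impI)
  have D: "D j (\<lambda>t. a * u t + v t) x = a * D j u x + D j v x" if "j \<le> m" "0 \<le> x" for j x
    by (rule D_lin[OF that(2)])
       (use solution_dd[OF u that(2)] solution_dd[OF v that(2)] that in \<open>auto intro: dd_mono[OF _ _ that(2)]\<close>)
  show "D j (\<lambda>x. a * u x + v x) differentiable_on {0..}" if "j < m" for j
  proof (rule differentiable_on_half_line_cong)
    show "(\<lambda>x. a * D j u x + D j v x) differentiable_on {0..}"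
      using u v that by (intro derivative_intros) (auto simp: solution_def)
  qed (use D that in auto)
  have "continuous_on {0..} (\<lambda>x. a * D m u x + D m v x)"
    using u v by (intro continuous_intros) (auto simp: solution_def)
  then show "continuous_on {0..} (D m (\<lambda>x. a * u x + v x))"
    by (rule continuous_on_eq) (use D in auto)
  show "M (\<lambda>x. a * u x + v x) x = c * (a * u x + v x)" if "0 \<le> x" for x
    using M_lin[OF that solution_dd[OF u that] solution_dd[OF v that]] u v that by (simp add: solution_def algebra_simps)
qed (use u v in \<open>auto simp: solution_def\<close>)

definition fundamental :: "complex \<Rightarrow> nat \<Rightarrow> real \<Rightarrow> complex" where
  "fundamental c i = (SOME u. solution c u \<and> (\<forall>j<m. D j u 0 = (if j = i then 1 else 0)))"

lemma fundamental: "solution c (fundamental c i)" "j < m \<Longrightarrow> D j (fundamental c i) 0 = (if j = i then 1 else 0)"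
proof -
  obtain u where "solution c u" "\<And>j. j < m \<Longrightarrow> D j u 0 = (if j = i then 1 else 0)"
    using solution_exists[of c "\<lambda>j. if j = i then 1 else 0"] by blast
  then have "\<exists>u. solution c u \<and> (\<forall>j<m. D j u 0 = (if j = i then 1 else 0))" by blast
  from someI_ex[OF this] show "solution c (fundamental c i)"
    "j < m \<Longrightarrow> D j (fundamental c i) 0 = (if j = i then 1 else 0)"
    unfolding fundamental_def by auto
qed

text \<open>The solution with the initial values \<open>v\<close>, in a form that is linear in \<open>v\<close>.\<close>

definition sol :: "complex \<Rightarrow> (nat \<Rightarrow> complex) \<Rightarrow> real \<Rightarrow> complex" where
  "sol c v = lcomb {..<m} v (fundamental c)"

lemma solution_zero: "solution c (\<lambda>_. 0)"
  using solution_lin[OF fundamental(1)[of c 0] fundamental(1)[of c 0], of "-1"] by simp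

lemma solution_sol: "solution c (sol c v)"
  unfolding sol_def by (rule lcomb_closed[where P = "solution c"]) (auto intro: fundamental solution_lin solution_zero)

lemma sol_data: "j < m \<Longrightarrow> D j (sol c v) 0 = v j"
proof -
  assume j: "j < m"
  have "D j (sol c v) 0 = (\<Sum>i<m. v i * D j (fundamental c i) 0)"
    unfolding sol_def using solution_loc_dom[OF fundamental(1)] j by (intro D_lcomb) auto
  also have "\<dots> = (\<Sum>i<m. if j = i then v i else 0)" using j by (intro sum.cong refl) (simp add: fundamental(2))
  finally show ?thesis using j by simp
qed

lemma GF_nondegenerate_0:
  assumes "loc_dom f" "\<And>v. GF f (sol c v) 0 = 0" "j < m"
  shows "D j f 0 = 0"
proof (rule GF_nondegenerate[OF assms(1) order.refl, where g = "\<lambda>l. sol c (\<lambda>j. if j = l then 1 else 0)"])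
qed (use assms sol_data solution_loc_dom[OF solution_sol] in auto)

lemma solution_continuous: "solution c u \<Longrightarrow> continuous_on {0..} u"
  by (intro loc_dom_continuous solution_loc_dom)

lemma sq_int_solution: "solution c u \<Longrightarrow> 0 \<le> a \<Longrightarrow> sq_int {a..b} u"
  by (intro sq_int_continuous continuous_on_subset[OF solution_continuous]) auto

lemma sq_int_M_solution:
  assumes "solution c u" "0 \<le> a"
  shows "sq_int {a..b} (M u)"
proof -
  have "sq_int {a..b} (\<lambda>x. c * u x + 0)"
    by (rule sq_int_lin[OF sq_int_solution[OF assms] sq_int_continuous[OF continuous_on_const]]) simp
  then show ?thesis by (rule sq_int_ae_eq[of _ _ "{}"]) (use assms in \<open>auto simp: solution_def\<close>)
qed

lemma ip_M_solution:
  assumes "solution c u" "0 \<le> a"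
  shows "ip {a..b} (M u) v = c * ip {a..b} u v" "ip {a..b} v (M u) = cnj c * ip {a..b} v u"
proof -
  have "ip {a..b} (M u) v = integral {a..b} (\<lambda>x. c * (u x * cnj (v x)))"
    unfolding ip_def using assms by (intro Henstock_Kurzweil_Integration.integral_cong) (auto simp: solution_def)
  then show 1: "ip {a..b} (M u) v = c * ip {a..b} u v" by (simp add: ip_def)
  show "ip {a..b} v (M u) = cnj c * ip {a..b} v u"
    unfolding ip_cnj[of _ v "M u"] ip_cnj[of _ v u] using 1 by simp
qed

lemma green_solution_right:
  assumes f: "loc_dom f" and Mf: "sq_int {0..b} (M f)" and u: "solution c u" and b: "0 \<le> b"
  shows "GF f u b - GF f u 0 = ip {0..b} (M f) u - cnj c * ip {0..b} f u"
  using green_ip[OF f solution_loc_dom[OF u] b Mf sq_int_M_solution[OF u order.refl]] ip_M_solution[OF u order.refl] by simp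

text \<open>If \<open>c = \<plusminus> \<i>\<close>, the factor is \<open>2 c\<close> for \<open>c' = c\<close> and \<open>0\<close> for \<open>c' = - c\<close>.\<close>

lemma green_solutions:
  assumes "solution c u" "solution c' v" "0 \<le> b"
  shows "GF u v b - GF u v 0 = (c - cnj c') * ip {0..b} u v"
  using green_solution_right[OF solution_loc_dom[OF assms(1)] sq_int_M_solution[OF assms(1) order.refl] assms(2,3)]
    ip_M_solution[OF assms(1) order.refl] by (simp add: algebra_simps)

lemma solution_zero_data:
  assumes u: "solution c u" and b: "0 < b" and z: "sqn {0..b} u = 0" and j: "j < m"
  shows "D j u 0 = 0"
proof -
  have "u x = 0" if "x \<in> {0..b}" for x
    by (rule sqn_eq_0_imp_zero[OF _ z that b]) (auto intro: continuous_on_subset[OF solution_continuous[OF u]])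
  then have "D j u 0 = D j (\<lambda>_. 0) 0"
    using b by (intro D_local[of "{..<b}"]) auto
  also have "\<dots> = 0" by (simp add: D_zero)
  finally show ?thesis .
qed

text \<open>These are \<open>4 k\<close> linear equations for \<open>4 k\<close> coefficients. If a sum \<open>u + y\<close> of solutions has zero data at
  both endpoints, Green's formula for \<open>u + y\<close> and \<open>u\<close> reads \<open>0 = 2 c \<parallel>u\<parallel>\<^sup>2\<close>, and for \<open>u + y\<close> and \<open>y\<close> it reads
  \<open>0 = - 2 c \<parallel>y\<parallel>\<^sup>2\<close>; so the system is injective.\<close>

lemma boundary_values:
  assumes c: "c = \<i> \<or> c = -\<i>" and b: "0 < b"
  obtains v w where
    "\<And>j. j < m \<Longrightarrow> D j (\<lambda>x. 1 * sol c v x + sol (-c) w x) 0 = \<alpha> j"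
    "\<And>j. j < m \<Longrightarrow> D j (\<lambda>x. 1 * sol c v x + sol (-c) w x) b = \<beta> j"
proof -
  \<comment> \<open>In the first component \<open>True\<close> stands for the endpoint
      \<open>b\<close> or the parameter \<open>c\<close>, and \<open>False\<close> for
      \<open>0\<close> or \<open>- c\<close>.\<close>
  define cc where "cc t = (if t then c else - c)" for t
  define I where "I = (UNIV :: bool set) \<times> {..<m}"
  define A where "A p r = D (snd p) (fundamental (cc (fst r)) (snd r)) (if fst p then b else 0)" for p r :: "bool \<times> nat"
  have ld: "loc_dom (sol c v)" for c v using solution_loc_dom[OF solution_sol] .
  have b0: "0 \<le> b" using b by simp
  have A: "(\<Sum>r\<in>I. A (e, j) r * x r) = D j (\<lambda>t. 1 * sol c (\<lambda>i. x (True, i)) t + sol (-c) (\<lambda>i. x (False, i)) t) (if e then b else 0)"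
    if j: "j < m" for e j x
  proof -
    have p: "0 \<le> (if e then b else 0)" using b by simp
    have I: "I = Pair True ` {..<m} \<union> Pair False ` {..<m}" by (auto simp: I_def)
    have "(\<Sum>r\<in>I. A (e, j) r * x r) = (\<Sum>i<m. A (e, j) (True, i) * x (True, i)) + (\<Sum>i<m. A (e, j) (False, i) * x (False, i))"
      unfolding I by (subst sum.union_disjoint) (auto simp: sum.reindex inj_on_def)
    moreover have "(\<Sum>i<m. A (e, j) (t, i) * x (t, i)) = D j (sol (cc t) (\<lambda>i. x (t, i))) (if e then b else 0)" for t
    proof -
      have "D j (sol (cc t) (\<lambda>i. x (t, i))) (if e then b else 0) =
         (\<Sum>i<m. x (t, i) * D j (fundamental (cc t) i) (if e then b else 0))"
        unfolding sol_def using solution_loc_dom[OF fundamental(1)] j p by (intro D_lcomb) auto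
      then show ?thesis by (simp add: A_def mult.commute)
    qed
    note this[of True] this[of False]
    ultimately show ?thesis using D_lin_loc_dom[OF ld ld j p, of 1] by (simp add: cc_def)
  qed
  have inj: "x p = 0" if z: "\<And>p. p \<in> I \<Longrightarrow> (\<Sum>r\<in>I. A p r * x r) = 0" and p: "p \<in> I" for x p
  proof -
    define u where "u = sol c (\<lambda>i. x (True, i))"
    define w where "w = sol (-c) (\<lambda>i. x (False, i))"
    define g where "g = (\<lambda>t. 1 * u t + w t)"
    have su: "solution c u" and sw: "solution (-c) w" by (auto simp: u_def w_def solution_sol)
    have lu: "loc_dom u" "loc_dom w" "loc_dom g" using su sw loc_dom_lin[of u w 1] by (auto simp: g_def intro: solution_loc_dom)
    have gz: "D j g 0 = 0" "D j g b = 0" if "j < m" for j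
      using A[OF that, of False x] A[OF that, of True x] z[of "(False, j)"] z[of "(True, j)"] that by (auto simp: I_def g_def u_def w_def)
    have GF0: "GF g h b - GF g h 0 = 0" if "loc_dom h" for h
    proof -
      have "GF g h b = GF (\<lambda>_. 0) h b" "GF g h 0 = GF (\<lambda>_. 0) h 0"
        using gz lu(3) that b0 by (auto intro!: GF_data loc_dom_zero simp: D_zero)
      then show ?thesis using GF_zero that b0 by simp
    qed
    have split: "GF g h b - GF g h 0 = (GF u h b - GF u h 0) + (GF w h b - GF w h 0)" if "loc_dom h" for h
      unfolding g_def using GF_lin[OF lu(1,2) that, of _ 1] b0 by simp
    have cc2: "c - cnj c = 2 * c" "- c - cnj c = 0" "c - cnj (- c) = 0" "- c - cnj (- c) = - 2 * c" "c \<noteq> 0" using c by auto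
    have "2 * c * ip {0..b} u u = 0"
      using split[OF lu(1), unfolded GF0[OF lu(1)] green_solutions[OF su su b0] green_solutions[OF sw su b0] cc2] by simp
    then have u0: "sqn {0..b} u = 0" using cc2 ip_self[OF sq_int_solution[OF su order.refl]] by simp
    have "2 * c * ip {0..b} w w = 0"
      using split[OF lu(2), unfolded GF0[OF lu(2)] green_solutions[OF su sw b0] green_solutions[OF sw sw b0] cc2] by simp
    then have w0: "sqn {0..b} w = 0" using cc2 ip_self[OF sq_int_solution[OF sw order.refl]] by simp
    obtain t i where ti: "p = (t, i)" "i < m" using p by (auto simp: I_def)
    show ?thesis
      using ti solution_zero_data[OF su b u0 ti(2)] solution_zero_data[OF sw b w0 ti(2)]
        sol_data[OF ti(2), of c "\<lambda>i. x (True, i)"] sol_data[OF ti(2), of "-c" "\<lambda>i. x (False, i)"]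
      by (cases t) (auto simp: u_def w_def)
  qed
  have "finite I" by (simp add: I_def)
  then obtain x where x: "\<forall>p\<in>I. (\<Sum>r\<in>I. A p r * x r) = (if fst p then \<beta> (snd p) else \<alpha> (snd p))"
    using square_system_surj[of I I A "\<lambda>p. if fst p then \<beta> (snd p) else \<alpha> (snd p)"] inj by blast
  show ?thesis
  proof (rule that)
    fix j assume j: "j < m"
    show "D j (\<lambda>t. 1 * sol c (\<lambda>i. x (True, i)) t + sol (-c) (\<lambda>i. x (False, i)) t) 0 = \<alpha> j"
      using A[OF j, of False x] x j by (auto simp: I_def)
    show "D j (\<lambda>t. 1 * sol c (\<lambda>i. x (True, i)) t + sol (-c) (\<lambda>i. x (False, i)) t) b = \<beta> j"
      using A[OF j, of True x] x j by (auto simp: I_def)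
  qed
qed

end

section \<open>Cutoffs and the defect spaces\<close>

text \<open>At the cut the derivatives from both sides are \<open>0\<close>.\<close>

lemma cut_has_vector_derivative:
  fixes h h' :: "real \<Rightarrow> complex"
  assumes h: "\<And>x. 0 \<le> x \<Longrightarrow> (h has_vector_derivative h' x) (at x within {0..})"
    and 1: "h 1 = 0" "h' 1 = 0" and x: "0 \<le> x"
  shows "((\<lambda>x. if x \<le> 1 then h x else 0) has_vector_derivative (if x \<le> 1 then h' x else 0)) (at x within {0..})"
proof -
  consider "x < 1" | "x = 1" | "x > 1" by linarith
  then show ?thesis
  proof cases
    case 1
    then show ?thesis
      using has_vector_derivative_transform_within[OF h[OF x], of "1 - x" "\<lambda>x. if x \<le> 1 then h x else 0"] x
      by (auto simp: dist_real_def)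
  next
    case 2
    have h1: "\<exists>d>0. \<forall>y\<in>{0..}. 0 < norm (y - 1) \<and> norm (y - 1) < d \<longrightarrow> norm (h y) / norm (y - 1) < e" if "e > 0" for e
      using h[of 1] 1 that unfolding has_vector_derivative_def has_derivative_within' by simp
    have "\<exists>d>0. \<forall>y\<in>{0..}. 0 < norm (y - 1) \<and> norm (y - 1) < d \<longrightarrow>
        norm (if y \<le> 1 then h y else 0) / norm (y - 1) < e" if e: "e > 0" for e
    proof -
      obtain d where d: "d > 0" "\<forall>y\<in>{0..}. 0 < norm (y - 1) \<and> norm (y - 1) < d \<longrightarrow> norm (h y) / norm (y - 1) < e"
        using h1[OF e] by blast
      have "norm (if y \<le> 1 then h y else 0) / norm (y - 1) < e"
        if "y \<in> {0..}" "0 < norm (y - 1) \<and> norm (y - 1) < d" for y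
      proof (cases "y \<le> 1")
        case True then show ?thesis using d(2) that by (simp only: if_True)
      qed (use e in simp)
      then show ?thesis using d(1) by blast
    qed
    then have "((\<lambda>x. if x \<le> 1 then h x else 0) has_vector_derivative 0) (at 1 within {0..})"
      using 1 unfolding has_vector_derivative_def has_derivative_within' by simp
    then show ?thesis using 2 1 by simp
  next
    case 3
    then show ?thesis
      using has_vector_derivative_transform_within[OF has_vector_derivative_const[of 0 "at x within {0..}"], of "x - 1" "\<lambda>x. if x \<le> 1 then h x else 0"] x
      by (auto simp: dist_real_def)
  qed
qed

lemma AC_loc_cut:
  assumes h: "\<And>x. 0 \<le> x \<Longrightarrow> (h has_vector_derivative h' x) (at x within {0..})"
    and cont: "continuous_on {0..} h'" and 1: "h 1 = 0"
  shows "AC_loc (\<lambda>x. if x \<le> 1 then h x else 0)"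
  unfolding AC_loc_def
proof (intro allI impI)
  fix a b :: real assume ab: "0 \<le> a" "a \<le> b"
  obtain C where C: "C > 0" "\<And>x y. x \<in> {0..1} \<Longrightarrow> y \<in> {0..1} \<Longrightarrow> norm (h y - h x) \<le> C * norm (y - x)"
    using C1_lipschitz[OF h cont order.refl] by blast
  show "abs_cont_on a b (\<lambda>x. if x \<le> 1 then h x else 0)"
  proof (rule abs_cont_on_lipschitz[of C])
    fix x y assume xy: "a \<le> x" "x \<le> y" "y \<le> b"
    have cut: "(if z \<le> 1 then h z else 0) = h (min z 1)" for z using 1 by (auto simp: min_def)
    have "norm (h (min y 1) - h (min x 1)) \<le> C * norm (min y 1 - min x 1)"
      using xy ab by (intro C(2)) auto
    also have "\<dots> \<le> C * (y - x)" using xy C(1) by (intro mult_left_mono) auto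
    finally show "norm ((if y \<le> 1 then h y else 0) - (if x \<le> 1 then h x else 0)) \<le> C * (y - x)"
      unfolding cut .
  qed (use C in auto)
qed

lemma sq_int_cut:
  assumes "continuous_on {0..1} f"
  shows "sq_int {0..} (\<lambda>x. if x \<le> 1 then f x else 0)"
proof -
  let ?g = "\<lambda>x. if x \<in> {0..1} then f x else 0"
  have f: "sq_int {0..1} f" by (rule sq_int_continuous[OF assms])
  have "f measurable_on {0..1}" using f by (simp add: sq_int_def measurable_on_iff_borel_measurable)
  then have "?g measurable_on UNIV" by (simp only: measurable_on_UNIV)
  then have 1: "?g \<in> borel_measurable (lebesgue_on UNIV)" by (simp add: measurable_on_iff_borel_measurable)
  have "(\<lambda>x. if x \<in> {0..1} then (norm (f x))\<^sup>2 else 0) integrable_on UNIV"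
    using f unfolding sq_int_def by (simp only: integrable_restrict_UNIV)
  moreover have "(\<lambda>x. (norm (?g x))\<^sup>2) = (\<lambda>x. if x \<in> {0..1} then (norm (f x))\<^sup>2 else 0)" by auto
  ultimately have "sq_int UNIV ?g" using 1 unfolding sq_int_def by simp
  then have "sq_int {0..} ?g" by (rule sq_int_subset) auto
  then show ?thesis by (rule sq_int_ae_eq[of _ _ "{}"]) auto
qed

lemma bounded_coordinates_subsequence:
  fixes v :: "nat \<Rightarrow> nat \<Rightarrow> complex"
  assumes "\<And>i. i < N \<Longrightarrow> bounded (range (\<lambda>n. v n i))"
  obtains r l where "strict_mono r" "\<And>i. i < N \<Longrightarrow> (\<lambda>n. v (r n) i) \<longlonglongrightarrow> l i"
proof -
  have "\<exists>r. strict_mono (r::nat\<Rightarrow>nat) \<and> (\<forall>i<N. \<exists>l. (\<lambda>n. v (r n) i) \<longlonglongrightarrow> l)"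
    using assms
  proof (induction N)
    case 0 then show ?case by (intro exI[of _ id]) (auto simp: strict_mono_def)
  next
    case (Suc N)
    then obtain r where r: "strict_mono (r::nat\<Rightarrow>nat)" "\<forall>i<N. \<exists>l. (\<lambda>n. v (r n) i) \<longlonglongrightarrow> l" by auto
    have "bounded (range (\<lambda>n. v (r n) N))" using Suc.prems[of N] by (rule bounded_subset) auto
    then obtain l r' where r': "strict_mono (r'::nat\<Rightarrow>nat)" "((\<lambda>n. v (r n) N) \<circ> r') \<longlonglongrightarrow> l"
      using bounded_imp_convergent_subsequence by blast
    have "\<exists>l. (\<lambda>n. v ((r \<circ> r') n) i) \<longlonglongrightarrow> l" if i: "i < Suc N" for i
    proof (cases "i = N")
      case True then show ?thesis using r'(2) by (auto simp: o_def)
    next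
      case False
      then have "i < N" using i by simp
      then obtain l where "(\<lambda>n. v (r n) i) \<longlonglongrightarrow> l" using r(2) by blast
      from LIMSEQ_subseq_LIMSEQ[OF this r'(1)] show ?thesis by (auto simp: o_def)
    qed
    moreover have "strict_mono (r \<circ> r')" using r(1) r'(1) by (rule strict_mono_o)
    ultimately show ?case by blast
  qed
  then show ?thesis using that by metis
qed

context symmetric_expr
begin

text \<open>A sum of two solutions takes prescribed data at \<open>0\<close> and zero data at \<open>1\<close>, so it can be continued by
  \<open>0\<close>. As \<open>M\<close> multiplies the two solutions by constants, the image is again square integrable.\<close>

lemma cutoff_exists:
  obtains e where "e \<in> DD" "\<And>j. j < m \<Longrightarrow> D j e 0 = \<eta> j" "\<And>x. 1 < x \<Longrightarrow> e x = 0"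
proof -
  obtain v w where vw: "\<And>j. j < m \<Longrightarrow> D j (\<lambda>x. 1 * sol \<i> v x + sol (-\<i>) w x) 0 = \<eta> j"
    "\<And>j. j < m \<Longrightarrow> D j (\<lambda>x. 1 * sol \<i> v x + sol (-\<i>) w x) 1 = 0"
    using boundary_values[of \<i> 1 \<eta> "\<lambda>_. 0"] by auto
  define g where "g = (\<lambda>x. 1 * sol \<i> v x + sol (-\<i>) w x)"
  define e where "e x = (if x < 0 then 0 else if x \<le> 1 then g x else 0)" for x
  note su = solution_sol[of \<i> v] and sw = solution_sol[of "-\<i>" w]
  have ddg: "dd (m-1) x g" if "0 \<le> x" for x
    unfolding g_def using dd_add[OF solution_dd[OF su that] solution_dd[OF sw that] that] by simp
  have Dg: "D j g x = 1 * D j (sol \<i> v) x + D j (sol (-\<i>) w) x" if "j \<le> m" "0 \<le> x" for j x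
    unfolding g_def by (rule D_lin[OF that(2)])
      (use solution_dd[OF su that(2)] solution_dd[OF sw that(2)] that in \<open>auto intro: dd_mono[OF _ _ that(2)]\<close>)
  have "continuous_on {0..} (\<lambda>x. 1 * D m (sol \<i> v) x + D m (sol (-\<i>) w) x)"
    using su sw by (intro continuous_intros) (auto simp: solution_def)
  then have Dmc: "continuous_on {0..} (D m g)" by (rule continuous_on_eq) (use Dg in auto)
  have g_has: "(D j g has_vector_derivative D (Suc j) g x) (at x within {0..})" if "j < m" "0 \<le> x" for j x
    by (rule dd_has[OF ddg[OF that(2)] _ that(2)]) (use that in auto)
  have g1: "D j g 1 = 0" if "j < m" for j using vw(2)[OF that] by (simp only: g_def)
  have De: "D j e x = (if x \<le> 1 then D j g x else 0)" if "j < m" "0 \<le> x" for j x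
    using that
  proof (induction j arbitrary: x)
    case 0 then show ?case by (simp add: e_def)
  next
    case (Suc j)
    have "D (Suc j) e x = hderiv (\<lambda>x. if x \<le> 1 then D j g x else 0) x"
      unfolding D_Suc by (rule hderiv_cong) (use Suc in auto)
    also have "\<dots> = (if x \<le> 1 then D (Suc j) g x else 0)"
      by (rule hderiv_eqI[OF cut_has_vector_derivative]) (use Suc.prems g_has g1 in auto)
    finally show ?case .
  qed
  have ld: "loc_dom e"
    unfolding loc_dom_def smooth_def
  proof (intro conjI allI impI)
    fix j assume j: "j < m - 1"
    have "(\<lambda>x. if x \<le> 1 then D j g x else 0) differentiable_on {0..}"
      unfolding differentiable_on_def
      by (intro ballI differentiableI_vector[OF cut_has_vector_derivative[where h' = "D (Suc j) g"]])
         (use g_has g1 j in auto)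
    then show "D j e differentiable_on {0..}"
      by (rule differentiable_on_half_line_cong[rotated]) (use De j in auto)
  next
    have "AC_loc (\<lambda>x. if x \<le> 1 then D (m-1) g x else 0)"
    proof (rule AC_loc_cut)
      show "(D (m-1) g has_vector_derivative D m g x) (at x within {0..})" if "0 \<le> x" for x
        using g_has[of "m-1" x] that k_pos by simp
    qed (use Dmc g1 k_pos in auto)
    then show "AC_loc (D (m-1) e)" by (rule AC_loc_cong) (use De k_pos in auto)
  qed
  obtain a where "\<And>j. j < m \<Longrightarrow> continuous_on {0..} (a j)"
    and a: "\<And>f x. 0 \<le> x \<Longrightarrow> dd (m-1) x f \<Longrightarrow> M f x = (-1)^k * of_real (s k x) * D m f x + (\<Sum>j<m. a j x * D j f x)"
    using M_expr_rep[OF k_pos s_smooth q_smooth] by blast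
  have dde: "dd (m-1) x e" if "0 \<le> x" "x \<noteq> 1" for x
    unfolding dd_def
  proof (intro conjI allI impI)
    show "D j e differentiable_on {0..}" if "j < m - 1" for j using ld that by (simp add: loc_dom_def smooth_def)
    show "D (m-1) e differentiable (at x within {0..})"
    proof (cases "x < 1")
      case True
      have "(D (m-1) e has_vector_derivative D (Suc (m-1)) g x) (at x within {0..})"
        by (rule has_vector_derivative_transform_within[OF g_has[of "m-1" x], of "1 - x"])
           (use True that De k_pos in \<open>auto simp: dist_real_def\<close>)
      then show ?thesis by (rule differentiableI_vector)
    next
      case False
      have "(D (m-1) e has_vector_derivative 0) (at x within {0..})"
        by (rule has_vector_derivative_transform_within[OF has_vector_derivative_const[of 0 "at x within {0..}"], of "x - 1"])
           (use False that De k_pos in \<open>auto simp: dist_real_def\<close>)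
      then show ?thesis by (rule differentiableI_vector)
    qed
  qed
  have Me: "M e x = (if x \<le> 1 then 1 * (\<i> * sol \<i> v x) + (-\<i>) * sol (-\<i>) w x else 0)" if "0 \<le> x" "x \<noteq> 1" for x
  proof (cases "x < 1")
    case True
    have "D j e x = D j g x" for j
      by (rule D_local[of "{..<1}"]) (use True that in \<open>auto simp: e_def\<close>)
    then have "M e x = M g x" using a[OF that(1) dde[OF that]] a[OF that(1) ddg[OF that(1)]] by simp
    also have "\<dots> = 1 * M (sol \<i> v) x + M (sol (-\<i>) w) x"
      unfolding g_def by (rule M_lin[OF that(1) solution_dd[OF su that(1)] solution_dd[OF sw that(1)]])
    finally show ?thesis using su sw True that by (simp add: solution_def)
  next
    case False
    have "D j e x = D j (\<lambda>_. 0) x" for j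
      by (rule D_local[of "{1<..}"]) (use False that in \<open>auto simp: e_def\<close>)
    then show ?thesis using a[OF that(1) dde[OF that]] that False by (simp add: D_zero)
  qed
  have cu: "continuous_on {0..1} (sol \<i> v)" "continuous_on {0..1} (sol (-\<i>) w)"
    using su sw by (auto intro: continuous_on_subset[OF solution_continuous])
  have "sq_int {0..} (\<lambda>x. if x \<le> 1 then 1 * (\<i> * sol \<i> v x) + (-\<i>) * sol (-\<i>) w x else 0)"
    using cu by (intro sq_int_cut continuous_intros)
  then have "sq_int {0..} (M e)" by (rule sq_int_ae_eq[of _ _ "{1}"]) (use Me in auto)
  moreover have "sq_int {0..} e"
  proof -
    have "continuous_on {0..1} g" unfolding g_def using cu by (intro continuous_intros)
    then have "sq_int {0..} (\<lambda>x. if x \<le> 1 then g x else 0)" by (rule sq_int_cut)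
    then show ?thesis by (rule sq_int_ae_eq[of _ _ "{}"]) (auto simp: e_def)
  qed
  ultimately have "e \<in> DD" unfolding Delta_iff using ld by (auto simp: e_def)
  moreover have "D j e 0 = \<eta> j" if "j < m" for j using De[OF that, of 0] vw(1)[OF that] by (simp only: g_def) simp
  moreover have "e x = 0" if "1 < x" for x using that by (simp add: e_def)
  ultimately show ?thesis using that by blast
qed

abbreviation "E c \<equiv> defect_space k s q c"

lemma defect_iff: "f \<in> E c \<longleftrightarrow> f \<in> DD \<and> (\<exists>N. negligible N \<and> (\<forall>x\<in>{0..} - N. M f x = c * f x))"
proof -
  have "(AE x in lebesgue_on {0<..}. M f x = c * f x) \<longleftrightarrow> (AE x in lebesgue. x \<in> {0<..} \<longrightarrow> M f x = c * f x)"
    by (rule AE_restrict_space_iff) auto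
  also have "\<dots> \<longleftrightarrow> (\<exists>N. negligible N \<and> (\<forall>x\<in>{0..} - N. M f x = c * f x))"
  proof
    assume "AE x in lebesgue. x \<in> {0<..} \<longrightarrow> M f x = c * f x"
    then obtain N where N: "\<And>x. x \<in> space lebesgue - N \<Longrightarrow> x \<in> {0<..} \<longrightarrow> M f x = c * f x" "N \<in> null_sets lebesgue"
      by (rule AE_E3) blast
    have "negligible (insert 0 N)" using N(2) by (simp add: negligible_iff_null_sets)
    moreover have "\<forall>x\<in>{0..} - insert 0 N. M f x = c * f x" using N(1) by force
    ultimately show "\<exists>N. negligible N \<and> (\<forall>x\<in>{0..} - N. M f x = c * f x)" by blast
  next
    assume "\<exists>N. negligible N \<and> (\<forall>x\<in>{0..} - N. M f x = c * f x)"
    then obtain N where N: "negligible N" "\<forall>x\<in>{0..} - N. M f x = c * f x" by blast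
    show "AE x in lebesgue. x \<in> {0<..} \<longrightarrow> M f x = c * f x"
    proof (rule AE_I')
      show "N \<in> null_sets lebesgue" using N(1) by (simp add: negligible_iff_null_sets)
      show "{x \<in> space lebesgue. \<not> (x \<in> {0<..} \<longrightarrow> M f x = c * f x)} \<subseteq> N" using N(2) by force
    qed
  qed
  finally show ?thesis unfolding defect_space_def by blast
qed

lemma solution_defect: "solution c u \<Longrightarrow> sq_int {0..} u \<Longrightarrow> u \<in> E c"
proof -
  assume u: "solution c u" and L: "sq_int {0..} u"
  have "sq_int {0..} (\<lambda>x. c * u x + 0)" by (rule sq_int_lin[OF L sq_int_zero]) auto
  then have "sq_int {0..} (M u)" by (rule sq_int_ae_eq[of _ _ "{}"]) (use u in \<open>auto simp: solution_def\<close>)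
  then show ?thesis unfolding defect_iff Delta_iff using u L solution_loc_dom[OF u]
    by (auto simp: solution_def intro!: exI[of _ "{}"])
qed

lemma defect_lin: "f \<in> E c \<Longrightarrow> g \<in> E c \<Longrightarrow> (\<lambda>x. a * f x + g x) \<in> E c"
proof -
  assume f: "f \<in> E c" and g: "g \<in> E c"
  obtain N1 where N1: "negligible N1" "\<And>x. x \<in> {0..} - N1 \<Longrightarrow> M f x = c * f x" using f unfolding defect_iff by blast
  obtain N2 where N2: "negligible N2" "\<And>x. x \<in> {0..} - N2 \<Longrightarrow> M g x = c * g x" using g unfolding defect_iff by blast
  have "loc_dom f" "loc_dom g" using f g by (auto simp: defect_iff Delta_iff)
  then obtain N where N: "negligible N" "\<And>x. x \<in> {0..} - N \<Longrightarrow> M (\<lambda>t. a * f t + g t) x = a * M f x + M g x"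
    using M_lin_ae by blast
  have "negligible (N \<union> N1 \<union> N2)" using N N1 N2 by (intro negligible_Un)
  moreover have "\<forall>x\<in>{0..} - (N \<union> N1 \<union> N2). M (\<lambda>t. a * f t + g t) x = c * (a * f x + g x)"
    using N N1 N2 by (auto simp: algebra_simps)
  ultimately have "\<exists>N. negligible N \<and> (\<forall>x\<in>{0..} - N. M (\<lambda>t. a * f t + g t) x = c * (a * f x + g x))" by blast
  moreover have "(\<lambda>t. a * f t + g t) \<in> DD" using f g by (intro Delta_lin) (auto simp: defect_iff)
  ultimately show ?thesis unfolding defect_iff by blast
qed

lemma defect_zero: "(\<lambda>_. 0) \<in> E c"
  by (rule solution_defect[OF solution_zero sq_int_zero])

lemma defect_ip:
  assumes "f \<in> E c"
  shows "ip {0..b} (M f) g = c * ip {0..b} f g" "ip {0..} (M f) g = c * ip {0..} f g"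
    "ip {0..} g (M f) = cnj c * ip {0..} g f"
proof -
  obtain N where N: "negligible N" "\<And>x. x \<in> {0..} - N \<Longrightarrow> M f x = c * f x" using assms unfolding defect_iff by blast
  have *: "ip S (M f) g = c * ip S f g" if "S \<subseteq> {0..}" for S
  proof -
    have "ip S (M f) g = integral S (\<lambda>x. c * (f x * cnj (g x)))"
      unfolding ip_def by (rule integral_spike[OF N(1)]) (use N(2) that in auto)
    then show ?thesis by (simp add: ip_def)
  qed
  show "ip {0..b} (M f) g = c * ip {0..b} f g" "ip {0..} (M f) g = c * ip {0..} f g" by (auto intro!: *)
  then show "ip {0..} g (M f) = cnj c * ip {0..} g f"
    unfolding ip_cnj[of _ g "M f"] ip_cnj[of _ g f] by simp
qed

text \<open>An element of \<open>E c\<close> satisfies the equation almost everywhere only. Green's formula replaces the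
  uniqueness theorem for initial value problems: \<open>[f y](b) = [f y](0) = 0\<close> for all solutions of
  \<open>M y = - c y\<close>, these solutions take arbitrary data at \<open>b\<close>, and the form at \<open>b\<close> is nondegenerate.\<close>

lemma defect_unique:
  assumes c: "c = \<i> \<or> c = -\<i>" and f: "f \<in> E c" and z: "\<And>j. j < m \<Longrightarrow> D j f 0 = 0"
  shows "f = (\<lambda>_. 0)"
proof
  fix b
  have lf: "loc_dom f" and fD: "f \<in> DD" using f by (auto simp: defect_iff Delta_iff)
  show "f b = 0"
  proof (cases "b < 0")
    case True then show ?thesis using fD by (simp add: Delta_iff)
  next
    case False
    then have b: "0 \<le> b" by simp
    have ld: "loc_dom (sol c' v)" for c' v using solution_loc_dom[OF solution_sol] .
    have cc: "cnj (- c) = c" "- c - cnj c = 0" using c by auto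
    have Mf: "sq_int {0..b} (M f)" using fD unfolding Delta_iff by (auto intro: sq_int_subset)
    have zero: "GF f (sol (-c) v) b = 0" for v
    proof -
      have "GF f (sol (-c) v) 0 = GF (\<lambda>_. 0) (sol (-c) v) 0"
        by (intro GF_data lf ld loc_dom_zero) (use z in \<open>auto simp: D_zero\<close>)
      then have "GF f (sol (-c) v) 0 = 0" using GF_zero[OF ld] by simp
      then show ?thesis
        using green_solution_right[OF lf Mf solution_sol b, of "-c" v] defect_ip(1)[OF f, of b "sol (-c) v"]
        unfolding cc by simp
    qed
    \<comment> \<open>The data at \<open>b\<close> of solutions of \<open>M y = - c y\<close> in terms
        of those at \<open>0\<close>.\<close>
    define A where "A j i = D j (fundamental (-c) i) b" for j i
    have A: "D j (sol (-c) v) b = (\<Sum>i\<in>{..<m}. A j i * v i)" if "j < m" for j v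
      unfolding sol_def A_def using D_lcomb[of "{..<m}" "fundamental (-c)" j b v] that b solution_loc_dom[OF fundamental(1)]
      by (simp add: mult.commute)
    have inj: "v i = 0" if zz: "\<And>j. j \<in> {..<m} \<Longrightarrow> (\<Sum>i\<in>{..<m}. A j i * v i) = 0" and i: "i \<in> {..<m}" for v i
    proof -
      have nz: "GF (sol (-c) v) (sol c w) 0 = 0" for w
      proof -
        have "GF (sol (-c) v) (sol c w) b = GF (\<lambda>_. 0) (sol c w) b"
          by (intro GF_data ld loc_dom_zero b) (use A zz b in \<open>auto simp: D_zero\<close>)
        then have "GF (sol (-c) v) (sol c w) b = 0" using GF_zero[OF ld b] by simp
        then show ?thesis using green_solutions[OF solution_sol solution_sol b, of "-c" v c w] unfolding cc by simp
      qed
      then have "D i (sol (-c) v) 0 = 0" using GF_nondegenerate_0[OF ld nz, of i] i by simp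
      then show ?thesis using sol_data i by simp
    qed
    have "\<exists>v. \<forall>j\<in>{..<m}. (\<Sum>i\<in>{..<m}. A j i * v i) = (if j = l then 1 else 0)" for l
      by (rule square_system_surj) (use inj in auto)
    then obtain v where v: "\<And>l j. j < m \<Longrightarrow> (\<Sum>i\<in>{..<m}. A j i * v l i) = (if j = l then 1 else 0)"
      by (metis lessThan_iff)
    have "D 0 f b = 0"
      by (rule GF_nondegenerate[OF lf b, where g = "\<lambda>l. sol (-c) (v l)"]) (use ld A v zero k_pos in auto)
    then show ?thesis by simp
  qed
qed

end

section \<open>The sign of the boundary form\<close>

lemma sq_int_of_bounded:
  assumes u: "continuous_on {0..} u" and T: "\<And>B. 0 \<le> B \<Longrightarrow> sqn {0..B} u \<le> T"
  shows "sq_int {0..} u"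
proof -
  let ?f = "\<lambda>(n::nat) x. if x \<in> {0..real n} then (norm (u x))\<^sup>2 else 0"
  have c: "continuous_on {0..B} u" for B by (rule continuous_on_subset[OF u]) auto
  have i0: "(\<lambda>x. (norm (u x))\<^sup>2) integrable_on {0..B}" for B
    using sq_int_continuous[OF c] by (simp add: sq_int_def)
  have "((\<lambda>x. (norm (u x))\<^sup>2) integrable_on {0..}) \<and> ((\<lambda>n. integral {0..} (?f n)) \<longlonglongrightarrow> integral {0..} (\<lambda>x. (norm (u x))\<^sup>2))"
  proof (rule monotone_convergence_increasing)
    have fi: "(?f n has_integral sqn {0..real n} u) {0..}" for n
    proof -
      have "((\<lambda>x. (norm (u x))\<^sup>2) has_integral sqn {0..real n} u) {0..real n}"
        using i0 unfolding sqn_def by (rule integrable_integral)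
      then show ?thesis by (subst has_integral_restrict) auto
    qed
    show "?f n integrable_on {0..}" for n using fi by blast
    show "?f n x \<le> ?f (Suc n) x" for n x by auto
    show "(\<lambda>n. ?f n x) \<longlonglongrightarrow> (norm (u x))\<^sup>2" if "x \<in> {0..}" for x
    proof (rule tendsto_eventually)
      obtain n0 where "x \<le> real n0" using real_arch_simple by blast
      then show "\<forall>\<^sub>F n in sequentially. ?f n x = (norm (u x))\<^sup>2"
        using that by (intro eventually_sequentiallyI[of n0]) auto
    qed
    have "integral {0..} (?f n) = sqn {0..real n} u" for n using fi by (rule integral_unique)
    then show "bounded (range (\<lambda>n. integral {0..} (?f n)))"
      using T sqn_nonneg by (intro boundedI[of _ T]) auto
  qed
  then show ?thesis unfolding sq_int_def using u by (auto intro: continuous_imp_measurable_on_sets_lebesgue)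
qed

context symmetric_expr
begin

lemma Delta_loc: "f \<in> DD \<Longrightarrow> loc_dom f" by (simp add: Delta_iff)

lemma Delta_sq: "f \<in> DD \<Longrightarrow> S \<subseteq> {0..} \<Longrightarrow> S \<in> sets lebesgue \<Longrightarrow> sq_int S f \<and> sq_int S (M f)"
  by (auto simp: Delta_iff intro: sq_int_subset)

text \<open>There is a fixed \<open>h\<close> in the maximal domain, vanishing beyond \<open>1\<close>, with \<open>[u h](0) = D j u 0\<close> for all \<open>u\<close>.
  Green's formula on \<open>[0, 2]\<close> then expresses \<open>v j\<close> by inner products of the solution with \<open>h\<close> and \<open>M h\<close>.\<close>

lemma coefficient_bound:
  obtains C where "\<And>v j. j < m \<Longrightarrow> norm (v j) \<le> C + (1 + norm c) * sqn {0..2} (sol c v)"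
proof -
  have "\<exists>Cj. \<forall>v. norm (v j) \<le> Cj + (1 + norm c) * sqn {0..2} (sol c v)" if j: "j < m" for j
  proof -
    have "\<exists>e. e \<in> DD \<and> (\<forall>j<m. D j e 0 = (if j = l then 1 else 0)) \<and> (\<forall>x>1. e x = 0)" for l
    proof -
      obtain e where "e \<in> DD" "\<And>j. j < m \<Longrightarrow> D j e 0 = (if j = l then 1 else 0)" "\<And>x. 1 < x \<Longrightarrow> e x = 0"
        using cutoff_exists[of "\<lambda>j. if j = l then 1 else 0"] by blast
      then show ?thesis by blast
    qed
    then have "\<exists>e. \<forall>l. e l \<in> DD \<and> (\<forall>j<m. D j (e l) 0 = (if j = l then 1 else 0)) \<and> (\<forall>x>1. e l x = 0)"
      by (intro choice) blast
    then obtain e where eD: "\<And>l. e l \<in> DD" and e0: "\<And>l j. j < m \<Longrightarrow> D j (e l) 0 = (if j = l then 1 else 0)"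
      and e1: "\<And>l x. 1 < x \<Longrightarrow> e l x = 0" by blast
    \<comment> \<open>The form in the basis \<open>e\<close> dual to the derivatives at
        \<open>0\<close>. The value \<open>-1\<close> below turns into \<open>1\<close>
        when the arguments are interchanged.\<close>
    define A where "A i l = GF (e l) (e i) 0" for i l
    have inj: "x l = 0" if z: "\<And>i. i \<in> {..<m} \<Longrightarrow> (\<Sum>l\<in>{..<m}. A i l * x l) = 0" and l: "l \<in> {..<m}" for x l
    proof -
      have "GF (lcomb {..<m} x e) (e i) 0 = 0" if "i < m" for i
        using GF_lcomb[of "{..<m}" e "e i" 0 x] Delta_loc[OF eD] z[of i] that by (simp add: A_def mult.commute)
      then have "D l (lcomb {..<m} x e) 0 = 0"
        using e0 l Delta_loc[OF eD] by (intro GF_nondegenerate[where g = e] loc_dom_lcomb) auto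
      moreover have "D l (lcomb {..<m} x e) 0 = (\<Sum>i<m. x i * (if l = i then 1 else 0))"
        using D_lcomb[of "{..<m}" e l 0 x] Delta_loc[OF eD] l e0 by simp
      ultimately show ?thesis using l by (simp add: if_distrib[of "\<lambda>y. _ * y"] cong: if_cong)
    qed
    obtain x where x: "\<And>i. i < m \<Longrightarrow> (\<Sum>l\<in>{..<m}. A i l * x l) = (if i = j then -1 else 0)"
      using square_system_surj[of "{..<m}" "{..<m}" A "\<lambda>i. if i = j then -1 else 0"] inj by auto
    define h where "h = lcomb {..<m} x e"
    have hD: "h \<in> DD" unfolding h_def by (rule lcomb_closed[where P = "\<lambda>f. f \<in> DD"]) (auto intro: eD Delta_zero Delta_lin)
    have h1: "h t = 0" if "1 < t" for t unfolding h_def lcomb_def using e1 that by simp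
    have h2: "D i h 2 = 0" if "i < m" for i
    proof -
      have "D i h 2 = D i (\<lambda>_. 0) 2" by (rule D_local[of "{1<..}"]) (use h1 in auto)
      also have "\<dots> = 0" by (simp add: D_zero)
      finally show ?thesis .
    qed
    have hei: "GF h (e i) 0 = (if i = j then -1 else 0)" if "i < m" for i
      unfolding h_def using GF_lcomb[of "{..<m}" e "e i" 0 x] Delta_loc[OF eD] x[OF that] by (simp add: A_def mult.commute)
    have key: "GF u h 0 = D j u 0" if u: "loc_dom u" for u
    proof -
      have l: "loc_dom (lcomb {..<m} (\<lambda>i. D i u 0) e)" using Delta_loc[OF eD] by (intro loc_dom_lcomb) auto
      have "GF u h 0 = GF (lcomb {..<m} (\<lambda>i. D i u 0) e) h 0"
      proof (rule GF_data[OF u Delta_loc[OF hD] l Delta_loc[OF hD] order.refl])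
        fix i assume i: "i < m"
        have "D i (lcomb {..<m} (\<lambda>i. D i u 0) e) 0 = (\<Sum>l<m. D l u 0 * D i (e l) 0)"
          using Delta_loc[OF eD] i by (intro D_lcomb) auto
        also have "\<dots> = (\<Sum>l<m. if i = l then D l u 0 else 0)" by (intro sum.cong refl) (simp add: e0[OF i])
        finally show "D i u 0 = D i (lcomb {..<m} (\<lambda>i. D i u 0) e) 0" using i by simp
      qed simp
      also have "\<dots> = (\<Sum>i<m. D i u 0 * GF (e i) h 0)"
        using Delta_loc[OF eD] Delta_loc[OF hD] by (intro GF_lcomb) auto
      also have "\<dots> = (\<Sum>i<m. if i = j then D i u 0 else 0)"
        using GF_herm[of "e _" h 0] hei by (intro sum.cong refl) (auto simp: GF_herm[of "e _" h 0])
      finally show ?thesis using j by simp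
    qed
    define Cj where "Cj = norm c * sqn {0..2} h + sqn {0..2} (M h)"
    have "norm (v j) \<le> Cj + (1 + norm c) * sqn {0..2} (sol c v)" for v
    proof -
      let ?u = "sol c v"
      have su: "solution c ?u" by (rule solution_sol)
      have hs: "sq_int {0..2} h" "sq_int {0..2} (M h)" using Delta_sq[OF hD, of "{0..2}"] by auto
      note us = sq_int_solution[OF su order.refl, of 2]
      have "GF ?u h 2 = GF ?u (\<lambda>_. 0) 2"
        using h2 Delta_loc[OF hD] solution_loc_dom[OF su] by (intro GF_data loc_dom_zero) (auto simp: D_zero)
      also have "\<dots> = 0" using GF_herm[of ?u "\<lambda>_. 0" 2] GF_zero[OF solution_loc_dom[OF su], of 2] by simp
      finally have "- GF ?u h 0 = ip {0..2} (M ?u) h - ip {0..2} ?u (M h)"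
        using green_ip[OF solution_loc_dom[OF su] Delta_loc[OF hD] _ sq_int_M_solution[OF su order.refl] hs(2)] by simp
      then have "GF ?u h 0 = - (ip {0..2} (M ?u) h - ip {0..2} ?u (M h))" by (metis minus_minus)
      then have "v j = - (c * ip {0..2} ?u h - ip {0..2} ?u (M h))"
        using key[OF solution_loc_dom[OF su]] sol_data[OF j] ip_M_solution(1)[OF su order.refl] by simp
      then have "norm (v j) \<le> norm (c * ip {0..2} ?u h) + norm (ip {0..2} ?u (M h))"
        by (metis norm_minus_cancel norm_triangle_ineq4)
      also have "\<dots> \<le> norm c * norm (ip {0..2} ?u h) + norm (ip {0..2} ?u (M h))" by (simp add: norm_mult)
      also have "\<dots> \<le> norm c * (sqn {0..2} ?u / (2*1) + 1 * sqn {0..2} h / 2) + (sqn {0..2} ?u / (2*1) + 1 * sqn {0..2} (M h) / 2)"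
        by (intro add_mono mult_left_mono ip_bound us hs) auto
      also have "\<dots> \<le> Cj + (1 + norm c) * sqn {0..2} ?u"
      proof -
        have "0 \<le> norm c * sqn {0..2} ?u" "0 \<le> norm c * sqn {0..2} h" "0 \<le> sqn {0..2} ?u" "0 \<le> sqn {0..2} (M h)"
          by (auto intro: mult_nonneg_nonneg sqn_nonneg)
        then show ?thesis unfolding Cj_def distrib_left distrib_right
          by (simp only: mult_1_left mult_1_right times_divide_eq_right)
      qed
      finally show ?thesis .
    qed
    then show ?thesis by blast
  qed
  then obtain Cj where Cj: "\<And>j v. j < m \<Longrightarrow> norm (v j) \<le> Cj j + (1 + norm c) * sqn {0..2} (sol c v)" by metis
  show ?thesis
  proof (rule that)
    fix v :: "nat \<Rightarrow> complex" and j assume j: "j < m"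
    have "Cj j \<le> (\<Sum>j<m. \<bar>Cj j\<bar>)"
      using member_le_sum[of j "{..<m}" "\<lambda>j. \<bar>Cj j\<bar>"] j by auto
    then show "norm (v j) \<le> (\<Sum>j<m. \<bar>Cj j\<bar>) + (1 + norm c) * sqn {0..2} (sol c v)" using Cj[OF j, of v] by linarith
  qed
qed

end

lemma ip_lcomb_left:
  assumes "finite I" "\<And>i. i \<in> I \<Longrightarrow> sq_int S (e i)" "sq_int S h" "S \<in> sets lebesgue"
  shows "ip S (lcomb I c e) h = (\<Sum>i\<in>I. c i * ip S (e i) h)"
  using lcomb_linear[of I e "Collect (sq_int S)" "\<lambda>f. ip S f h" c] assms sq_int_zero sq_int_lin ip_lin_left by simp

lemma ip_lcomb_right:
  assumes "finite I" "\<And>i. i \<in> I \<Longrightarrow> sq_int S (e i)" "sq_int S h" "S \<in> sets lebesgue"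
  shows "ip S h (lcomb I c e) = (\<Sum>i\<in>I. cnj (c i) * ip S h (e i))"
proof -
  have "ip S h (lcomb I c e) = cnj (\<Sum>i\<in>I. c i * ip S (e i) h)"
    using ip_lcomb_left[OF assms] ip_cnj[of S h "lcomb I c e"] by simp
  also have "\<dots> = (\<Sum>i\<in>I. cnj (c i) * cnj (ip S (e i) h))" by (simp add: cnj_sum)
  also have "\<dots> = (\<Sum>i\<in>I. cnj (c i) * ip S h (e i))" by (simp only: ip_cnj[of S h, symmetric])
  finally show ?thesis .
qed

lemma ip_combine:
  assumes "sq_int {a..b} f" "sq_int {a..b} g" "a \<le> d" "d \<le> b"
  shows "ip {a..b} f g = ip {a..d} f g + ip {d..b} f g"
  unfolding ip_def
  by (rule Henstock_Kurzweil_Integration.integral_combine[symmetric])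
     (use assms in \<open>auto intro!: set_lebesgue_integral_eq_integral(1)[OF sq_int_mult]\<close>)

lemma sqn_combine:
  assumes "sq_int {a..b} f" "a \<le> d" "d \<le> b"
  shows "sqn {a..b} f = sqn {a..d} f + sqn {d..b} f"
  unfolding sqn_def
  by (rule Henstock_Kurzweil_Integration.integral_combine[symmetric])
     (use assms in \<open>auto simp: sq_int_def\<close>)

lemma ip_half_line_tendsto:
  assumes "sq_int {0..} f" "sq_int {0..} g"
  shows "((\<lambda>B. ip {0..B} f g) \<longlongrightarrow> ip {0..} f g) at_top"
  unfolding ip_def by (intro abs_integrable_half_line_tendsto sq_int_mult assms) auto

context symmetric_expr
begin

lemma sq_int_fundamental: "sq_int {0..B} (fundamental c i)"
  by (rule sq_int_solution[OF fundamental(1)]) simp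

lemma ip_sol_tendsto:
  assumes "\<And>i. i < m \<Longrightarrow> (\<lambda>n. v n i) \<longlonglongrightarrow> l i" "sq_int {0..B} h"
  shows "(\<lambda>n. ip {0..B} h (sol c (v n))) \<longlonglongrightarrow> ip {0..B} h (sol c l)"
proof -
  have eq: "ip {0..B} h (sol c v) = (\<Sum>i<m. cnj (v i) * ip {0..B} h (fundamental c i))" for v
    unfolding sol_def by (rule ip_lcomb_right) (auto intro: sq_int_fundamental assms)
  show ?thesis unfolding eq by (intro tendsto_intros assms(1)) auto
qed

lemma sqn_sol_tendsto:
  fixes v :: "nat \<Rightarrow> nat \<Rightarrow> complex"
  assumes "\<And>i. i < m \<Longrightarrow> (\<lambda>n. v n i) \<longlonglongrightarrow> l i"
  shows "(\<lambda>n. sqn {0..B} (sol c (v n))) \<longlonglongrightarrow> sqn {0..B} (sol c l)"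
proof -
  have sq: "sq_int {0..B} (sol c v)" for v by (rule sq_int_solution[OF solution_sol]) simp
  have eq: "ip {0..B} (sol c v) (sol c v) =
      (\<Sum>i<m. v i * (\<Sum>j<m. cnj (v j) * ip {0..B} (fundamental c i) (fundamental c j)))" for v
  proof -
    have "ip {0..B} (sol c v) (sol c v) = (\<Sum>i<m. v i * ip {0..B} (fundamental c i) (sol c v))"
      by (subst (1) sol_def, rule ip_lcomb_left) (auto intro: sq_int_fundamental sq)
    moreover have "ip {0..B} (fundamental c i) (sol c v) = (\<Sum>j<m. cnj (v j) * ip {0..B} (fundamental c i) (fundamental c j))" for i
      unfolding sol_def by (rule ip_lcomb_right) (auto intro: sq_int_fundamental)
    ultimately show ?thesis by simp
  qed
  have "(\<lambda>n. ip {0..B} (sol c (v n)) (sol c (v n))) \<longlonglongrightarrow> ip {0..B} (sol c l) (sol c l)"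
    unfolding eq by (intro tendsto_intros assms) auto
  then have "(\<lambda>n. complex_of_real (sqn {0..B} (sol c (v n)))) \<longlonglongrightarrow> complex_of_real (sqn {0..B} (sol c l))"
    by (simp only: ip_self[OF sq])
  then show ?thesis by (simp only: tendsto_of_real_iff)
qed

text \<open>In von Neumann's decomposition \<open>f = f\<^sub>0 + e\<^sub>+ + e\<^sub>-\<close>, with \<open>f\<^sub>0\<close> in the domain of \<open>T\<^sub>m\<^sub>i\<^sub>n\<close>, \<open>e\<^sub>+\<close> in \<open>E c\<close> and
  \<open>e\<^sub>-\<close> in \<open>E (- c)\<close>, the form is \<open>2 \<parallel>e\<^sub>+\<parallel>\<^sup>2 - 2 \<parallel>e\<^sub>-\<parallel>\<^sup>2\<close>, and the hypothesis says that \<open>e\<^sub>+ = 0\<close>. The proof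
  imitates this on \<open>[0, b]\<close>. There \<open>f\<close> has the boundary values of some \<open>u + y\<close> with \<open>M u = c u\<close> and
  \<open>M y = - c y\<close>, and Green's formula gives, with norms and inner products on \<open>[0, b]\<close>,
  \<open>- c ([f f](b) - [f f](0)) = 2 \<parallel>u\<parallel>\<^sup>2 - 2 \<parallel>y\<parallel>\<^sup>2\<close> and \<open>2 c \<parallel>u\<parallel>\<^sup>2 = \<langle>F, u\<rangle>\<close> for \<open>F = c f + M f\<close>. So \<open>\<parallel>u\<parallel>\<close> is
  bounded by \<open>\<parallel>F\<parallel>\<close>, the coefficients of \<open>u\<close> are bounded, and along a sequence of endpoints \<open>u\<close> converges,
  uniformly on compact intervals, to a square integrable solution \<open>U\<close>. Since \<open>F\<close> is orthogonal to \<open>U\<close>,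
  \<open>\<langle>F, u\<rangle>\<close> tends to \<open>0\<close>, and so does \<open>\<parallel>u\<parallel>\<^sup>2\<close>; hence the limit of the form cannot be positive.\<close>

lemma boundary_form_nonpos:
  assumes c: "c = \<i> \<or> c = -\<i>" and f: "f \<in> DD"
    and orth: "\<And>v. v \<in> E c \<Longrightarrow> ip {0..} (\<lambda>x. c * f x + M f x) v = 0"
  shows "Re (- c * (green_form_inf k s q f f - GF f f 0)) \<le> 0"
proof (rule ccontr)
  assume pos: "\<not> Re (- c * (green_form_inf k s q f f - GF f f 0)) \<le> 0"
  define \<delta> where "\<delta> = Re (- c * (green_form_inf k s q f f - GF f f 0))"
  have \<delta>: "\<delta> > 0" using pos by (simp only: \<delta>_def not_le)
  define F where "F = (\<lambda>x. c * f x + M f x)"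
  have lf: "loc_dom f" by (rule Delta_loc[OF f])
  have FL: "sq_int {0..} F" unfolding F_def using f by (intro sq_int_lin) (auto simp: Delta_iff)
  have Fsub: "sq_int {a..b} F" if "0 \<le> a" for a b by (rule sq_int_subset[OF FL]) (use that in auto)
  have fs: "sq_int {0..b} f" "sq_int {0..b} (M f)" for b using Delta_sq[OF f, of "{0..b}"] by auto
  have cc: "cnj c = - c" "norm c = 1" "c * c = -1" "c \<noteq> 0" "c - cnj c = 2 * c" "- c - cnj c = 0" "c - cnj (- c) = 0" "- c - cnj (- c) = - 2 * c"
    using c by auto
  define T where "T = sqn {0..} F"
  have T0: "T \<ge> 0" by (simp add: T_def sqn_nonneg)
  \<comment> \<open>The shift makes \<open>[0, 2]\<close>, the interval of
      \<open>coefficient_bound\<close>, part of every \<open>[0, b n]\<close>.\<close>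
  define b where "b n = real n + 2" for n :: nat
  have b: "0 < b n" "0 \<le> b n" "2 \<le> b n" for n by (auto simp: b_def)
  define P where "P n v w \<longleftrightarrow> (\<forall>j<m. D j (\<lambda>x. 1 * sol c v x + sol (-c) w x) 0 = D j f 0) \<and>
      (\<forall>j<m. D j (\<lambda>x. 1 * sol c v x + sol (-c) w x) (b n) = D j f (b n))" for n v w
  have "\<exists>v w. P n v w" for n
  proof -
    obtain v w where "\<And>j. j < m \<Longrightarrow> D j (\<lambda>x. 1 * sol c v x + sol (-c) w x) 0 = D j f 0"
      "\<And>j. j < m \<Longrightarrow> D j (\<lambda>x. 1 * sol c v x + sol (-c) w x) (b n) = D j f (b n)"
      using boundary_values[OF c b(1)[of n], of "\<lambda>j. D j f 0" "\<lambda>j. D j f (b n)"] by blast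
    then have "P n v w" by (simp only: P_def) blast
    then show ?thesis by blast
  qed
  then obtain v w where "\<And>n. P n (v n) (w n)" by metis
  then have vw: "D j (\<lambda>x. 1 * sol c (v n) x + sol (-c) (w n) x) 0 = D j f 0"
      "D j (\<lambda>x. 1 * sol c (v n) x + sol (-c) (w n) x) (b n) = D j f (b n)" if "j < m" for n j
    using that unfolding P_def by blast+
  define u where "u n = sol c (v n)" for n
  define y where "y n = sol (-c) (w n)" for n
  define g where "g n = (\<lambda>x. 1 * u n x + y n x)" for n
  have su: "solution c (u n)" and sy: "solution (-c) (y n)" for n by (auto simp: u_def y_def solution_sol)
  have lu: "loc_dom (u n)" "loc_dom (y n)" for n using su sy solution_loc_dom by blast+
  have lg: "loc_dom (g n)" for n unfolding g_def by (rule loc_dom_lin[OF lu])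
  have gd: "D j (g n) 0 = D j f 0" "D j (g n) (b n) = D j f (b n)" if "j < m" for n j
    using vw[OF that] unfolding g_def u_def y_def by auto
  have uq: "sq_int {0..B} (u n)" "sq_int {0..B} (y n)" for n B using sq_int_solution su sy by blast+
  define t where "t n = sqn {0..b n} (u n)" for n
  have t0: "t n \<ge> 0" for n by (simp add: t_def sqn_nonneg)
  have energy: "Re (- c * (GF f f (b n) - GF f f 0)) \<le> 2 * t n" for n
  proof -
    have "GF f f (b n) = GF (g n) (g n) (b n)" "GF f f 0 = GF (g n) (g n) 0"
      using gd lf lg b by (auto intro!: GF_data)
    moreover have "GF (g n) (g n) x = GF (u n) (u n) x + GF (u n) (y n) x + GF (y n) (u n) x + GF (y n) (y n) x" if "0 \<le> x" for x
    proof -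
      have "GF (g n) (g n) x = GF (u n) (g n) x + GF (y n) (g n) x"
        using GF_lin[OF lu lg that, of 1] by (simp add: g_def)
      moreover have "GF (u n) (g n) x = GF (u n) (u n) x + GF (u n) (y n) x" "GF (y n) (g n) x = GF (y n) (u n) x + GF (y n) (y n) x"
        using GF_lin_right[OF lu _ that, of _ 1] lu by (simp_all add: g_def)
      ultimately show ?thesis by simp
    qed
    ultimately have "GF f f (b n) - GF f f 0 = (GF (u n) (u n) (b n) - GF (u n) (u n) 0) + (GF (u n) (y n) (b n) - GF (u n) (y n) 0)
       + (GF (y n) (u n) (b n) - GF (y n) (u n) 0) + (GF (y n) (y n) (b n) - GF (y n) (y n) 0)"
      using b by simp
    also have "\<dots> = 2 * c * of_real (t n) - 2 * c * of_real (sqn {0..b n} (y n))"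
      using green_solutions[OF su su b(2)] green_solutions[OF su sy b(2)] green_solutions[OF sy su b(2)] green_solutions[OF sy sy b(2)]
      unfolding cc by (simp add: ip_self[OF uq(1)] ip_self[OF uq(2)] t_def)
    finally have "- c * (GF f f (b n) - GF f f 0) = - c * (2 * c * of_real (t n) - 2 * c * of_real (sqn {0..b n} (y n)))"
      by (simp only:)
    also have "\<dots> = - (c * c) * (2 * of_real (t n) - 2 * of_real (sqn {0..b n} (y n)))" by (simp add: algebra_simps)
    finally have "Re (- c * (GF f f (b n) - GF f f 0)) = 2 * t n - 2 * sqn {0..b n} (y n)" unfolding cc by simp
    then show ?thesis using sqn_nonneg[of "{0..b n}" "y n"] by linarith
  qed
  have proj: "2 * c * ip {0..b n} (u n) (u n) = ip {0..b n} F (u n)" for n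
  proof -
    have "GF f (u n) (b n) = GF (g n) (u n) (b n)" "GF f (u n) 0 = GF (g n) (u n) 0"
      using gd lf lg lu b by (auto intro!: GF_data)
    moreover have "GF (g n) (u n) x = GF (u n) (u n) x + GF (y n) (u n) x" if "0 \<le> x" for x
      using GF_lin[OF lu lu(1) that, of 1] by (simp add: g_def)
    ultimately have "GF f (u n) (b n) - GF f (u n) 0 =
       (GF (u n) (u n) (b n) - GF (u n) (u n) 0) + (GF (y n) (u n) (b n) - GF (y n) (u n) 0)" using b by simp
    also have "\<dots> = 2 * c * ip {0..b n} (u n) (u n)"
      unfolding green_solutions[OF su su b(2)] green_solutions[OF sy su b(2)] cc by simp
    finally have "2 * c * ip {0..b n} (u n) (u n) = ip {0..b n} (M f) (u n) + c * ip {0..b n} f (u n)"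
      using green_solution_right[OF lf fs(2) su b(2)] unfolding cc by simp
    also have "\<dots> = ip {0..b n} F (u n)"
      unfolding F_def using ip_lin_left[OF fs uq(1)] by simp
    finally show ?thesis .
  qed
  have tF: "2 * t n = norm (ip {0..b n} F (u n))" for n
    unfolding proj[symmetric] ip_self[OF uq(1)] t_def[symmetric] norm_mult using t0[of n] cc by simp
  have FT: "sqn {a..b} F \<le> T" if "0 \<le> a" for a b
    unfolding T_def by (rule sqn_mono[OF FL]) (use that in auto)
  have tT: "t n \<le> T" for n
  proof -
    have "norm (ip {0..b n} F (u n)) \<le> sqn {0..b n} F / (2*1) + 1 * sqn {0..b n} (u n) / 2"
      by (rule ip_bound[OF Fsub uq(1)]) auto
    then have "2 * t n \<le> sqn {0..b n} F / (2*1) + 1 * t n / 2" using tF[of n] by (simp add: t_def)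
    then show ?thesis using FT[of 0 "b n"] t0[of n] T0 by simp
  qed
  have uT: "sqn {0..B} (u n) \<le> T" if "B \<le> b n" for n B
  proof -
    have "sqn {0..B} (u n) \<le> t n" unfolding t_def by (rule sqn_mono[OF uq(1)]) (use that in auto)
    then show ?thesis using tT[of n] by linarith
  qed
  obtain C where C: "\<And>v j. j < m \<Longrightarrow> norm (v j) \<le> C + (1 + norm c) * sqn {0..2} (sol c v)"
    using coefficient_bound by blast
  have "bounded (range (\<lambda>n. v n j))" if "j < m" for j
  proof (rule boundedI)
    fix z assume "z \<in> range (\<lambda>n. v n j)"
    then obtain n where n: "z = v n j" by blast
    have "norm (v n j) \<le> C + (1 + norm c) * sqn {0..2} (u n)" using C[OF that, of "v n"] by (simp add: u_def)
    also have "\<dots> \<le> C + (1 + norm c) * T" by (intro add_left_mono mult_left_mono uT b) auto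
    finally show "norm z \<le> C + (1 + norm c) * T" using n by simp
  qed
  then obtain r l where r: "strict_mono r" and l: "\<And>j. j < m \<Longrightarrow> (\<lambda>n. v (r n) j) \<longlonglongrightarrow> l j"
    using bounded_coordinates_subsequence[of m v] by blast
  define U where "U = sol c l"
  have br: "B \<le> b (r n)" if "B \<le> real n" for n B
    using seq_suble[OF r, of n] that by (simp add: b_def)
  have "sqn {0..B} U \<le> T" for B
  proof (rule LIMSEQ_le_const2)
    show "(\<lambda>n. sqn {0..B} (u (r n))) \<longlonglongrightarrow> sqn {0..B} U" unfolding u_def U_def by (rule sqn_sol_tendsto[OF l])
    obtain n0 where "B \<le> real n0" using real_arch_simple by blast
    then show "\<exists>N. \<forall>n\<ge>N. sqn {0..B} (u (r n)) \<le> T" by (intro exI[of _ n0]) (auto intro!: uT br)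
  qed
  then have UL: "sq_int {0..} U"
    unfolding U_def by (intro sq_int_of_bounded solution_continuous[OF solution_sol]) auto
  have "U \<in> E c" using UL unfolding U_def by (intro solution_defect[OF solution_sol])
  then have FU: "ip {0..} F U = 0" using orth by (simp add: F_def)
  have "((\<lambda>x. GF f f x) \<longlongrightarrow> green_form_inf k s q f f) at_top" by (rule green_limit(1)[OF f f])
  moreover have "filterlim b at_top sequentially"
    unfolding b_def by (rule filterlim_at_top_mono[OF filterlim_real_sequentially]) auto
  ultimately have "(\<lambda>n. GF f f (b n)) \<longlonglongrightarrow> green_form_inf k s q f f" by (rule filterlim_compose)
  then have "(\<lambda>n. Re (- c * (GF f f (b n) - GF f f 0))) \<longlonglongrightarrow> \<delta>"
    unfolding \<delta>_def by (intro tendsto_intros)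
  then have ev1: "\<forall>\<^sub>F n in sequentially. \<delta> / 2 < Re (- c * (GF f f (b n) - GF f f 0))"
    by (rule order_tendstoD) (use \<delta> in auto)
  \<comment> \<open>The weight \<open>\<eta>\<close> is so small that the tail of \<open>u\<close>
      contributes at most \<open>\<delta>/8\<close>, the point \<open>B\<close> so large
      that the tail of \<open>F\<close> does; \<open>[0, B]\<close> contributes less
      than \<open>\<delta>/8\<close>, but the total exceeds \<open>\<delta>/2\<close>.\<close>
  define \<eta> where "\<eta> = \<delta> / (4 * (T + 1))"
  have \<eta>: "\<eta> > 0" "\<eta> * T / 2 \<le> \<delta> / 8" using \<delta> T0 by (auto simp: \<eta>_def field_simps)
  have "((\<lambda>B. Re (ip {0..B} F F)) \<longlongrightarrow> Re (ip {0..} F F)) at_top"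
    by (intro tendsto_intros ip_half_line_tendsto FL)
  then have "((\<lambda>B. sqn {0..B} F) \<longlongrightarrow> T) at_top"
    unfolding ip_self[OF FL] ip_self[OF Fsub[OF order.refl]] T_def by simp
  then have ev2: "\<forall>\<^sub>F B in at_top. T - \<eta> * \<delta> / 4 < sqn {0..B} F"
    by (rule order_tendstoD) (use \<delta> \<eta> in auto)
  have "((\<lambda>B. norm (ip {0..B} F U)) \<longlongrightarrow> norm (ip {0..} F U)) at_top"
    by (intro tendsto_intros ip_half_line_tendsto FL UL)
  then have ev3: "\<forall>\<^sub>F B in at_top. norm (ip {0..B} F U) < \<delta> / 8"
    by (rule order_tendstoD) (use \<delta> FU in auto)
  have "\<forall>\<^sub>F B in at_top. 0 \<le> B \<and> T - \<eta> * \<delta> / 4 < sqn {0..B} F \<and> norm (ip {0..B} F U) < \<delta> / 8"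
    using eventually_conj[OF eventually_ge_at_top[of 0] eventually_conj[OF ev2 ev3]] by simp
  then obtain B where B: "0 \<le> B" "T - \<eta> * \<delta> / 4 < sqn {0..B} F" "norm (ip {0..B} F U) < \<delta> / 8"
    using eventually_happens'[OF trivial_limit_at_top_linorder] by blast
  have "(\<lambda>n. norm (ip {0..B} F (u (r n)))) \<longlonglongrightarrow> norm (ip {0..B} F U)"
    unfolding u_def U_def by (intro tendsto_norm ip_sol_tendsto l Fsub) auto
  then have "\<forall>\<^sub>F n in sequentially. norm (ip {0..B} F (u (r n))) < \<delta> / 8"
    by (rule order_tendstoD) (use B in auto)
  moreover have "\<forall>\<^sub>F n in sequentially. \<delta> / 2 < Re (- c * (GF f f (b (r n)) - GF f f 0))"
    using ev1 eventually_subseq[OF r] by blast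
  moreover obtain n0 where "B \<le> real n0" using real_arch_simple by blast
  then have "\<forall>\<^sub>F n in sequentially. B \<le> b (r n)"
    by (intro eventually_sequentiallyI[of n0] br) auto
  ultimately have "\<forall>\<^sub>F n in sequentially. False"
  proof eventually_elim
    case (elim n)
    let ?b = "b (r n)" and ?u = "u (r n)"
    have "\<delta> / 2 < 2 * t (r n)" using elim(2) energy[of "r n"] by linarith
    also have "2 * t (r n) = norm (ip {0..?b} F ?u)" by (rule tF)
    also have "\<dots> \<le> norm (ip {0..B} F ?u) + norm (ip {B..?b} F ?u)"
      unfolding ip_combine[OF Fsub[OF order.refl] uq(1) B(1) elim(3)] by (rule norm_triangle_ineq)
    also have "norm (ip {B..?b} F ?u) \<le> sqn {B..?b} F / (2 * \<eta>) + \<eta> * sqn {B..?b} ?u / 2"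
      using B(1) by (intro ip_bound Fsub sq_int_solution[OF su] \<eta>) auto
    also have "sqn {B..?b} F / (2 * \<eta>) \<le> \<delta> / 8"
    proof -
      have "sqn {B..?b} F \<le> \<eta> * \<delta> / 4"
        using sqn_combine[OF Fsub[OF order.refl] B(1) elim(3)] FT[of 0 ?b] B(2) by simp
      then show ?thesis using \<eta>(1) by (simp add: field_simps)
    qed
    also have "\<eta> * sqn {B..?b} ?u / 2 \<le> \<delta> / 8"
    proof -
      have "sqn {B..?b} ?u \<le> t (r n)" unfolding t_def by (rule sqn_mono[OF uq(1)]) (use B in auto)
      then have "\<eta> * sqn {B..?b} ?u / 2 \<le> \<eta> * T / 2" using tT[of "r n"] \<eta>(1) by simp
      then show ?thesis using \<eta>(2) by linarith
    qed
    finally show False using elim(1) \<delta> by simp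
  qed
  then show False by simp
qed

end

section \<open>Inertia of the boundary forms\<close>

lemma sum_scaled_functions_eq_lcomb:
  "finite S \<Longrightarrow> (\<Sum>v\<in>S. (\<lambda>x. u v * v x)) = lcomb S u (\<lambda>v. v)"
  by (induction S rule: finite_induct) (auto simp: lcomb_def fun_eq_iff)

text \<open>Independent sets have at most \<open>m\<close> elements by \<open>dep\<close>, so the dimension is that of a finite basis.\<close>

lemma dim_basis:
  assumes V: "(\<lambda>_. 0) \<in> V" "\<And>a f g. f \<in> V \<Longrightarrow> g \<in> V \<Longrightarrow> (\<lambda>x. a * f x + g x) \<in> V"
    and dep: "\<And>S. finite S \<Longrightarrow> S \<subseteq> V \<Longrightarrow> m < card S \<Longrightarrow> \<exists>x. (\<exists>v\<in>S. x v \<noteq> 0) \<and> lcomb S x (\<lambda>v. v) = (\<lambda>_. 0)"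
  obtains B where "finite B" "B \<subseteq> V" "card B = cfun.dim V" "card B \<le> m"
    "\<And>x. lcomb B x (\<lambda>v. v) = (\<lambda>_. 0) \<Longrightarrow> (\<forall>v\<in>B. x v = 0)"
    "\<And>f. f \<in> V \<Longrightarrow> \<exists>x. f = lcomb B x (\<lambda>v. v)"
proof -
  obtain B where B: "B \<subseteq> V" "cfun.independent B" "V \<subseteq> cfun.span B" "card B = cfun.dim V"
    using cfun.basis_exists[of V] by blast
  have indep: "\<forall>v\<in>S. x v = 0" if "finite S" "S \<subseteq> B" "lcomb S x (\<lambda>v. v) = (\<lambda>_. 0)" for S x
  proof (rule ccontr)
    assume "\<not> (\<forall>v\<in>S. x v = 0)"
    moreover have "(\<Sum>v\<in>S. (\<lambda>t. x v * v t)) = 0"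
      using that sum_scaled_functions_eq_lcomb[of S x] by (simp add: zero_fun_def)
    ultimately have "cfun.dependent B" unfolding cfun.dependent_explicit using that by blast
    then show False using B(2) by simp
  qed
  have small: "card S \<le> m" if "finite S" "S \<subseteq> B" for S
  proof (rule ccontr)
    assume "\<not> card S \<le> m"
    then have "\<exists>x. (\<exists>v\<in>S. x v \<noteq> 0) \<and> lcomb S x (\<lambda>v. v) = (\<lambda>_. 0)"
      by (intro dep) (use that B(1) in auto)
    then show False using indep[OF that] by blast
  qed
  have fin: "finite B"
  proof (rule ccontr)
    assume "infinite B"
    then obtain S where "finite S" "card S = Suc m" "S \<subseteq> B" using infinite_arbitrarily_large by blast
    then show False using small by fastforce
  qed
  have span: "\<exists>x. f = lcomb B x (\<lambda>v. v)" if "f \<in> V" for f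
  proof -
    have "f \<in> range (\<lambda>u. \<Sum>v\<in>B. (\<lambda>x. u v * v x))" using that B(3) cfun.span_finite[OF fin] by auto
    then show ?thesis using sum_scaled_functions_eq_lcomb[OF fin] by auto
  qed
  show ?thesis using that[OF fin B(1,4) small[OF fin order.refl] indep[OF fin order.refl] span] .
qed

context symmetric_expr
begin

text \<open>An element of \<open>E c\<close> is determined by its \<open>2 k\<close> derivatives at \<open>0\<close>.\<close>

lemma defect_dependent:
  assumes c: "c = \<i> \<or> c = -\<i>" and I: "finite I" "m < card I" and e: "\<And>i. i \<in> I \<Longrightarrow> e i \<in> E c"
  shows "\<exists>x. (\<exists>i\<in>I. x i \<noteq> 0) \<and> lcomb I x e = (\<lambda>_. 0)"
proof -
  obtain x where x: "\<exists>i\<in>I. x i \<noteq> 0" "\<forall>j\<in>{..<m}. (\<Sum>i\<in>I. D j (e i) 0 * x i) = 0"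
    using underdetermined_system[of "{..<m}" I "\<lambda>j i. D j (e i) 0"] I by auto
  have "lcomb I x e \<in> E c"
    using I(1) e by (intro lcomb_closed[where P = "\<lambda>f. f \<in> E c"] defect_zero defect_lin)
  moreover have "D j (lcomb I x e) 0 = 0" if "j < m" for j
  proof -
    have "loc_dom (e i)" if "i \<in> I" for i using e[OF that] by (simp add: defect_iff Delta_iff)
    then have "D j (lcomb I x e) 0 = (\<Sum>i\<in>I. x i * D j (e i) 0)" using I(1) that by (intro D_lcomb) auto
    then show ?thesis using x(2) that by (simp add: mult.commute)
  qed
  ultimately have "lcomb I x e = (\<lambda>_. 0)" using defect_unique[OF c] by blast
  then show ?thesis using x(1) by blast
qed

lemma defect_basis:
  assumes c: "c = \<i> \<or> c = -\<i>"
  obtains B where "finite B" "B \<subseteq> E c" "card B = cfun.dim (E c)" "card B \<le> m"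
    "\<And>x. lcomb B x (\<lambda>v. v) = (\<lambda>_. 0) \<Longrightarrow> (\<forall>v\<in>B. x v = 0)"
    "\<And>f. f \<in> E c \<Longrightarrow> \<exists>x. f = lcomb B x (\<lambda>v. v)"
proof -
  have dep: "\<exists>x. (\<exists>v\<in>S. x v \<noteq> 0) \<and> lcomb S x (\<lambda>v. v) = (\<lambda>_. 0)"
    if "finite S" "S \<subseteq> E c" "m < card S" for S
    using defect_dependent[OF c that(1,3), of "\<lambda>v. v"] that(2) by blast
  show ?thesis
  proof (rule dim_basis[OF defect_zero defect_lin dep])
    fix B
    assume "finite B" "B \<subseteq> E c" "card B = cfun.dim (E c)" "card B \<le> m"
      "\<And>x. lcomb B x (\<lambda>v. v) = (\<lambda>_. 0) \<Longrightarrow> (\<forall>v\<in>B. x v = 0)"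
      "\<And>f. f \<in> E c \<Longrightarrow> \<exists>x. f = lcomb B x (\<lambda>v. v)"
    then show thesis by (rule that)
  qed
qed

text \<open>The factor \<open>- c\<close> makes a skew-Hermitian form Hermitian if \<open>c = \<plusminus> \<i>\<close>. As \<open>c\<close> and \<open>- c\<close> give opposite
  signs, counting positive directions for both values of \<open>c\<close> determines the inertia.\<close>

definition inf_form :: "complex \<Rightarrow> (real \<Rightarrow> complex) \<Rightarrow> (real \<Rightarrow> complex) \<Rightarrow> complex" where
  "inf_form c f g = - c * green_form_inf k s q f g"

definition zero_form :: "complex \<Rightarrow> (real \<Rightarrow> complex) \<Rightarrow> (real \<Rightarrow> complex) \<Rightarrow> complex" where
  "zero_form c f g = - c * GF f g 0"

lemma green_inf_lin:
  assumes "f \<in> DD" "g \<in> DD" "h \<in> DD"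
  shows "green_form_inf k s q (\<lambda>x. a * f x + g x) h = a * green_form_inf k s q f h + green_form_inf k s q g h"
proof (rule tendsto_unique[OF trivial_limit_at_top_linorder])
  show "(GF (\<lambda>x. a * f x + g x) h \<longlongrightarrow> green_form_inf k s q (\<lambda>x. a * f x + g x) h) at_top"
    by (rule green_limit(1)[OF Delta_lin[OF assms(1,2)] assms(3)])
  have "((\<lambda>x. a * GF f h x + GF g h x) \<longlongrightarrow> a * green_form_inf k s q f h + green_form_inf k s q g h) at_top"
    using green_limit(1) assms by (intro tendsto_intros)
  moreover have "\<forall>\<^sub>F x in at_top. a * GF f h x + GF g h x = GF (\<lambda>x. a * f x + g x) h x"
    using eventually_ge_at_top[of 0] by eventually_elim (use GF_lin Delta_loc assms in simp)
  ultimately show "(GF (\<lambda>x. a * f x + g x) h \<longlongrightarrow> a * green_form_inf k s q f h + green_form_inf k s q g h) at_top"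
    by (rule Lim_transform_eventually)
qed

lemma green_inf_herm:
  assumes "f \<in> DD" "g \<in> DD"
  shows "green_form_inf k s q g f = - cnj (green_form_inf k s q f g)"
proof (rule tendsto_unique[OF trivial_limit_at_top_linorder])
  show "(GF g f \<longlongrightarrow> green_form_inf k s q g f) at_top" by (rule green_limit(1)[OF assms(2,1)])
  have "((\<lambda>x. - cnj (GF f g x)) \<longlongrightarrow> - cnj (green_form_inf k s q f g)) at_top"
    using green_limit(1)[OF assms] by (intro tendsto_intros)
  moreover have "GF g f = (\<lambda>x. - cnj (GF f g x))" using GF_herm[of g f] by blast
  ultimately show "(GF g f \<longlongrightarrow> - cnj (green_form_inf k s q f g)) at_top" by simp
qed

lemma hermitian_inf_form:
  assumes "c = \<i> \<or> c = -\<i>"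
  shows "hermitian_form DD (inf_form c)"
proof
  show "(\<lambda>_. 0) \<in> DD" by (rule Delta_zero)
  fix f g h a
  assume fg: "f \<in> DD" "g \<in> DD"
  show "(\<lambda>x. a * f x + g x) \<in> DD" by (rule Delta_lin[OF fg])
  show "inf_form c g f = cnj (inf_form c f g)"
    using green_inf_herm[OF fg] assms by (auto simp: inf_form_def)
  assume "h \<in> DD"
  then show "inf_form c (\<lambda>x. a * f x + g x) h = a * inf_form c f h + inf_form c g h"
    using green_inf_lin[OF fg] by (simp add: inf_form_def algebra_simps)
qed

lemma hermitian_zero_form:
  assumes "c = \<i> \<or> c = -\<i>"
  shows "hermitian_form DD (zero_form c)"
proof
  show "(\<lambda>_. 0) \<in> DD" by (rule Delta_zero)
  fix f g h a
  assume fg: "f \<in> DD" "g \<in> DD"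
  show "(\<lambda>x. a * f x + g x) \<in> DD" by (rule Delta_lin[OF fg])
  show "zero_form c g f = cnj (zero_form c f g)"
    using GF_herm[of g f 0] assms by (auto simp: zero_form_def)
  assume "h \<in> DD"
  then show "zero_form c (\<lambda>x. a * f x + g x) h = a * zero_form c f h + zero_form c g h"
    using GF_lin[of f g h 0 a] Delta_loc fg by (simp add: zero_form_def algebra_simps)
qed

lemma zero_form_data:
  assumes "f \<in> DD" "g \<in> DD" "f' \<in> DD" "g' \<in> DD"
    "\<And>j. j < m \<Longrightarrow> D j f 0 = D j f' 0" "\<And>j. j < m \<Longrightarrow> D j g 0 = D j g' 0"
  shows "zero_form c f g = zero_form c f' g'"
  unfolding zero_form_def using GF_data[of f g f' g' 0] Delta_loc assms by simp

text \<open>Orthogonality of \<open>c f + M f\<close> to \<open>E c\<close> amounts to \<open>dim (E c)\<close> linear equations for \<open>f\<close>. A longer family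
  has a nontrivial combination that solves them, and \<open>boundary_form_nonpos\<close> applies to it.\<close>

lemma positive_family_bound:
  assumes c: "c = \<i> \<or> c = -\<i>" and I: "finite I" and e: "\<And>i. i \<in> I \<Longrightarrow> e i \<in> DD"
    and pos: "\<And>x. \<exists>i\<in>I. x i \<noteq> 0 \<Longrightarrow> Re (inf_form c (lcomb I x e) (lcomb I x e) - zero_form c (lcomb I x e) (lcomb I x e)) > 0"
  shows "card I \<le> cfun.dim (E c)"
proof (rule ccontr)
  assume neg: "\<not> card I \<le> cfun.dim (E c)"
  obtain B where B: "finite B" "B \<subseteq> E c" "card B = cfun.dim (E c)"
    "card B \<le> m" "\<And>x. lcomb B x (\<lambda>v. v) = (\<lambda>_. 0) \<Longrightarrow> (\<forall>v\<in>B. x v = 0)"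
    "\<And>f. f \<in> E c \<Longrightarrow> \<exists>x. f = lcomb B x (\<lambda>v. v)"
    using defect_basis[OF c] by blast
  define L where "L v f = ip {0..} (\<lambda>x. c * f x + M f x) v" for v f
  have vq: "sq_int {0..} v" if "v \<in> B" for v using B(2) that by (auto simp: defect_iff Delta_iff)
  have Fq: "sq_int {0..} (\<lambda>x. c * f x + M f x)" if "f \<in> DD" for f
    using that by (intro sq_int_lin) (auto simp: Delta_iff)
  have lin: "L v (\<lambda>x. a * f x + g x) = a * L v f + L v g" if v: "v \<in> B" and f: "f \<in> DD" and g: "g \<in> DD" for v a f g
  proof -
    obtain N where N: "negligible N" "\<And>x. x \<in> {0..} - N \<Longrightarrow> M (\<lambda>t. a * f t + g t) x = a * M f x + M g x"
      using M_lin_ae[OF Delta_loc[OF f] Delta_loc[OF g]] by blast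
    have "L v (\<lambda>x. a * f x + g x) = ip {0..} (\<lambda>x. a * (c * f x + M f x) + (c * g x + M g x)) v"
      unfolding L_def ip_def
    proof (rule integral_spike[OF N(1)])
      fix x assume "x \<in> {0..} - N"
      then show "(a * (c * f x + M f x) + (c * g x + M g x)) * cnj (v x) = (c * (a * f x + g x) + M (\<lambda>x. a * f x + g x) x) * cnj (v x)"
        using N(2)[of x] by (simp add: algebra_simps)
    qed
    then show ?thesis unfolding L_def using ip_lin_left[OF Fq[OF f] Fq[OF g] vq[OF v]] by simp
  qed
  have "card B < card I" using neg B(3) by simp
  then obtain x where x: "\<exists>i\<in>I. x i \<noteq> 0" "\<forall>v\<in>B. (\<Sum>i\<in>I. L v (e i) * x i) = 0"
    using underdetermined_system[OF B(1) I, of "\<lambda>v i. L v (e i)"] by blast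
  define f where "f = lcomb I x e"
  have f: "f \<in> DD" "\<And>v. v \<in> B \<Longrightarrow> L v f = 0"
  proof -
    show "f \<in> DD" unfolding f_def using I e by (intro lcomb_closed[where P = "\<lambda>f. f \<in> DD"] Delta_zero Delta_lin)
    show "L v f = 0" if "v \<in> B" for v
    proof -
      have "L v f = (\<Sum>i\<in>I. x i * L v (e i))"
        unfolding f_def using lcomb_linear[of I e DD "L v" x] I e Delta_zero Delta_lin lin[OF that] by blast
      then show ?thesis using x(2) that by (simp add: mult.commute)
    qed
  qed
  have "ip {0..} (\<lambda>x. c * f x + M f x) v = 0" if "v \<in> E c" for v
  proof -
    obtain y where y: "v = lcomb B y (\<lambda>v. v)" using B(6)[OF \<open>v \<in> E c\<close>] by blast
    have "ip {0..} (\<lambda>x. c * f x + M f x) v = (\<Sum>w\<in>B. cnj (y w) * L w f)"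
      unfolding y L_def by (rule ip_lcomb_right[OF B(1) vq Fq[OF f(1)]]) auto
    then show ?thesis using f(2) by simp
  qed
  then have "Re (- c * (green_form_inf k s q f f - GF f f 0)) \<le> 0" by (rule boundary_form_nonpos[OF c f(1)])
  moreover have "inf_form c f f - zero_form c f f = - c * (green_form_inf k s q f f - GF f f 0)"
    by (simp add: inf_form_def zero_form_def algebra_simps)
  ultimately show False using pos[OF x(1), folded f_def] by simp
qed

text \<open>On \<open>E c\<close> the difference of the two forms is \<open>2 \<parallel>f\<parallel>\<^sup>2\<close> by Green's formula.\<close>

lemma defect_energy:
  assumes c: "c = \<i> \<or> c = -\<i>" and f: "f \<in> E c" and le: "Re (inf_form c f f - zero_form c f f) \<le> 0"
  shows "f = (\<lambda>_. 0)"
proof -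
  have fD: "f \<in> DD" using f by (simp add: defect_iff)
  have fL: "sq_int {0..} f" using fD by (simp add: Delta_iff)
  have "inf_form c f f - zero_form c f f = - c * (green_form_inf k s q f f - GF f f 0)"
    by (simp add: inf_form_def zero_form_def algebra_simps)
  also have "\<dots> = - c * ((c - cnj c) * of_real (sqn {0..} f))"
    unfolding green_limit(2)[OF fD fD] defect_ip(2,3)[OF f] ip_self[OF fL] by (simp add: algebra_simps)
  also have "\<dots> = of_real (2 * sqn {0..} f)" using c by (elim disjE) (simp_all add: complex_eq_iff)
  finally have z: "sqn {0..} f \<le> 0" using le by simp
  show ?thesis
  proof
    fix x
    show "f x = 0"
    proof (cases "x < 0")
      case True then show ?thesis using fD by (simp add: Delta_iff)
    next
      case False
      have "sqn {0..x+1} f \<le> sqn {0..} f" by (rule sqn_mono[OF fL]) auto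
      then have "sqn {0..x+1} f = 0" using z sqn_nonneg[of "{0..x+1}" f] by linarith
      then show ?thesis
        using False loc_dom_continuous[OF Delta_loc[OF fD]]
        by (intro sqn_eq_0_imp_zero[of "x+1" f]) (auto intro: continuous_on_subset)
    qed
  qed
qed

end

context symmetric_expr
begin

text \<open>The function \<open>cutoff f\<close> has the data of \<open>f\<close> at \<open>0\<close> and is invisible at infinity; \<open>f - cutoff f\<close> is
  invisible at \<open>0\<close> and agrees with \<open>f\<close> at infinity.\<close>

definition cutoff :: "(real \<Rightarrow> complex) \<Rightarrow> real \<Rightarrow> complex" where
  "cutoff f = (SOME e. e \<in> DD \<and> (\<forall>j<m. D j e 0 = D j f 0) \<and> (\<forall>x>1. e x = 0))"

lemma cutoff: "cutoff f \<in> DD" "j < m \<Longrightarrow> D j (cutoff f) 0 = D j f 0" "1 < x \<Longrightarrow> cutoff f x = 0"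
proof -
  obtain e where "e \<in> DD" "\<And>j. j < m \<Longrightarrow> D j e 0 = D j f 0" "\<And>x. 1 < x \<Longrightarrow> e x = 0"
    using cutoff_exists[of "\<lambda>j. D j f 0"] by blast
  then have "\<exists>e. e \<in> DD \<and> (\<forall>j<m. D j e 0 = D j f 0) \<and> (\<forall>x>1. e x = 0)" by blast
  from someI_ex[OF this, folded cutoff_def]
  show "cutoff f \<in> DD" "j < m \<Longrightarrow> D j (cutoff f) 0 = D j f 0" "1 < x \<Longrightarrow> cutoff f x = 0" by auto
qed

lemma inf_form_cutoff:
  assumes c: "c = \<i> \<or> c = -\<i>" and g: "g \<in> DD"
  shows "inf_form c (cutoff f) g = 0" "inf_form c g (cutoff f) = 0"
proof -
  have z: "GF (cutoff f) g x = 0" if "1 < x" for x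
  proof -
    have "D j (cutoff f) x = D j (\<lambda>_. 0) x" for j
      by (rule D_local[of "{1<..}"]) (use cutoff(3) that in auto)
    then have "GF (cutoff f) g x = GF (\<lambda>_. 0) g x"
      using that cutoff(1) g by (intro GF_data Delta_loc loc_dom_zero) auto
    then show ?thesis using GF_zero[OF Delta_loc[OF g], of x] that by simp
  qed
  have "\<forall>\<^sub>F x in at_top. GF (cutoff f) g x = 0"
    by (rule eventually_mono[OF eventually_gt_at_top[of 1]]) (rule z)
  then have "(GF (cutoff f) g \<longlongrightarrow> 0) at_top" by (rule tendsto_eventually)
  then have "green_form_inf k s q (cutoff f) g = 0"
    using green_limit(1)[OF cutoff(1) g] tendsto_unique[OF trivial_limit_at_top_linorder] by blast
  then show 1: "inf_form c (cutoff f) g = 0" by (simp add: inf_form_def)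
  interpret H: hermitian_form DD "inf_form c" by (rule hermitian_inf_form[OF c])
  show "inf_form c g (cutoff f) = 0" using H.form_herm[OF cutoff(1) g] 1 by simp
qed

text \<open>The surviving products have orders \<open>j, l \<ge> k\<close>, and their coefficients are \<open>0\<close> as \<open>j + l \<ge> 2 k\<close>.\<close>

lemma zero_form_isotropic:
  assumes f: "f \<in> DD" and z: "\<And>j. j < k \<Longrightarrow> D j f 0 = 0"
  shows "zero_form c f f = 0"
proof -
  obtain B where "\<And>j l. AC_loc (B j l)" and B0: "\<And>j l x. m \<le> j + l \<Longrightarrow> B j l x = 0"
    and "\<And>j x. j < m \<Longrightarrow> 0 \<le> x \<Longrightarrow> s k x \<noteq> 0 \<Longrightarrow> B j (m-1-j) x \<noteq> 0"
    and B: "\<And>f g x. 0 \<le> x \<Longrightarrow> smooth m f \<Longrightarrow> smooth m g \<Longrightarrow> GF f g x = bil m B f g x"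
    using green_form_rep[OF k_pos s_smooth q_smooth] by blast
  have t: "B j l 0 * D j f 0 * cnj (D l f 0) = 0" for j l
    using z[of j] z[of l] B0[of j l 0] by (cases "j < k"; cases "l < k") auto
  have "bil m B f f 0 = 0" unfolding bil_def by (simp only: t sum.neutral_const)
  then show ?thesis using B[of 0 f f] Delta_loc[OF f] by (simp add: zero_form_def loc_dom_def)
qed

lemma zero_form_nondegenerate:
  assumes c: "c \<noteq> 0" and f: "f \<in> DD" and z: "\<And>g. g \<in> DD \<Longrightarrow> zero_form c f g = 0" and j: "j < m"
  shows "D j f 0 = 0"
proof (rule GF_nondegenerate[OF Delta_loc[OF f] order.refl _ _ _ j])
  fix l assume "l < m"
  show "loc_dom (cutoff (fundamental 0 l))" by (rule Delta_loc[OF cutoff(1)])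
  show "GF f (cutoff (fundamental 0 l)) 0 = 0" using z[OF cutoff(1)] c by (simp add: zero_form_def)
next
  fix l i assume "l < m" "i < m"
  then show "D i (cutoff (fundamental 0 l)) 0 = (if i = l then 1 else 0)" using cutoff(2) fundamental(2) by simp
qed

lemma zero_form_minus: "zero_form (-c) f g = - zero_form c f g"
  by (simp add: zero_form_def)

lemma D_lcomb_Delta:
  assumes "finite I" "\<And>i. i \<in> I \<Longrightarrow> e i \<in> DD" "j < m"
  shows "D j (lcomb I x e) 0 = (\<Sum>i\<in>I. x i * D j (e i) 0)"
  using assms Delta_loc by (intro D_lcomb) auto

lemma lcomb_Delta: "finite I \<Longrightarrow> (\<And>i. i \<in> I \<Longrightarrow> e i \<in> DD) \<Longrightarrow> lcomb I x e \<in> DD"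
  by (rule lcomb_closed[where P = "\<lambda>f. f \<in> DD"]) (auto intro: Delta_zero Delta_lin)

text \<open>More than \<open>2 k\<close> functions have a nontrivial combination with zero data at \<open>0\<close>. More than \<open>k\<close> positive
  ones have a nontrivial combination whose derivatives of order below \<open>k\<close> vanish at \<open>0\<close>: it is isotropic,
  but the form is positive on it.\<close>

lemma zero_form_orth_bound:
  assumes c: "c = \<i> \<or> c = -\<i>" and h: "hermitian_form.orth_family DD (zero_form c) N h"
  shows "N \<le> m" "card {l. l < N \<and> Re (zero_form c (h l) (h l)) > 0} \<le> k"
proof -
  interpret Z: hermitian_form DD "zero_form c" by (rule hermitian_zero_form[OF c])
  have hD: "h i \<in> DD" if "i < N" for i using h that by (auto simp: Z.orth_family_def)
  show "N \<le> m"
  proof (rule ccontr)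
    assume "\<not> N \<le> m"
    then obtain x where x: "\<exists>i\<in>{..<N}. x i \<noteq> 0" "\<forall>j\<in>{..<m}. (\<Sum>i\<in>{..<N}. D j (h i) 0 * x i) = 0"
      using underdetermined_system[of "{..<m}" "{..<N}" "\<lambda>j i. D j (h i) 0"] by auto
    let ?f = "lcomb {..<N} x h"
    have f: "?f \<in> DD" by (rule lcomb_Delta) (use hD in auto)
    have fd: "D j ?f 0 = 0" if "j < m" for j
      using D_lcomb_Delta[of "{..<N}" h j x] hD x(2) that by (simp add: mult.commute)
    have "zero_form c ?f (h j) = 0" if "j < N" for j
    proof -
      have "zero_form c ?f (h j) = zero_form c (\<lambda>_. 0) (h j)"
        using fd by (intro zero_form_data f hD that Delta_zero) (auto simp: D_zero)
      then show ?thesis using Z.form_zero[OF hD[OF that]] by simp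
    qed
    then have "x j = 0" if "j < N" for j using Z.orth_family_independent[OF h f _ that] by blast
    then show False using x(1) by auto
  qed
  show "card {l. l < N \<and> Re (zero_form c (h l) (h l)) > 0} \<le> k"
  proof (rule ccontr)
    let ?P = "{l. l < N \<and> Re (zero_form c (h l) (h l)) > 0}"
    assume "\<not> card ?P \<le> k"
    then obtain x where x: "\<exists>i\<in>?P. x i \<noteq> 0" "\<forall>j\<in>{..<k}. (\<Sum>i\<in>?P. D j (h i) 0 * x i) = 0"
      using underdetermined_system[of "{..<k}" ?P "\<lambda>j i. D j (h i) 0"] by auto
    let ?f = "lcomb ?P x h"
    have f: "?f \<in> DD" by (rule lcomb_Delta) (use hD in auto)
    have "D j ?f 0 = 0" if "j < k" for j
    proof -
      have "D j ?f 0 = (\<Sum>i\<in>?P. x i * D j (h i) 0)" using that hD by (intro D_lcomb_Delta) auto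
      then show ?thesis using x(2) that by (simp add: mult.commute)
    qed
    then have "zero_form c ?f ?f = 0" by (rule zero_form_isotropic[OF f])
    moreover have "zero_form c ?f ?f = (\<Sum>i\<in>?P. of_real ((cmod (x i))\<^sup>2) * zero_form c (h i) (h i))"
      by (rule Z.form_lcomb_orth[OF h]) auto
    ultimately have "Re (\<Sum>i\<in>?P. of_real ((cmod (x i))\<^sup>2) * zero_form c (h i) (h i)) = 0" by simp
    then have "(\<Sum>i\<in>?P. (cmod (x i))\<^sup>2 * Re (zero_form c (h i) (h i))) = 0" by (simp add: Re_sum)
    moreover have "(\<Sum>i\<in>?P. (cmod (x i))\<^sup>2 * Re (zero_form c (h i) (h i))) > 0"
    proof -
      obtain i where "i \<in> ?P" "x i \<noteq> 0" using x(1) by blast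
      then show ?thesis by (intro sum_pos2[of ?P i]) auto
    qed
    ultimately show False by simp
  qed
qed

lemma orth_family_minus:
  assumes "c = \<i> \<or> c = -\<i>"
  shows "hermitian_form.orth_family DD (zero_form (-c)) N h \<longleftrightarrow> hermitian_form.orth_family DD (zero_form c) N h"
    "hermitian_form.orth_family DD (inf_form (-c)) N h \<longleftrightarrow> hermitian_form.orth_family DD (inf_form c) N h"
proof -
  have c': "-c = \<i> \<or> -c = -\<i>" using assms by auto
  show "hermitian_form.orth_family DD (zero_form (-c)) N h \<longleftrightarrow> hermitian_form.orth_family DD (zero_form c) N h"
    unfolding hermitian_form.orth_family_def[OF hermitian_zero_form[OF assms]] hermitian_form.orth_family_def[OF hermitian_zero_form[OF c']]
    by (simp add: zero_form_def)
  show "hermitian_form.orth_family DD (inf_form (-c)) N h \<longleftrightarrow> hermitian_form.orth_family DD (inf_form c) N h"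
    unfolding hermitian_form.orth_family_def[OF hermitian_inf_form[OF assms]] hermitian_form.orth_family_def[OF hermitian_inf_form[OF c']]
    by (simp add: inf_form_def)
qed

text \<open>By nondegeneracy a maximal family has \<open>2 k\<close> members, and at most \<open>k\<close> have either sign; so \<open>k\<close> have each.
  The negative members are counted because the form at \<open>0\<close> is subtracted from the one at infinity.\<close>

lemma zero_form_inertia:
  assumes c: "c = \<i> \<or> c = -\<i>"
  obtains h where "hermitian_form.orth_family DD (zero_form c) m h"
    "\<And>f g. f \<in> DD \<Longrightarrow> g \<in> DD \<Longrightarrow> zero_form c f g = (\<Sum>l<m. zero_form c f (h l) * zero_form c (h l) g / zero_form c (h l) (h l))"
    "card {l. l < m \<and> Re (zero_form (-c) (h l) (h l)) > 0} = k"
proof -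
  have c0: "c \<noteq> 0" and c': "-c = \<i> \<or> -c = -\<i>" using c by auto
  interpret Z: hermitian_form DD "zero_form c" by (rule hermitian_zero_form[OF c])
  obtain N h where h: "Z.orth_family N h"
    and rep: "\<And>f g. f \<in> DD \<Longrightarrow> g \<in> DD \<Longrightarrow> zero_form c f g = (\<Sum>l<N. zero_form c f (h l) * zero_form c (h l) g / zero_form c (h l) (h l))"
    using Z.maximal_orth_family[of m] zero_form_orth_bound(1)[OF c] by blast
  have hD: "h i \<in> DD" "zero_form c (h i) (h i) \<noteq> 0" if "i < N" for i using h that by (auto simp: Z.orth_family_def)
  have "m \<le> N"
  proof (rule ccontr)
    assume "\<not> m \<le> N"
    define e where "e i = cutoff (fundamental 0 i)" for i
    have e: "e i \<in> DD" for i unfolding e_def by (rule cutoff(1))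
    obtain x where x: "\<exists>i\<in>{..<m}. x i \<noteq> 0" "\<forall>l\<in>{..<N}. (\<Sum>i\<in>{..<m}. zero_form c (e i) (h l) * x i) = 0"
      using underdetermined_system[of "{..<N}" "{..<m}" "\<lambda>l i. zero_form c (e i) (h l)"] \<open>\<not> m \<le> N\<close> by auto
    let ?f = "lcomb {..<m} x e"
    have f: "?f \<in> DD" by (rule lcomb_Delta) (use e in auto)
    have "zero_form c ?f (h l) = 0" if "l < N" for l
      using Z.form_lcomb[of "{..<m}" e "h l" x] e hD(1)[OF that] x(2) that by (simp add: mult.commute)
    then have "zero_form c ?f g = 0" if "g \<in> DD" for g using rep[OF f that] by simp
    then have "D j ?f 0 = 0" if "j < m" for j using zero_form_nondegenerate[OF c0 f _ that] by blast
    moreover have "D j ?f 0 = x j" if "j < m" for j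
    proof -
      have "D j ?f 0 = (\<Sum>i<m. x i * D j (e i) 0)" using e that by (intro D_lcomb_Delta) auto
      also have "\<dots> = (\<Sum>i<m. if j = i then x i else 0)"
        using that by (intro sum.cong refl) (simp add: e_def cutoff(2) fundamental(2))
      finally show ?thesis using that by simp
    qed
    ultimately show False using x(1) by auto
  qed
  then have N: "N = m" using zero_form_orth_bound(1)[OF c h] by simp
  let ?P = "{l. l < m \<and> Re (zero_form c (h l) (h l)) > 0}" and ?Q = "{l. l < m \<and> Re (zero_form (-c) (h l) (h l)) > 0}"
  have "card ?P \<le> k" using zero_form_orth_bound(2)[OF c h] N by simp
  moreover have "card ?Q \<le> k" using zero_form_orth_bound(2)[OF c', of N h] orth_family_minus(1)[OF c] h N by simp
  moreover have "card {..<m} \<le> card ?P + card ?Q"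
  proof -
    have "l \<in> ?P \<union> ?Q" if "l < m" for l
    proof -
      have "Re (zero_form c (h l) (h l)) \<noteq> 0"
        using hD[of l] Z.form_self_real[of "h l"] that N by (auto simp: complex_eq_iff)
      then show ?thesis using that by (auto simp: zero_form_def)
    qed
    then have "{..<m} = ?P \<union> ?Q" by auto
    then show ?thesis using card_Un_le[of ?P ?Q] by simp
  qed
  ultimately have "card ?Q = k" by simp
  then show ?thesis using that h rep unfolding N by blast
qed

text \<open>The functions \<open>h l - cutoff (h l)\<close> for the positive members of \<open>h\<close>, together with the cutoffs of \<open>k\<close>
  functions on which the form at \<open>0\<close> is negative, form a family to which \<open>positive_family_bound\<close> applies:
  the first kind has zero data at \<open>0\<close>, the second kind vanishes near infinity.\<close>

lemma defect_lower_bound: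
  assumes c: "c = \<i> \<or> c = -\<i>" and h: "hermitian_form.orth_family DD (inf_form c) N h"
  shows "card {l. l < N \<and> Re (inf_form c (h l) (h l)) > 0} + k \<le> cfun.dim (E c)"
proof -
  let ?P = "{l. l < N \<and> Re (inf_form c (h l) (h l)) > 0}"
  interpret Z: hermitian_form DD "zero_form c" by (rule hermitian_zero_form[OF c])
  interpret G: hermitian_form DD "inf_form c" by (rule hermitian_inf_form[OF c])
  obtain h0 where h0_orth: "Z.orth_family m h0"
    and "\<And>f g. f \<in> DD \<Longrightarrow> g \<in> DD \<Longrightarrow> zero_form c f g = (\<Sum>l<m. zero_form c f (h0 l) * zero_form c (h0 l) g / zero_form c (h0 l) (h0 l))"
    and h0_card: "card {l. l < m \<and> Re (zero_form (-c) (h0 l) (h0 l)) > 0} = k"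
    using zero_form_inertia[OF c] by blast
  let ?Q = "{l. l < m \<and> Re (zero_form (-c) (h0 l) (h0 l)) > 0}"
  have hD: "h i \<in> DD" if "i < N" for i using h that by (auto simp: G.orth_family_def)
  have h0D: "h0 i \<in> DD" if "i < m" for i using h0_orth that by (auto simp: Z.orth_family_def)
  define a where "a l = (\<lambda>x. (-1) * cutoff (h l) x + h l x)" for l
  define b where "b l = cutoff (h0 l)" for l
  have aD: "a l \<in> DD" if "l < N" for l unfolding a_def by (rule Delta_lin[OF cutoff(1) hD[OF that]])
  have bD: "b l \<in> DD" for l unfolding b_def by (rule cutoff(1))
  have aG: "inf_form c (a i) g = inf_form c (h i) g" if "i < N" "g \<in> DD" for i g
    unfolding a_def using G.form_lin[OF cutoff(1) hD[OF that(1)] that(2), of "-1" "h i"] inf_form_cutoff[OF c that(2)] by simp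
  have aG': "inf_form c g (a i) = inf_form c g (h i)" if "i < N" "g \<in> DD" for i g
    unfolding a_def using G.form_lin_right[OF cutoff(1) hD[OF that(1)] that(2), of "-1" "h i"] inf_form_cutoff[OF c that(2)] by simp
  have aa: "inf_form c (a i) (a j) = inf_form c (h i) (h j)" if "i < N" "j < N" for i j
    using aG[OF that(1) aD[OF that(2)]] aG'[OF that(2) hD[OF that(1)]] by simp
  have a_orth: "G.orth_family N a" using h aD aa unfolding G.orth_family_def by simp
  have a0: "D j (a l) 0 = 0" if "l < N" "j < m" for l j
    using D_lin_loc_dom[OF Delta_loc[OF cutoff(1)] Delta_loc[OF hD[OF that(1)]] that(2) order.refl, of "-1" "h l"] cutoff(2)[OF that(2)]
    by (simp add: a_def)
  have bb: "zero_form c (b i) (b j) = zero_form c (h0 i) (h0 j)" if "i < m" "j < m" for i j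
    by (intro zero_form_data bD h0D that) (auto simp: b_def cutoff(2))
  have b_orth: "Z.orth_family m b" using h0_orth bD bb unfolding Z.orth_family_def by simp
  define e where "e p = (case p of Inl l \<Rightarrow> a l | Inr l \<Rightarrow> b l)" for p
  have "card (?P <+> ?Q) \<le> cfun.dim (E c)"
  proof (rule positive_family_bound[OF c, of _ e])
    show "finite (?P <+> ?Q)" by auto
    show "e p \<in> DD" if "p \<in> ?P <+> ?Q" for p using that aD bD by (auto simp: e_def)
    fix x :: "nat + nat \<Rightarrow> complex" assume x: "\<exists>i\<in>?P <+> ?Q. x i \<noteq> 0"
    define u where "u = lcomb ?P (\<lambda>l. x (Inl l)) a"
    define v where "v = lcomb ?Q (\<lambda>l. x (Inr l)) b"
    have fPQ: "finite ?P" "finite ?Q" by auto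
    have uD: "u \<in> DD" unfolding u_def by (rule lcomb_Delta) (use aD in auto)
    have vD: "v \<in> DD" unfolding v_def by (rule lcomb_Delta) (use bD in auto)
    have f: "lcomb (?P <+> ?Q) x e = (\<lambda>t. 1 * u t + v t)"
      unfolding lcomb_def u_def v_def by (simp add: sum.Plus[OF fPQ] e_def)
    have gv: "inf_form c g v = 0" "inf_form c v g = 0" if "g \<in> DD" for g
      unfolding v_def using G.form_lcomb_right[of ?Q b g "\<lambda>l. x (Inr l)"] G.form_lcomb[of ?Q b g "\<lambda>l. x (Inr l)"]
        fPQ(2) bD that inf_form_cutoff[OF c that, folded b_def] by (simp_all add: b_def inf_form_cutoff[OF c that])
    have fD: "(\<lambda>t. 1 * u t + v t) \<in> DD" by (rule Delta_lin[OF uD vD])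
    have "inf_form c (\<lambda>t. 1 * u t + v t) (\<lambda>t. 1 * u t + v t) = inf_form c u u"
      using G.form_lin[OF uD vD fD, of 1] G.form_lin_right[OF uD vD uD, of 1] gv[OF fD] gv[OF uD] by simp
    also have "\<dots> = (\<Sum>i\<in>?P. of_real ((cmod (x (Inl i)))\<^sup>2) * inf_form c (a i) (a i))"
      unfolding u_def by (rule G.form_lcomb_orth[OF a_orth]) auto
    finally have R1: "Re (inf_form c (\<lambda>t. 1 * u t + v t) (\<lambda>t. 1 * u t + v t)) =
       (\<Sum>i\<in>?P. (cmod (x (Inl i)))\<^sup>2 * Re (inf_form c (h i) (h i)))" using aa by (simp add: Re_sum)
    have "zero_form c (\<lambda>t. 1 * u t + v t) (\<lambda>t. 1 * u t + v t) = zero_form c v v"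
    proof (rule zero_form_data[OF fD fD vD vD])
      fix j assume j: "j < m"
      have "D j u 0 = (\<Sum>i\<in>?P. x (Inl i) * D j (a i) 0)" unfolding u_def using aD j by (intro D_lcomb_Delta) auto
      then have "D j u 0 = 0" using a0 j by simp
      then show "D j (\<lambda>t. 1 * u t + v t) 0 = D j v 0"
        using D_lin_loc_dom[OF Delta_loc[OF uD] Delta_loc[OF vD] j order.refl, of 1] by simp
      \<comment> \<open>Both arguments of the form are replaced.\<close>
      then show "D j (\<lambda>t. 1 * u t + v t) 0 = D j v 0" .
    qed
    also have "\<dots> = (\<Sum>i\<in>?Q. of_real ((cmod (x (Inr i)))\<^sup>2) * zero_form c (b i) (b i))"
      unfolding v_def by (rule Z.form_lcomb_orth[OF b_orth]) auto
    finally have R2: "- Re (zero_form c (\<lambda>t. 1 * u t + v t) (\<lambda>t. 1 * u t + v t)) =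
       (\<Sum>i\<in>?Q. (cmod (x (Inr i)))\<^sup>2 * Re (zero_form (-c) (h0 i) (h0 i)))"
      using bb by (simp add: Re_sum zero_form_minus sum_negf)
    have n1: "0 \<le> (\<Sum>i\<in>?P. (cmod (x (Inl i)))\<^sup>2 * Re (inf_form c (h i) (h i)))" by (intro sum_nonneg) auto
    have n2: "0 \<le> (\<Sum>i\<in>?Q. (cmod (x (Inr i)))\<^sup>2 * Re (zero_form (-c) (h0 i) (h0 i)))" by (intro sum_nonneg) auto
    have "0 < (\<Sum>i\<in>?P. (cmod (x (Inl i)))\<^sup>2 * Re (inf_form c (h i) (h i))) +
       (\<Sum>i\<in>?Q. (cmod (x (Inr i)))\<^sup>2 * Re (zero_form (-c) (h0 i) (h0 i)))"
    proof -
      obtain p where p: "p \<in> ?P <+> ?Q" "x p \<noteq> 0" using x by blast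
      show ?thesis
      proof (cases p)
        case (Inl l)
        then have l: "l \<in> ?P" "x (Inl l) \<noteq> 0" using p by auto
        have "0 < (\<Sum>i\<in>?P. (cmod (x (Inl i)))\<^sup>2 * Re (inf_form c (h i) (h i)))"
          by (rule sum_pos2[OF fPQ(1) l(1)]) (use l in auto)
        then show ?thesis using n2 by linarith
      next
        case (Inr l)
        then have l: "l \<in> ?Q" "x (Inr l) \<noteq> 0" using p by auto
        have "0 < (\<Sum>i\<in>?Q. (cmod (x (Inr i)))\<^sup>2 * Re (zero_form (-c) (h0 i) (h0 i)))"
          by (rule sum_pos2[OF fPQ(2) l(1)]) (use l in auto)
        then show ?thesis using n1 by linarith
      qed
    qed
    then show "0 < Re (inf_form c (lcomb (?P <+> ?Q) x e) (lcomb (?P <+> ?Q) x e) - zero_form c (lcomb (?P <+> ?Q) x e) (lcomb (?P <+> ?Q) x e))"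
      unfolding f using R1 R2 by simp
  qed
  then show ?thesis using h0_card by (simp add: card_Plus)
qed

text \<open>Otherwise some nonzero \<open>f\<close> in \<open>E c\<close> is orthogonal at infinity to the positive members of \<open>h\<close>, and at \<open>0\<close>
  to \<open>k\<close> members, those on which the form is negative, of a maximal family. Then \<open>inf_form\<close> is \<open>\<le> 0\<close> and
  \<open>zero_form\<close> is \<open>\<ge> 0\<close> at \<open>f\<close>, against \<open>defect_energy\<close>.\<close>

lemma defect_upper_bound:
  assumes c: "c = \<i> \<or> c = -\<i>" and h: "hermitian_form.orth_family DD (inf_form c) N h"
    and rep: "\<And>f g. f \<in> DD \<Longrightarrow> g \<in> DD \<Longrightarrow> inf_form c f g = (\<Sum>l<N. inf_form c f (h l) * inf_form c (h l) g / inf_form c (h l) (h l))"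
  shows "cfun.dim (E c) \<le> card {l. l < N \<and> Re (inf_form c (h l) (h l)) > 0} + k"
proof (rule ccontr)
  let ?P = "{l. l < N \<and> Re (inf_form c (h l) (h l)) > 0}"
  have c': "-c = \<i> \<or> -c = -\<i>" using c by auto
  interpret Z: hermitian_form DD "zero_form c" by (rule hermitian_zero_form[OF c])
  interpret Z': hermitian_form DD "zero_form (-c)" by (rule hermitian_zero_form[OF c'])
  interpret G: hermitian_form DD "inf_form c" by (rule hermitian_inf_form[OF c])
  obtain h0 where h0: "Z.orth_family m h0"
     "\<And>f g. f \<in> DD \<Longrightarrow> g \<in> DD \<Longrightarrow> zero_form c f g = (\<Sum>l<m. zero_form c f (h0 l) * zero_form c (h0 l) g / zero_form c (h0 l) (h0 l))"
     "card {l. l < m \<and> Re (zero_form (-c) (h0 l) (h0 l)) > 0} = k"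
    using zero_form_inertia[OF c] by blast
  let ?Q = "{l. l < m \<and> Re (zero_form (-c) (h0 l) (h0 l)) > 0}"
  have hD: "h i \<in> DD" if "i < N" for i using h that by (auto simp: G.orth_family_def)
  have h0D: "h0 i \<in> DD" if "i < m" for i using h0 that by (auto simp: Z.orth_family_def)
  assume neg: "\<not> cfun.dim (E c) \<le> card ?P + k"
  obtain B where B: "finite B" "B \<subseteq> E c" "card B = cfun.dim (E c)" "card B \<le> m"
    "\<And>x. lcomb B x (\<lambda>v. v) = (\<lambda>_. 0) \<Longrightarrow> (\<forall>v\<in>B. x v = 0)"
    "\<And>f. f \<in> E c \<Longrightarrow> \<exists>x. f = lcomb B x (\<lambda>v. v)"
    using defect_basis[OF c] by blast
  have BD: "v \<in> DD" if "v \<in> B" for v using B(2) that by (auto simp: defect_iff)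
  have fin: "finite (?P <+> ?Q)" "card (?P <+> ?Q) < card B"
    using neg B(3) h0(3) by (auto simp: card_Plus)
  \<comment> \<open>The first kind of condition refers to infinity, the second to \<open>0\<close>.\<close>
  define A where "A p v = (case p of Inl l \<Rightarrow> inf_form c v (h l) | Inr l \<Rightarrow> zero_form (-c) v (h0 l))" for p v
  obtain x where x: "\<exists>v\<in>B. x v \<noteq> 0" "\<forall>p\<in>?P <+> ?Q. (\<Sum>v\<in>B. A p v * x v) = 0"
    using underdetermined_system[OF fin(1) B(1) fin(2), of A] by blast
  define f where "f = lcomb B x (\<lambda>v. v)"
  have fE: "f \<in> E c" unfolding f_def
    using B(1,2) by (intro lcomb_closed[where P = "\<lambda>f. f \<in> E c"] defect_zero defect_lin) auto
  then have fD: "f \<in> DD" by (simp add: defect_iff)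
  have "inf_form c f (h l) = 0" if "l \<in> ?P" for l
  proof -
    have "(\<Sum>v\<in>B. A (Inl l) v * x v) = 0" using x(2) that by blast
    moreover have "inf_form c f (h l) = (\<Sum>v\<in>B. x v * inf_form c v (h l))"
      unfolding f_def by (rule G.form_lcomb[OF B(1) BD]) (use that hD in auto)
    ultimately show ?thesis by (simp add: A_def mult.commute)
  qed
  then have 1: "Re (inf_form c f f) \<le> 0" by (intro G.form_nonpos_on_positive_complement[OF h rep fD]) auto
  have z0: "zero_form (-c) f (h0 l) = 0" if "l \<in> ?Q" for l
  proof -
    have "(\<Sum>v\<in>B. A (Inr l) v * x v) = 0" using x(2) that by blast
    moreover have "zero_form (-c) f (h0 l) = (\<Sum>v\<in>B. x v * zero_form (-c) v (h0 l))"
      unfolding f_def by (rule Z'.form_lcomb[OF B(1) BD]) (use that h0D in auto)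
    ultimately show ?thesis by (simp add: A_def mult.commute)
  qed
  have h0': "Z'.orth_family m h0" using orth_family_minus(1)[OF c] h0(1) by blast
  have minus: "zero_form (-c) f g = - zero_form c f g" for f g by (simp add: zero_form_def)
  have "Re (zero_form (-c) f f) \<le> 0"
  proof (rule Z'.form_nonpos_on_positive_complement[OF h0' _ fD])
    show "zero_form (-c) f g = (\<Sum>l<m. zero_form (-c) f (h0 l) * zero_form (-c) (h0 l) g / zero_form (-c) (h0 l) (h0 l))"
      if "f \<in> DD" "g \<in> DD" for f g
      unfolding minus h0(2)[OF that] by (simp add: sum_negf)
  qed (use z0 in auto)
  then have "Re (inf_form c f f - zero_form c f f) \<le> 0" using 1 by (simp add: zero_form_def)
  then have "f = (\<lambda>_. 0)" by (rule defect_energy[OF c fE])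
  then show False using B(5) x(1) unfolding f_def by blast
qed

text \<open>One maximal orthogonal family for the form at infinity serves \<open>c = \<i>\<close> and \<open>c = - \<i>\<close>: its positive
  members number \<open>N\<^sub>+ - k\<close> and its negative ones \<open>N\<^sub>- - k\<close>. By the expansion along the family, the form has
  rank \<open>N\<close>.\<close>

theorem boundary_form_rank:
  obtains N h a b where "a \<le> k" "b \<le> k" "N = a + b"
    "cfun.dim (E \<i>) = k + a" "cfun.dim (E (-\<i>)) = k + b"
    "\<And>i. i < N \<Longrightarrow> h i \<in> DD"
    "\<And>i. i < N \<Longrightarrow> green_form_inf k s q (h i) (h i) \<noteq> 0"
    "\<And>i j. i < N \<Longrightarrow> j < N \<Longrightarrow> i \<noteq> j \<Longrightarrow> green_form_inf k s q (h i) (h j) = 0"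
    "\<And>f g. f \<in> DD \<Longrightarrow> g \<in> DD \<Longrightarrow> green_form_inf k s q f g =
       (\<Sum>l<N. green_form_inf k s q f (h l) * (green_form_inf k s q (h l) g / green_form_inf k s q (h l) (h l)))"
proof -
  have c: "\<i> = \<i> \<or> \<i> = -\<i>" and c': "-\<i> = \<i> \<or> -\<i> = -\<i>" by auto
  interpret G: hermitian_form DD "inf_form \<i>" by (rule hermitian_inf_form[OF c])
  have split: "card {l. l < N \<and> Re (inf_form \<i> (h l) (h l)) > 0} + card {l. l < N \<and> Re (inf_form (-\<i>) (h l) (h l)) > 0} = N"
    if h: "G.orth_family N h" for N h
  proof -
    have "Re (inf_form \<i> (h l) (h l)) \<noteq> 0" if "l < N" for l
      using h that G.form_self_real[of "h l"] by (auto simp: complex_eq_iff G.orth_family_def)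
    then have "{..<N} = {l. l < N \<and> Re (inf_form \<i> (h l) (h l)) > 0} \<union> {l. l < N \<and> Re (inf_form (-\<i>) (h l) (h l)) > 0}"
      by (force simp: inf_form_def)
    moreover have "{l. l < N \<and> Re (inf_form \<i> (h l) (h l)) > 0} \<inter> {l. l < N \<and> Re (inf_form (-\<i>) (h l) (h l)) > 0} = {}"
      by (auto simp: inf_form_def)
    ultimately have "card {..<N} = card {l. l < N \<and> Re (inf_form \<i> (h l) (h l)) > 0} + card {l. l < N \<and> Re (inf_form (-\<i>) (h l) (h l)) > 0}"
      by (metis (no_types, lifting) card_Un_disjoint finite_Un finite_lessThan)
    then show ?thesis by simp
  qed
  have bound: "N \<le> cfun.dim (E \<i>) + cfun.dim (E (-\<i>))" if h: "G.orth_family N h" for N h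
    using split[OF h] defect_lower_bound[OF c h] defect_lower_bound[OF c', of N h] orth_family_minus(2)[OF c] h by simp
  obtain N h where h: "G.orth_family N h"
    and rep: "\<And>f g. f \<in> DD \<Longrightarrow> g \<in> DD \<Longrightarrow> inf_form \<i> f g = (\<Sum>l<N. inf_form \<i> f (h l) * inf_form \<i> (h l) g / inf_form \<i> (h l) (h l))"
    using G.maximal_orth_family[of "cfun.dim (E \<i>) + cfun.dim (E (-\<i>))"] bound by blast
  have h': "hermitian_form.orth_family DD (inf_form (-\<i>)) N h" using orth_family_minus(2)[OF c] h by simp
  have rep': "inf_form (-\<i>) f g = (\<Sum>l<N. inf_form (-\<i>) f (h l) * inf_form (-\<i>) (h l) g / inf_form (-\<i>) (h l) (h l))"
    if "f \<in> DD" "g \<in> DD" for f g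
  proof -
    have minus: "inf_form (-\<i>) f g = - inf_form \<i> f g" for f g by (simp add: inf_form_def)
    show ?thesis unfolding minus rep[OF that] by (simp add: sum_negf)
  qed
  define a where "a = card {l. l < N \<and> Re (inf_form \<i> (h l) (h l)) > 0}"
  define b where "b = card {l. l < N \<and> Re (inf_form (-\<i>) (h l) (h l)) > 0}"
  have a: "cfun.dim (E \<i>) = k + a"
    using defect_lower_bound[OF c h] defect_upper_bound[OF c h rep] by (simp add: a_def)
  have b: "cfun.dim (E (-\<i>)) = k + b"
    using defect_lower_bound[OF c' h'] defect_upper_bound[OF c' h' rep'] by (simp add: b_def)
  have "cfun.dim (E \<i>) \<le> m" "cfun.dim (E (-\<i>)) \<le> m"
    using defect_basis[OF c] defect_basis[OF c'] by metis+
  then have ab: "a \<le> k" "b \<le> k" using a b by auto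
  have N: "N = a + b" using split[OF h] by (simp add: a_def b_def)
  have G: "green_form_inf k s q f g = \<i> * inf_form \<i> f g" for f g by (simp add: inf_form_def)
  show ?thesis
  proof (rule that[OF ab N a b])
    show "green_form_inf k s q f g = (\<Sum>l<N. green_form_inf k s q f (h l) * (green_form_inf k s q (h l) g / green_form_inf k s q (h l) (h l)))"
      if "f \<in> DD" "g \<in> DD" for f g
      unfolding G rep[OF that] sum_distrib_left by (intro sum.cong refl) simp
  qed (use h in \<open>auto simp: G.orth_family_def G\<close>)
qed

end

section \<open>The determinant criterion\<close>

theorem theorem2p1:
  fixes k :: nat and s q :: "nat \<Rightarrow> real \<Rightarrow> real"
  assumes "k \<ge> 1"
    and "\<And>r. r \<le> k \<Longrightarrow> C_half r (s r)"
    and "\<And>r. r < k \<Longrightarrow> C_half (r + 1) (q r)"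
    and "\<And>x. x \<ge> 0 \<Longrightarrow> s k x > 0"
  shows
    "(\<forall>a b n. a \<le> k \<and> b \<le> k \<and> n = a + b \<and> limit_case k s q (k + a) (k + b) \<longrightarrow>
        (\<forall>f g. (\<forall>i<n+1. f i \<in> Delta k s q \<and> g i \<in> Delta k s q) \<longrightarrow>
           green_det k s q (n + 1) f g = 0))
     \<and>
     (\<forall>n\<le>2*k.
        (\<forall>f g. (\<forall>i<n+1. f i \<in> Delta k s q \<and> g i \<in> Delta k s q) \<longrightarrow>
           green_det k s q (n + 1) f g = 0) \<longrightarrow>
        (\<exists>a b. a \<le> k \<and> b \<le> k \<and> a + b \<le> n \<and> limit_case k s q (k + a) (k + b) \<and>
           ((\<exists>f g. (\<forall>i<n. f i \<in> Delta k s q \<and> g i \<in> Delta k s q) \<and>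
               green_det k s q n f g \<noteq> 0) \<longrightarrow> a + b = n)))"
proof -
  interpret symmetric_expr k s q by unfold_locales (use assms in auto)
  obtain N h a b where ab: "a \<le> k" "b \<le> k" "N = a + b"
    and dims: "cfun.dim (E \<i>) = k + a" "cfun.dim (E (-\<i>)) = k + b"
    and h: "\<And>i. i < N \<Longrightarrow> h i \<in> DD" "\<And>i. i < N \<Longrightarrow> green_form_inf k s q (h i) (h i) \<noteq> 0"
      "\<And>i j. i < N \<Longrightarrow> j < N \<Longrightarrow> i \<noteq> j \<Longrightarrow> green_form_inf k s q (h i) (h j) = 0"
    and rep: "\<And>f g. f \<in> DD \<Longrightarrow> g \<in> DD \<Longrightarrow> green_form_inf k s q f g =
       (\<Sum>l<N. green_form_inf k s q f (h l) * (green_form_inf k s q (h l) g / green_form_inf k s q (h l) (h l)))"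
    by (rule boundary_form_rank, (rule that; assumption))
  \<comment> \<open>Above the rank determinants vanish, up to the rank those of the family
      \<open>h\<close> do not.\<close>
  have big: "green_det k s q n f g = 0" if "N < n" "\<And>i. i < n \<Longrightarrow> f i \<in> DD \<and> g i \<in> DD" for n f g
    unfolding green_det_def
    by (rule det_low_rank_eq_0[OF that(1), where B = "\<lambda>i l. green_form_inf k s q (f i) (h l)" and
          C = "\<lambda>l j. green_form_inf k s q (h l) (g j) / green_form_inf k s q (h l) (h l)"])
       (rule rep, use that(2) in auto)
  have small: "green_det k s q n h h \<noteq> 0" if "n \<le> N" for n
    unfolding green_det_def by (rule det_diagonal_neq_0) (use h that in auto)
  have case_ab: "limit_case k s q (k + a) (k + b)" using dims by (simp add: limit_case_def)
  show ?thesis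
  proof (intro conjI allI impI)
    fix a' b' n f g
    assume "a' \<le> k \<and> b' \<le> k \<and> n = a' + b' \<and> limit_case k s q (k + a') (k + b')"
      and fg: "\<forall>i<n+1. f i \<in> DD \<and> g i \<in> DD"
    then have "n = N" using dims ab by (simp add: limit_case_def)
    then show "green_det k s q (n + 1) f g = 0" using fg by (intro big) auto
  next
    fix n
    assume "n \<le> 2*k" and van: "\<forall>f g. (\<forall>i<n+1. f i \<in> DD \<and> g i \<in> DD) \<longrightarrow> green_det k s q (n + 1) f g = 0"
    have le: "a + b \<le> n"
    proof (rule ccontr)
      assume "\<not> a + b \<le> n"
      then have "n + 1 \<le> N" using ab by simp
      then show False using small[of "n+1"] van h(1) by auto
    qed
    have "a + b = n" if "\<exists>f g. (\<forall>i<n. f i \<in> DD \<and> g i \<in> DD) \<and> green_det k s q n f g \<noteq> 0"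
      using that big[of n] le ab(3) by (metis le_neq_implies_less)
    then show "\<exists>a b. a \<le> k \<and> b \<le> k \<and> a + b \<le> n \<and> limit_case k s q (k + a) (k + b) \<and>
           ((\<exists>f g. (\<forall>i<n. f i \<in> DD \<and> g i \<in> DD) \<and> green_det k s q n f g \<noteq> 0) \<longrightarrow> a + b = n)"
      using ab case_ab le by blast
  qed
qed

end
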